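(* Let $K\subset\mathbb{R}^3$ be a convex body with a $C^2$-differentiable boundary and let $\alpha>0$. Suppose that through every $p\in\mathrm{bd}\,K$ there are four planes $H_{p_1},H_{p_2},H_{p_3},H_{p_4}$ (each containing $p$) satisfying: (i) for $j=1,2,3,4$, $H_{p_j}\cap\mathrm{bd}\,K$ is an ellipse $E_{p_j}$ of area greater than $\alpha$; (ii) for $1\le i<j\le 4$, the ellipses $E_{p_i}$ and $E_{p_j}$ are not tangent. Then $\mathrm{bd}\,K$ is an ellipsoid.
   Context: A convex body in $\mathbb{R}^3$ is a compact convex set with nonempty interior; $\mathrm{bd}\,K$ denotes its boundary. "$C^2$-differentiable boundary" means that $\mathrm{bd}\,K$ is a $C^2$ embedded surface. The area of an ellipse is the area of the planar region it bounds; circles count as ellipses. Two of the ellipses $E_{p_i},E_{p_j}$, which both pass through $p$, are tangent if they have the same tangent line at $p$; they are not tangent exactly when the planes $H_{p_i}$ and $H_{p_j}$ are distinct and the line $H_{p_i}\cap H_{p_j}$ meets the interior of $K$. An ellipsoid here means the surface (boundary of a solid ellipsoid). *)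

theory Defs
  imports "HOL-Analysis.Analysis"
begin

definition convex_body :: "'a::euclidean_space set \<Rightarrow> bool" where
  "convex_body K \<longleftrightarrow> compact K \<and> convex K \<and> interior K \<noteq> {}"

(* f' and f'' are the first and second Frechet derivatives of f, as maps into spaces of
   bounded linear operators with the operator norm. *)
definition C2_on :: "('a::real_normed_vector \<Rightarrow> 'b::real_normed_vector) \<Rightarrow> 'a set \<Rightarrow> bool" where
  "C2_on f U \<longleftrightarrow> open U \<and>
     (\<exists>(f' :: 'a \<Rightarrow> 'a \<Rightarrow>\<^sub>L 'b) (f'' :: 'a \<Rightarrow> 'a \<Rightarrow>\<^sub>L ('a \<Rightarrow>\<^sub>L 'b)).
        (\<forall>x\<in>U. (f has_derivative blinfun_apply (f' x)) (at x)) \<and>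
        (\<forall>x\<in>U. (f' has_derivative blinfun_apply (f'' x)) (at x)) \<and>
        continuous_on U f'')"

(* Around each point, S has a regular C2 parametrization that is a homeomorphism onto a
   relatively open subset of S. *)
definition C2_embedded_surface :: "(real^3) set \<Rightarrow> bool" where
  "C2_embedded_surface S \<longleftrightarrow>
     (\<forall>p\<in>S. \<exists>V U (\<phi> :: real^2 \<Rightarrow> real^3) \<psi>.
        open V \<and> p \<in> V \<and> C2_on \<phi> U \<and> homeomorphism U (S \<inter> V) \<phi> \<psi> \<and>
        (\<forall>u\<in>U. inj (frechet_derivative \<phi> (at u))))"

definition plane :: "(real^3) set \<Rightarrow> bool" where
  "plane H \<longleftrightarrow> affine H \<and> aff_dim H = 2"

(* Nondegenerate affine images of the unit circle. *)
definition ellipse :: "(real^3) set \<Rightarrow> bool" where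
  "ellipse E \<longleftrightarrow>
     (\<exists>c (L :: real^2 \<Rightarrow> real^3). linear L \<and> inj L \<and> E = (\<lambda>x. c + L x) ` sphere 0 1)"

(* The area of the region that a planar curve E bounds in its plane, computed in Cartesian
   coordinates f of that plane. If E is not contained in a line, the plane is determined by E
   and the value does not depend on the chosen f. *)
definition enclosed_area :: "(real^3) set \<Rightarrow> real" where
  "enclosed_area E =
     (let f = (SOME f :: real^2 \<Rightarrow> real^3. (\<forall>x y. dist (f x) (f y) = dist x y) \<and> E \<subseteq> range f)
      in measure lebesgue (inside (f -` E)))"

(* The union of all tangents at p to differentiable motions within E; for a smooth curve E
   and p in E this is the usual tangent line. *)
definition tangent_line :: "'a::real_normed_vector set \<Rightarrow> 'a \<Rightarrow> 'a set" where
  "tangent_line E p =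
     {p + v | v. \<exists>\<gamma> :: real \<Rightarrow> 'a. (\<forall>t. \<gamma> t \<in> E) \<and> \<gamma> 0 = p \<and>
                   (\<gamma> has_vector_derivative v) (at 0)}"

definition tangent_at :: "'a::real_normed_vector \<Rightarrow> 'a set \<Rightarrow> 'a set \<Rightarrow> bool" where
  "tangent_at p E F \<longleftrightarrow> p \<in> E \<and> p \<in> F \<and> tangent_line E p = tangent_line F p"

(* Nondegenerate affine images of the closed unit ball. *)
definition solid_ellipsoid :: "(real^3) set \<Rightarrow> bool" where
  "solid_ellipsoid B \<longleftrightarrow>
     (\<exists>c (L :: real^3 \<Rightarrow> real^3). linear L \<and> inj L \<and> B = (\<lambda>x. c + L x) ` cball 0 1)"

definition ellipsoid :: "(real^3) set \<Rightarrow> bool" where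
  "ellipsoid S \<longleftrightarrow> (\<exists>B. solid_ellipsoid B \<and> S = frontier B)"

end

theory Submission
  imports Defs "HOL-Computational_Algebra.Polynomial"
begin

text \<open>
  Near each boundary point \<open>p\<close> the surface is shown to lie on a quadric; connectedness then makes
  this one quadric for the whole boundary, and a convex body bounded by a quadric is an ellipsoid.

  The engine is a zero count. A quadratic polynomial restricted to an ellipse is a trigonometric
  polynomial of degree 2, so five zeros, counted with multiplicity, make it vanish there
  (lemmas \<open>quad_0_on_ell_five_zeros\<close>, \<open>quad_0_on_ell_double\<close>, \<open>quad_0_on_ell_triple\<close> and
  \<open>quad_0_on_ell_triple_double\<close>).

  Two non-tangent sections \<open>E\<^sub>i\<close>, \<open>E\<^sub>j\<close> through \<open>p\<close> meet in exactly one further point \<open>q\<^sub>i\<^sub>j\<close>, and they are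
  not tangent there either. Quadratic polynomials form a space of dimension 10. Six linear
  conditions make a polynomial vanish to third order at \<open>p\<close> along \<open>E\<^sub>1\<close>, \<open>E\<^sub>2\<close> and \<open>E\<^sub>3\<close>, and three more
  make it vanish at \<open>q\<^sub>1\<^sub>2\<close>, \<open>q\<^sub>1\<^sub>3\<close> and \<open>q\<^sub>2\<^sub>3\<close> (or to second order at this point if the three coincide).
  Hence some nonzero \<open>Q\<close> vanishes on all three ellipses (lemma \<open>quad_through_three_sections\<close>).
  Here the \<open>C\<^sup>2\<close> hypothesis enters: a quadratic form in the tangent directions governs the second
  order behaviour of the surface at \<open>p\<close>, and agreement in three directions forces \<open>Q\<close> to vanish to
  third order at \<open>p\<close> along every ellipse in the surface through \<open>p\<close> (lemma \<open>contact_of_quad\<close>). In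
  particular \<open>Q\<close> vanishes on \<open>E\<^sub>4\<close>, which it meets again at \<open>q\<^sub>1\<^sub>4\<close> and \<open>q\<^sub>2\<^sub>4\<close>.

  Suppose that boundary points \<open>q\<close> off the quadric accumulate at \<open>p\<close>. Each lies on a section ellipse \<open>F\<close> of
  area greater than \<open>\<alpha>\<close>; by compactness these ellipses converge, and the lower bound on the area
  keeps the limit nondegenerate. The limit does not lie in the supporting plane at \<open>p\<close>, because
  otherwise the second order form would vanish in every direction, whereas \<open>E\<^sub>1\<close> has positive
  curvature. So the limit is transversal at \<open>p\<close> to at least three of the four \<open>E\<^sub>i\<close>, and nearby \<open>F\<close>
  crosses each of these three once near \<open>p\<close> and once away from \<open>p\<close>. This yields five zeros of \<open>Q\<close>
  on \<open>F\<close>, so \<open>Q\<close> vanishes at \<open>q\<close> after all (lemma \<open>quad_0_near\<close>). Four sections are asked for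
  because the limit can be tangent to one of them.

  Finally a quadric through three pairwise non-tangent sections is unique
  (lemma \<open>quadric_through_three_sections_unique\<close>), so the quadric is a locally constant function of
  the boundary point.
\<close>

unbundle cross3_syntax

section \<open>Vectors in space\<close>

lemma cross_span:
  fixes a b v :: "real^3"
  assumes "a \<times> b \<noteq> 0" and "(a \<times> b) \<bullet> v = 0"
  obtains x y where "v = x *\<^sub>R a + y *\<^sub>R b"
proof -
  define N where "N = a \<times> b"
  have Na: "N \<times> a = (a \<bullet> a) *\<^sub>R b - (a \<bullet> b) *\<^sub>R a"
    unfolding N_def by (subst cross_skew) (simp add: Lagrange)
  have Nb: "N \<times> b = (b \<bullet> a) *\<^sub>R b - (b \<bullet> b) *\<^sub>R a"
    unfolding N_def by (subst cross_skew) (simp add: Lagrange)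
  \<comment> \<open>The double product \<open>N \<times> (v \<times> N)\<close> is a multiple of \<open>v\<close>, and by Lagrange's identity it lies in the span of \<open>a\<close> and \<open>b\<close>.\<close>
  have "N \<times> (v \<times> N) = (N \<bullet> N) *\<^sub>R v"
    using assms by (subst Lagrange) (simp add: N_def inner_commute)
  moreover have "v \<times> N = (v \<bullet> b) *\<^sub>R a - (v \<bullet> a) *\<^sub>R b"
    unfolding N_def by (simp add: Lagrange)
  ultimately have "(N \<bullet> N) *\<^sub>R v = (v \<bullet> b) *\<^sub>R (N \<times> a) - (v \<bullet> a) *\<^sub>R (N \<times> b)"
    by (simp add: Cross3.right_diff_distrib cross_mult_right)
  also have "\<dots> = ((v \<bullet> a) * (b \<bullet> b) - (v \<bullet> b) * (a \<bullet> b)) *\<^sub>R a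
                 + ((v \<bullet> b) * (a \<bullet> a) - (v \<bullet> a) * (a \<bullet> b)) *\<^sub>R b"
    unfolding Na Nb by (simp add: algebra_simps inner_commute)
  finally have eq: "(N \<bullet> N) *\<^sub>R v = \<dots>" .
  have "N \<bullet> N \<noteq> 0" using assms by (simp add: N_def)
  then have "v = (1 / (N \<bullet> N)) *\<^sub>R ((N \<bullet> N) *\<^sub>R v)" by simp
  then show ?thesis using that unfolding eq by (simp add: scaleR_add_right)
qed

lemma cross_eq_0_imp_scale:
  fixes v w :: "real^3"
  assumes "v \<times> w = 0" "v \<noteq> 0"
  obtains s where "w = s *\<^sub>R v"
proof -
  have "(v \<bullet> w) *\<^sub>R v - (v \<bullet> v) *\<^sub>R w = 0"
    using Lagrange[of v v w] assms by simp
  then have "(v \<bullet> v) *\<^sub>R w = (v \<bullet> w) *\<^sub>R v" by simp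
  then have "(1 / (v \<bullet> v)) *\<^sub>R ((v \<bullet> v) *\<^sub>R w) = ((v \<bullet> w) / (v \<bullet> v)) *\<^sub>R v"
    by simp
  then have "w = ((v \<bullet> w) / (v \<bullet> v)) *\<^sub>R v" using assms(2) by simp
  then show ?thesis using that by blast
qed

text \<open>
  Two independent vectors orthogonal to \<open>n\<close> span the plane orthogonal to \<open>n\<close>; this is the form in
  which tangent planes are used throughout.
\<close>
lemma orthogonal_span:
  fixes n b c v :: "real^3"
  assumes "n \<noteq> 0" "n \<bullet> b = 0" "n \<bullet> c = 0" "b \<times> c \<noteq> 0" "n \<bullet> v = 0"
  obtains x y where "v = x *\<^sub>R b + y *\<^sub>R c"
proof -
  have "n \<times> (b \<times> c) = 0" using assms by (simp add: Lagrange)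
  then obtain s where "b \<times> c = s *\<^sub>R n" using cross_eq_0_imp_scale assms(1) by blast
  then have "(b \<times> c) \<bullet> v = 0" using assms(5) by simp
  then show ?thesis using cross_span[OF assms(4)] that by blast
qed

lemma cross_indep:
  fixes a b :: "real^3"
  assumes "a \<times> b \<noteq> 0" "x *\<^sub>R a + y *\<^sub>R b = 0"
  shows "x = 0" "y = 0"
proof -
  have "(x *\<^sub>R a + y *\<^sub>R b) \<times> b = x *\<^sub>R (a \<times> b)" "a \<times> (x *\<^sub>R a + y *\<^sub>R b) = y *\<^sub>R (a \<times> b)"
    by (simp_all add: cross_add_left cross_add_right cross_mult_left cross_mult_right)
  then show "x = 0" "y = 0" using assms by auto
qed

lemma cross_combination:
  "(x *\<^sub>R a + y *\<^sub>R b) \<times> (s *\<^sub>R a + t *\<^sub>R b) = (x * t - y * s) *\<^sub>R (a \<times> b)"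
  by (simp add: cross_add_left cross_add_right cross_mult_left cross_mult_right cross_skew[of b a] scaleR_left_diff_distrib mult.commute)

lemma cross_both_orthogonal:
  fixes v w M N :: "real^3"
  assumes "M \<times> N \<noteq> 0" "M \<bullet> v = 0" "N \<bullet> v = 0" "M \<bullet> w = 0" "N \<bullet> w = 0"
  shows "v \<times> w = 0"
proof -
  have "(M \<times> N) \<times> v = 0" "(M \<times> N) \<times> w = 0"
    using assms cross_skew[of "M \<times> N" v] cross_skew[of "M \<times> N" w] by (simp_all add: Lagrange inner_commute)
  obtain s where "v = s *\<^sub>R (M \<times> N)"
    by (rule cross_eq_0_imp_scale[OF \<open>(M \<times> N) \<times> v = 0\<close> assms(1)])
  moreover obtain t where "w = t *\<^sub>R (M \<times> N)"
    by (rule cross_eq_0_imp_scale[OF \<open>(M \<times> N) \<times> w = 0\<close> assms(1)])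
  ultimately show ?thesis by (simp add: cross_mult_left cross_mult_right)
qed

section \<open>Quadratic polynomials in three variables\<close>

text \<open>
  Coefficients of a polynomial of degree at most 2: the constant term, the linear terms, the squares and
  the mixed products. As a Euclidean space of dimension 10 this type makes linear conditions on
  a polynomial into orthogonality conditions on its coefficients.
\<close>
type_synonym qcoef = "real \<times> (real^3) \<times> (real^3) \<times> (real^3)"

definition monomials :: "real^3 \<Rightarrow> qcoef" where
  "monomials x = (1, x, (\<chi> i. x$i * x$i), vector [x$2 * x$3, x$3 * x$1, x$1 * x$2])"

definition monomials_polar :: "real^3 \<Rightarrow> real^3 \<Rightarrow> qcoef" where
  "monomials_polar v w = (0, 0, (\<chi> i. 2 * v$i * w$i),
     vector [v$2 * w$3 + v$3 * w$2, v$3 * w$1 + v$1 * w$3, v$1 * w$2 + v$2 * w$1])"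

definition quad :: "qcoef \<Rightarrow> real^3 \<Rightarrow> real" where
  "quad C x = C \<bullet> monomials x"

text \<open>
  The symmetric bilinear form whose diagonal is twice the homogeneous quadratic part.
\<close>
definition polar :: "qcoef \<Rightarrow> real^3 \<Rightarrow> real^3 \<Rightarrow> real" where
  "polar C v w = C \<bullet> monomials_polar v w"

definition quad_deriv :: "qcoef \<Rightarrow> real^3 \<Rightarrow> real^3 \<Rightarrow> real" where
  "quad_deriv C x v = C \<bullet> ((0, v, 0, 0) + monomials_polar x v)"

lemmas quad_defs = quad_def polar_def quad_deriv_def monomials_def monomials_polar_def

lemma quad_taylor: "quad C (x + v) = quad C x + quad_deriv C x v + polar C v v / 2"
  by (cases C) (simp add: quad_defs inner_vec_def sum_3 algebra_simps)

lemma quad_deriv_add_base: "quad_deriv C (x + v) w = quad_deriv C x w + polar C v w"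
  by (cases C) (simp add: quad_defs inner_vec_def sum_3 algebra_simps)

lemma linear_quad_deriv: "linear (quad_deriv C x)"
  by (rule linearI; cases C) (simp_all add: quad_defs inner_vec_def sum_3 algebra_simps)

lemma polar_commute: "polar C v w = polar C w v"
  by (cases C) (simp add: quad_defs inner_vec_def sum_3 algebra_simps)

lemma bilinear_polar: "bilinear (polar C)"
  unfolding bilinear_def
  by (intro conjI allI linearI; cases C) (simp_all add: quad_defs inner_vec_def sum_3 algebra_simps)

lemmas quad_deriv_simps = linear_add[OF linear_quad_deriv] linear_diff[OF linear_quad_deriv]
  linear_scale[OF linear_quad_deriv] linear_neg[OF linear_quad_deriv] linear_0[OF linear_quad_deriv]

lemmas polar_simps = bilinear_ladd[OF bilinear_polar] bilinear_radd[OF bilinear_polar]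
  bilinear_lsub[OF bilinear_polar] bilinear_rsub[OF bilinear_polar]
  bilinear_lmul[OF bilinear_polar] bilinear_rmul[OF bilinear_polar]
  bilinear_lneg[OF bilinear_polar] bilinear_rneg[OF bilinear_polar]

lemma quad_ray: "quad C (x + t *\<^sub>R v) = quad C x + t * quad_deriv C x v + t\<^sup>2 * (polar C v v / 2)"
  by (simp add: quad_taylor quad_deriv_simps polar_simps power2_eq_square)

lemma quad_scale_add: "quad (s *\<^sub>R C + t *\<^sub>R C') x = s * quad C x + t * quad C' x"
  by (simp add: quad_def inner_add_left)

lemma quad_deriv_scale_add: "quad_deriv (s *\<^sub>R C + t *\<^sub>R C') x v = s * quad_deriv C x v + t * quad_deriv C' x v"
  by (simp add: quad_deriv_def inner_add_left)

lemma quad_minus: "quad (- C) x = - quad C x"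
  by (simp add: quad_def)

lemma quad_eq_0_imp:
  assumes "\<And>x. quad C x = 0"
  shows "C = 0"
proof -
  obtain k w d e where C: "C = (k, w, d, e)" by (cases C)
  have q: "k + (w$1*x + w$2*y + w$3*z) + (d$1*x*x + d$2*y*y + d$3*z*z) + (e$1*y*z + e$2*z*x + e$3*x*y) = 0"
    for x y z
    using assms[of "vector [x,y,z]"] by (simp add: C quad_defs inner_vec_def sum_3 algebra_simps)
  \<comment> \<open>Ten points that determine the ten coefficients.\<close>
  note q[of 0 0 0] q[of 1 0 0] q[of "-1" 0 0] q[of 0 1 0] q[of 0 "-1" 0] q[of 0 0 1] q[of 0 0 "-1"]
       q[of 1 1 0] q[of 0 1 1] q[of 1 0 1]
  then have "k = 0" "w$1 = 0" "w$2 = 0" "w$3 = 0" "d$1 = 0" "d$2 = 0" "d$3 = 0" "e$1 = 0" "e$2 = 0" "e$3 = 0"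
    by simp_all
  then show ?thesis by (simp add: C vec_eq_iff forall_3 zero_prod_def)
qed

lemma quad_0_on_open_imp:
  assumes "open U" "o' \<in> U" "\<And>x. x \<in> U \<Longrightarrow> quad C x = 0"
  shows "C = 0"
proof (rule quad_eq_0_imp)
  fix x
  obtain e where e: "e > 0" "ball o' e \<subseteq> U" using assms(1,2) open_contains_ball by blast
  define v where "v = x - o'"
  \<comment> \<open>On the line through \<open>o'\<close> and \<open>x\<close> three zeros inside \<open>U\<close> suffice; \<open>t\<close> is small enough to stay in the ball.\<close>
  define t where "t = e / (2 * (norm v + 1))"
  have pn: "norm v + 1 > 0" by (simp add: add_nonneg_pos)
  have t: "t > 0" using e(1) pn by (simp add: t_def)
  have "t * norm v \<le> t * (norm v + 1)" using t by simp
  also have "\<dots> = e / 2" using pn by (simp add: t_def field_simps)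
  finally have "t * norm v < e" using e(1) by simp
  then have "o' + t *\<^sub>R v \<in> U" "o' + (- t) *\<^sub>R v \<in> U" using e(2) t by (auto simp: dist_norm subset_iff)
  then have q: "quad C (o' + t *\<^sub>R v) = 0" "quad C (o' + (- t) *\<^sub>R v) = 0" "quad C o' = 0" using assms by auto
  then have "t * quad_deriv C o' v + t\<^sup>2 * (polar C v v / 2) = 0" "- t * quad_deriv C o' v + t\<^sup>2 * (polar C v v / 2) = 0"
    unfolding quad_ray by simp_all
  then have "t * quad_deriv C o' v = 0" "t\<^sup>2 * (polar C v v / 2) = 0" by linarith+
  then have "quad_deriv C o' v = 0" "polar C v v = 0" using t by auto
  then have "quad C (o' + v) = 0" by (simp add: quad_taylor q)
  then show "quad C x = 0" by (simp add: v_def)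
qed

lemma exists_quad_with_nine_conditions:
  fixes W :: "qcoef set"
  assumes "finite W" "card W \<le> 9"
  obtains C where "C \<noteq> 0" "\<And>w. w \<in> W \<Longrightarrow> C \<bullet> w = 0"
proof -
  have "dim W \<le> 9" using dim_le_card'[OF assms(1)] assms(2) by linarith
  then have lt: "dim W < DIM(qcoef)" by simp
  have "\<exists>C. C \<noteq> 0 \<and> (\<forall>y \<in> span W. orthogonal C y)"
    by (rule orthogonal_to_subspace_exists[OF lt]) blast
  then show ?thesis using that span_base[of _ W] unfolding orthogonal_def by blast
qed

section \<open>Zeros of a quadratic polynomial on an ellipse\<close>

text \<open>
  The ellipse with centre \<open>z - a\<close> and conjugate semi-diameters \<open>a\<close> and \<open>b\<close>, based at its point \<open>z\<close>, where
  \<open>b\<close> spans the tangent direction. In the usual parametrization, \<open>u = 1 - cos t\<close> and \<open>y = sin t\<close>.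
\<close>
definition ell :: "real^3 \<Rightarrow> real^3 \<Rightarrow> real^3 \<Rightarrow> (real^3) set" where
  "ell z a b = {z - u *\<^sub>R a + y *\<^sub>R b | u y. u\<^sup>2 + y\<^sup>2 = 2 * u}"

lemma ellI: "u\<^sup>2 + y\<^sup>2 = 2 * u \<Longrightarrow> z - u *\<^sub>R a + y *\<^sub>R b \<in> ell z a b"
  unfolding ell_def by blast

lemma base_in_ell [simp]: "z \<in> ell z a b"
  using ellI[of 0 0 z a b] by simp

lemma in_ell_iff:
  assumes "a \<times> b \<noteq> 0"
  shows "z - u *\<^sub>R a + y *\<^sub>R b \<in> ell z a b \<longleftrightarrow> u\<^sup>2 + y\<^sup>2 = 2 * u"
proof
  assume "z - u *\<^sub>R a + y *\<^sub>R b \<in> ell z a b"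
  then obtain u' y' where e: "z - u *\<^sub>R a + y *\<^sub>R b = z - u' *\<^sub>R a + y' *\<^sub>R b"
    and u': "u'\<^sup>2 + y'\<^sup>2 = 2 * u'" unfolding ell_def by blast
  have "(u' - u) *\<^sub>R a + (y - y') *\<^sub>R b = 0" using e by (simp add: algebra_simps)
  from cross_indep[OF assms this] show "u\<^sup>2 + y\<^sup>2 = 2 * u" using u' by simp
qed (rule ellI)

lemma ell_pointE:
  assumes "x \<in> ell z a b"
  obtains u y where "x = z - u *\<^sub>R a + y *\<^sub>R b" "u\<^sup>2 + y\<^sup>2 = 2 * u"
  using assms unfolding ell_def by blast

text \<open>
  Any point of an ellipse can serve as base point: \<open>a'\<close> and \<open>b'\<close> are \<open>a\<close> and \<open>b\<close> rotated by the parameter of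
  the new point. The cross product, which fixes the plane and the area, does not change.
\<close>
lemma ell_rebase:
  assumes uy: "u\<^sup>2 + y\<^sup>2 = 2 * u"
    and x: "x = z - u *\<^sub>R a + y *\<^sub>R b"
    and a': "a' = (1-u) *\<^sub>R a + y *\<^sub>R b" and b': "b' = (1-u) *\<^sub>R b - y *\<^sub>R a"
  shows "ell z a b = ell x a' b'" "a' \<times> b' = a \<times> b"
proof -
  have sq: "(1-u)\<^sup>2 + y\<^sup>2 = 1" using uy by (simp add: power2_eq_square algebra_simps)
  have "a' \<times> b' = ((1-u)\<^sup>2 + y\<^sup>2) *\<^sub>R (a \<times> b)"
    unfolding a' b'
    by (simp add: cross_add_left Cross3.right_diff_distrib
        cross_mult_left cross_mult_right cross_skew[of b a] power2_eq_square scaleR_left_distrib)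
  then show "a' \<times> b' = a \<times> b" using sq by simp
  have "w \<in> ell z a b \<longleftrightarrow> w \<in> ell x a' b'" for w
  proof
    assume "w \<in> ell z a b"
    then obtain v s where w: "w = z - v *\<^sub>R a + s *\<^sub>R b" and vs: "v\<^sup>2 + s\<^sup>2 = 2 * v"
      unfolding ell_def by blast
    define v' where "v' = 1 - ((1-v) * (1-u) + s * y)"
    define s' where "s' = s * (1-u) - (1-v) * y"
    have "(1-v')\<^sup>2 + s'\<^sup>2 = ((1-v)\<^sup>2 + s\<^sup>2) * ((1-u)\<^sup>2 + y\<^sup>2)"
      unfolding v'_def s'_def by algebra
    also have "\<dots> = 1" using sq vs by (simp add: power2_eq_square algebra_simps)
    finally have 1: "v'\<^sup>2 + s'\<^sup>2 = 2 * v'" by (simp add: power2_eq_square algebra_simps)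
    have "1 - u - v' * (1-u) - s' * y = (1 - v) * ((1-u)\<^sup>2 + y\<^sup>2)"
      unfolding v'_def s'_def by algebra
    then have e1: "- u - v' * (1-u) - s' * y = - v" using sq by simp
    have "y - v' * y + s' * (1-u) = s * ((1-u)\<^sup>2 + y\<^sup>2)" unfolding v'_def s'_def by algebra
    then have e2: "y - v' * y + s' * (1-u) = s" using sq by simp
    have "x - v' *\<^sub>R a' + s' *\<^sub>R b' = z + (- u - v' * (1-u) - s' * y) *\<^sub>R a + (y - v' * y + s' * (1-u)) *\<^sub>R b"
      unfolding x a' b' by (simp add: algebra_simps)
    also have "\<dots> = w" unfolding e1 e2 w by simp
    finally show "w \<in> ell x a' b'" using ellI[OF 1, of x a' b'] by simp
  next
    assume "w \<in> ell x a' b'"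
    then obtain v' s' where w: "w = x - v' *\<^sub>R a' + s' *\<^sub>R b'" and vs: "v'\<^sup>2 + s'\<^sup>2 = 2 * v'"
      unfolding ell_def by blast
    define v where "v = u + v' * (1-u) + s' * y"
    define s where "s = y - v' * y + s' * (1-u)"
    have "(1-v)\<^sup>2 + s\<^sup>2 = ((1-v')\<^sup>2 + s'\<^sup>2) * ((1-u)\<^sup>2 + y\<^sup>2)"
      unfolding v_def s_def by algebra
    also have "\<dots> = 1" using sq vs by (simp add: power2_eq_square algebra_simps)
    finally have 1: "v\<^sup>2 + s\<^sup>2 = 2 * v" by (simp add: power2_eq_square algebra_simps)
    have "w = z - v *\<^sub>R a + s *\<^sub>R b"
      unfolding w x a' b' v_def s_def by (simp add: algebra_simps)
    then show "w \<in> ell z a b" using ellI[OF 1, of z a b] by simp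
  qed
  then show "ell z a b = ell x a' b'" by blast
qed

text \<open>
  Stereographic projection from the base point, with parameter \<open>s = y / u\<close>; it covers every point of the
  ellipse but the base point, which sits at \<open>s = \<infinity>\<close>.
\<close>
definition stereo :: "real^3 \<Rightarrow> real^3 \<Rightarrow> real^3 \<Rightarrow> real \<Rightarrow> real^3" where
  "stereo z a b s = z + (2 / (1 + s\<^sup>2)) *\<^sub>R (s *\<^sub>R b - a)"

lemma stereo_in_ell: "stereo z a b s \<in> ell z a b"
proof -
  define u where "u = 2 / (1 + s\<^sup>2)"
  have p: "1 + s\<^sup>2 \<noteq> 0" using zero_le_power2[of s] by linarith
  have "u * (1 + s\<^sup>2) = 2" unfolding u_def using p by (metis nonzero_eq_divide_eq)
  moreover have "u\<^sup>2 + (s*u)\<^sup>2 = u * (u * (1 + s\<^sup>2))" by algebra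
  ultimately have "u\<^sup>2 + (s*u)\<^sup>2 = 2 * u" by simp
  then show ?thesis using ellI[of u "s*u" z a b]
    by (simp add: stereo_def u_def algebra_simps)
qed

lemma ell_eq_stereo:
  assumes "x \<in> ell z a b" "x \<noteq> z"
  obtains s where "x = stereo z a b s"
proof -
  obtain u y where x: "x = z - u *\<^sub>R a + y *\<^sub>R b" and uy: "u\<^sup>2 + y\<^sup>2 = 2 * u"
    using assms(1) unfolding ell_def by blast
  have u0: "u \<noteq> 0" using x uy assms(2) by auto
  have p: "1 + (y/u)\<^sup>2 \<noteq> 0" using zero_le_power2[of "y/u"] by linarith
  have "u * (1 + (y/u)\<^sup>2) = 2" using u0 uy by (simp add: field_simps power2_eq_square)
  then have "u = 2 / (1 + (y/u)\<^sup>2)" using p by (simp add: eq_divide_eq)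
  then have "stereo z a b (y/u) = z + u *\<^sub>R ((y/u) *\<^sub>R b - a)" by (simp add: stereo_def)
  also have "\<dots> = x" using u0 by (simp add: x algebra_simps)
  finally show ?thesis using that by metis
qed

lemma stereo_inverse:
  assumes "t \<noteq> 0"
  shows "stereo p a b (1/t) = p + (2 * t / (1 + t\<^sup>2)) *\<^sub>R (b - t *\<^sub>R a)"
proof -
  have pos: "1 + t\<^sup>2 > 0" by (simp add: add_pos_nonneg)
  have "2 / (1 + (1/t)\<^sup>2) = 2 * t / (1 + t\<^sup>2) * t" using assms pos by (simp add: field_simps power2_eq_square)
  then have "stereo p a b (1/t) = p + (2 * t / (1 + t\<^sup>2) * t) *\<^sub>R ((1/t) *\<^sub>R b - a)" by (simp only: stereo_def)
  also have "(2 * t / (1 + t\<^sup>2) * t) *\<^sub>R ((1/t) *\<^sub>R b - a) = (2 * t / (1 + t\<^sup>2)) *\<^sub>R (t *\<^sub>R ((1/t) *\<^sub>R b - a))" by simp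
  also have "t *\<^sub>R ((1/t) *\<^sub>R b - a) = b - t *\<^sub>R a" using assms by (simp add: scaleR_diff_right)
  finally show ?thesis .
qed

text \<open>
  The numerator of a quadratic polynomial pulled back along \<open>stereo\<close>, when the polynomial vanishes at the
  base point. A zero of higher order at the base point lowers the degree: the coefficient of \<open>s\<^sup>3\<close> is the first derivative
  along the ellipse there and, once it vanishes, the coefficient of \<open>s\<^sup>2\<close> is the second derivative.
\<close>
definition trace_poly :: "qcoef \<Rightarrow> real^3 \<Rightarrow> real^3 \<Rightarrow> real^3 \<Rightarrow> real poly" where
  "trace_poly C z a b =
     [: polar C a a - quad_deriv C z a, quad_deriv C z b - 2 * polar C a b,
        polar C b b - quad_deriv C z a, quad_deriv C z b :]"

lemma quad_stereo:
  assumes "quad C z = 0"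
  shows "quad C (stereo z a b s) = 2 / (1 + s\<^sup>2)\<^sup>2 * poly (trace_poly C z a b) s"
proof -
  have p: "1 + s\<^sup>2 \<noteq> 0" using zero_le_power2[of s] by linarith
  define r where "r = 2 / (1 + s\<^sup>2)"
  have r: "r * (1 + s\<^sup>2) = 2" unfolding r_def using p by (metis nonzero_eq_divide_eq)
  have r2: "2 / (1 + s\<^sup>2)\<^sup>2 = r\<^sup>2 / 2" unfolding r_def by (simp add: power_divide)
  have A: "quad C (stereo z a b s) = r * (s * quad_deriv C z b - quad_deriv C z a)
       + r\<^sup>2 * (s\<^sup>2 * polar C b b - 2 * s * polar C a b + polar C a a) / 2"
    unfolding stereo_def quad_ray r_def[symmetric]
    by (simp add: assms quad_deriv_simps polar_simps polar_commute[of C b a] power2_eq_square algebra_simps)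
  have B: "r * (s * quad_deriv C z b - quad_deriv C z a)
      = r\<^sup>2 / 2 * ((1 + s\<^sup>2) * (s * quad_deriv C z b - quad_deriv C z a))"
  proof -
    have "r\<^sup>2 * (1 + s\<^sup>2) = 2 * r" using r unfolding power2_eq_square[of r] mult.assoc by simp
    then have rr: "r\<^sup>2 * (1 + s\<^sup>2) / 2 = r" by linarith
    have "r\<^sup>2 / 2 * ((1 + s\<^sup>2) * X) = (r\<^sup>2 * (1 + s\<^sup>2) / 2) * X" for X :: real
      by simp
    from this[unfolded rr, symmetric] show ?thesis .
  qed
  show ?thesis unfolding r2 A B
    by (simp add: trace_poly_def algebra_simps power2_eq_square add_divide_distrib diff_divide_distrib)
qed

lemma quad_stereo_0_iff:
  assumes "quad C z = 0"
  shows "quad C (stereo z a b s) = 0 \<longleftrightarrow> poly (trace_poly C z a b) s = 0"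
proof -
  have p: "1 + s\<^sup>2 \<noteq> 0" using zero_le_power2[of s] by linarith
  then show ?thesis by (simp add: quad_stereo[OF assms])
qed

lemma quad_0_on_ell_iff:
  assumes "quad C z = 0"
  shows "(\<forall>x \<in> ell z a b. quad C x = 0) \<longleftrightarrow> trace_poly C z a b = 0"
proof
  assume "\<forall>x \<in> ell z a b. quad C x = 0"
  then have "poly (trace_poly C z a b) s = 0" for s
    using stereo_in_ell quad_stereo_0_iff[OF assms] by metis
  then show "trace_poly C z a b = 0" using poly_all_0_iff_0 by blast
next
  assume "trace_poly C z a b = 0"
  then show "\<forall>x \<in> ell z a b. quad C x = 0"
    using ell_eq_stereo quad_stereo_0_iff[OF assms] assms by (metis poly_0)
qed

text \<open>
  The first and the second derivative along the ellipse at the base point are zero. These equations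
  are the form in which a zero of order 3 is expressed below.
\<close>
lemma quad_deriv_tangent_0:
  assumes "quad C z = 0" "\<forall>x \<in> ell z a b. quad C x = 0"
  shows "quad_deriv C z b = 0" "polar C b b = quad_deriv C z a"
  using quad_0_on_ell_iff[OF assms(1), of a b] assms(2) by (auto simp: trace_poly_def)

text \<open>
  Distinct points of the ellipse have distinct stereographic parameters, so the points of \<open>X\<close> give
  more roots than the degree of \<open>trace_poly\<close> allows. The next three lemmas spell this out for a base
  point that is a zero of order 1, 2 and 3.
\<close>
lemma quad_0_on_ell_if_many_zeros:
  assumes z: "quad C z = 0" and X: "X \<subseteq> ell z a b - {z}" "finite X" "\<And>x. x \<in> X \<Longrightarrow> quad C x = 0"
    and deg: "degree (trace_poly C z a b) < card X"
  shows "\<forall>x \<in> ell z a b. quad C x = 0"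
proof (rule ccontr)
  assume "\<not> ?thesis"
  then have nz: "trace_poly C z a b \<noteq> 0" using quad_0_on_ell_iff[OF z] by blast
  define R where "R = {s. poly (trace_poly C z a b) s = 0}"
  have "finite R" using nz by (simp add: R_def poly_roots_finite)
  have "X \<subseteq> stereo z a b ` R"
  proof
    fix x assume "x \<in> X"
    then obtain s where "x = stereo z a b s" using X(1) ell_eq_stereo by blast
    then show "x \<in> stereo z a b ` R" using X(3)[OF \<open>x \<in> X\<close>] quad_stereo_0_iff[OF z] R_def by auto
  qed
  then have "card X \<le> card R" using \<open>finite R\<close> by (rule surj_card_le[rotated])
  also have "\<dots> \<le> degree (trace_poly C z a b)" using nz card_poly_roots_bound[OF nz] by (simp add: R_def)
  finally show False using deg by simp
qed

lemma quad_0_on_ell_five_zeros: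
  assumes "quad C z = 0" "X \<subseteq> ell z a b - {z}" "finite X" "\<And>x. x \<in> X \<Longrightarrow> quad C x = 0" "4 \<le> card X"
  shows "\<forall>x \<in> ell z a b. quad C x = 0"
proof -
  have "degree (trace_poly C z a b) \<le> 3" by (simp add: trace_poly_def degree_pCons_eq_if)
  then show ?thesis using quad_0_on_ell_if_many_zeros[OF assms(1,2,3,4)] assms(5) by linarith
qed

lemma quad_0_on_ell_double:
  assumes "quad C z = 0" "quad_deriv C z b = 0"
    "X \<subseteq> ell z a b - {z}" "finite X" "\<And>x. x \<in> X \<Longrightarrow> quad C x = 0" "3 \<le> card X"
  shows "\<forall>x \<in> ell z a b. quad C x = 0"
proof -
  have "degree (trace_poly C z a b) \<le> 2" by (simp add: trace_poly_def degree_pCons_eq_if assms)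
  then show ?thesis using quad_0_on_ell_if_many_zeros[OF assms(1,3,4,5)] assms(6) by linarith
qed

lemma quad_0_on_ell_triple:
  assumes "quad C z = 0" "quad_deriv C z b = 0" "polar C b b = quad_deriv C z a"
    "x \<in> ell z a b" "x \<noteq> z" "quad C x = 0" "y \<in> ell z a b" "y \<noteq> z" "quad C y = 0" "x \<noteq> y"
  shows "\<forall>x \<in> ell z a b. quad C x = 0"
proof -
  have "degree (trace_poly C z a b) \<le> 1" by (simp add: trace_poly_def degree_pCons_eq_if assms)
  then show ?thesis using quad_0_on_ell_if_many_zeros[OF assms(1), of "{x,y}" a b] assms by auto
qed

text \<open>
  A zero of order 3 at \<open>z\<close> and one of order 2 at \<open>x\<close>. The vector \<open>(1-u) b - y a\<close> is the tangent at \<open>x\<close>.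
\<close>
lemma quad_0_on_ell_triple_double:
  assumes z: "quad C z = 0" "quad_deriv C z b = 0" "polar C b b = quad_deriv C z a"
    and uy: "u\<^sup>2 + y\<^sup>2 = 2 * u" "u \<noteq> 0"
    and x: "x = z - u *\<^sub>R a + y *\<^sub>R b" "quad C x = 0" "quad_deriv C x ((1-u) *\<^sub>R b - y *\<^sub>R a) = 0"
  shows "\<forall>x \<in> ell z a b. quad C x = 0"
proof -
  define \<alpha> \<beta> \<gamma> where "\<alpha> = polar C a a" and "\<beta> = polar C b b" and "\<gamma> = polar C a b"
  note pa = polar_commute[of C b a]
  have xz: "x = z + (y *\<^sub>R b - u *\<^sub>R a)" by (simp add: x)
  have "- u * \<beta> + (u\<^sup>2 * \<alpha> - 2 * u * y * \<gamma> + y\<^sup>2 * \<beta>) / 2 = 0"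
    using x(2) unfolding xz quad_taylor
    by (simp add: z(1,2) z(3)[symmetric] quad_deriv_simps polar_simps pa \<alpha>_def \<beta>_def \<gamma>_def power2_eq_square algebra_simps)
  then have "u * (u * (\<alpha> - \<beta>) - 2 * y * \<gamma>) = 0" using uy(1) by algebra
  then have 1: "u * (\<alpha> - \<beta>) = 2 * y * \<gamma>" using uy by simp
  have "- y * \<beta> + (u * y * \<alpha> - u * (1-u) * \<gamma> + y * (1-u) * \<beta> - y\<^sup>2 * \<gamma>) = 0"
    using x(3) unfolding xz quad_deriv_add_base
    by (simp add: z(1,2) z(3)[symmetric] quad_deriv_simps polar_simps pa \<alpha>_def \<beta>_def \<gamma>_def power2_eq_square algebra_simps)
  then have "u * (y * (\<alpha> - \<beta>) - (3 - 2 * u) * \<gamma>) = 0" using uy(1) by algebra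
  then have "y * (\<alpha> - \<beta>) = (3 - 2 * u) * \<gamma>" using uy by simp
  then have "u * \<gamma> = 0" using 1 uy(1) by algebra
  then have "\<gamma> = 0" "\<alpha> = \<beta>" using uy 1 by auto
  then show ?thesis using quad_0_on_ell_iff[OF z(1)] z(2,3)
    by (simp add: trace_poly_def \<alpha>_def \<beta>_def \<gamma>_def)
qed

text \<open>
  An arc at the base point corresponds to an unbounded interval of stereographic parameters, all of them
  roots of one polynomial.
\<close>
lemma quad_0_on_ell_if_near:
  assumes "r > 0" "\<And>x. x \<in> ell z a b \<Longrightarrow> dist x z < r \<Longrightarrow> quad C x = 0"
  shows "\<forall>x \<in> ell z a b. quad C x = 0"
proof -
  have z: "quad C z = 0" using assms by simp
  have "((\<lambda>t. z + (2 * t / (1 + t\<^sup>2)) *\<^sub>R (b - t *\<^sub>R a)) \<longlongrightarrow> z) (at_right (0::real))"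
    by (auto intro!: tendsto_eq_intros)
  then have "eventually (\<lambda>t. dist (z + (2 * t / (1 + t\<^sup>2)) *\<^sub>R (b - t *\<^sub>R a)) z < r) (at_right (0::real))"
    using assms(1) by (rule tendstoD)
  then obtain d where d: "d > 0" "\<And>t. 0 < t \<Longrightarrow> t < d \<Longrightarrow> dist (z + (2 * t / (1 + t\<^sup>2)) *\<^sub>R (b - t *\<^sub>R a)) z < r"
    unfolding eventually_at_right_field by auto
  have root: "poly (trace_poly C z a b) s = 0" if "s > 1 / d" for s
  proof -
    have s0: "s > 0" using that d(1) by (meson less_trans zero_less_divide_1_iff)
    have "1 / s < d" using that d(1) s0 by (simp add: field_simps)
    then have "dist (stereo z a b (1 / (1 / s))) z < r"
      using d(2)[of "1/s"] s0 by (subst stereo_inverse) auto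
    then have "quad C (stereo z a b s) = 0" using assms(2) stereo_in_ell by simp
    then show ?thesis using quad_stereo_0_iff[OF z] by blast
  qed
  have "trace_poly C z a b = 0"
  proof (rule ccontr)
    assume "trace_poly C z a b \<noteq> 0"
    then have "finite {s. poly (trace_poly C z a b) s = 0}" by (rule poly_roots_finite)
    then have "finite {1 / d<..}" by (rule finite_subset[rotated]) (use root in auto)
    then show False by (simp add: infinite_Ioi)
  qed
  then show ?thesis using quad_0_on_ell_iff[OF z] by blast
qed

section \<open>Supporting planes and elliptic sections\<close>

text \<open>
  A plane that supports an ellipse at a point contains the tangent of the ellipse there.
\<close>
lemma support_normal_orth_tangent:
  assumes "\<And>x. x \<in> ell p a b \<Longrightarrow> n \<bullet> (x - p) \<le> 0"
  shows "n \<bullet> b = 0"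
proof (rule ccontr)
  assume nb: "n \<bullet> b \<noteq> 0"
  \<comment> \<open>With this parameter the height above the supporting plane would be positive.\<close>
  define s where "s = (n \<bullet> a + 1) / (n \<bullet> b)"
  have p: "0 < 2 / (1 + s\<^sup>2)" by (simp add: add_pos_nonneg)
  have "n \<bullet> (stereo p a b s - p) \<le> 0" using assms stereo_in_ell by blast
  then have "(2 / (1 + s\<^sup>2)) * (s * (n \<bullet> b) - n \<bullet> a) \<le> 0"
    by (simp add: stereo_def inner_diff_right)
  then have "s * (n \<bullet> b) - n \<bullet> a \<le> 0" using p by (simp only: mult_le_0_iff) linarith
  then show False using nb by (simp add: s_def)
qed

lemma support_eq_in_frontier:
  fixes n :: "'a::euclidean_space"
  assumes "n \<noteq> 0" "\<And>w. w \<in> K \<Longrightarrow> n \<bullet> (w - p) \<le> 0" "x \<in> K" "n \<bullet> (x - p) = 0"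
  shows "x \<in> frontier K"
proof -
  have "x \<notin> interior K"
  proof
    assume "x \<in> interior K"
    then obtain e where e: "e > 0" "cball x e \<subseteq> K" using mem_interior_cball by blast
    have "x + (e / norm n) *\<^sub>R n \<in> cball x e" using e assms(1) by (simp add: dist_norm)
    then have "n \<bullet> (x + (e / norm n) *\<^sub>R n - p) \<le> 0" using e assms(2) by blast
    moreover have "n \<bullet> (x + (e / norm n) *\<^sub>R n - p) = n \<bullet> (x - p) + (e / norm n) * (n \<bullet> n)"
      by (simp add: inner_diff_right inner_add_right)
    moreover have "(e / norm n) * (n \<bullet> n) > 0" using e(1) assms(1) by simp
    ultimately show False using assms(4) by linarith
  qed
  then show ?thesis using assms(3) closure_subset by (auto simp: frontier_def)
qed

lemma support_exists:
  fixes K :: "'a::euclidean_space set"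
  assumes "convex_body K" "p \<in> frontier K"
  obtains n where "n \<noteq> 0" "\<And>w. w \<in> K \<Longrightarrow> n \<bullet> (w - p) \<le> 0"
proof -
  have cl: "closed K" and c: "convex K" and i: "interior K \<noteq> {}"
    using assms(1) by (auto simp: convex_body_def compact_imp_closed)
  have "rel_interior K = interior K" using i by (rule rel_interior_nonempty_interior)
  then have "p \<in> closure K" "p \<notin> rel_interior K" using assms(2) by (auto simp: frontier_def)
  then have "p \<in> K" using cl by simp
  have "\<exists>a. a \<noteq> 0 \<and> (\<forall>y \<in> K. a \<bullet> p \<le> a \<bullet> y)"
    by (rule supporting_hyperplane_rel_boundary[OF c \<open>p \<in> K\<close> \<open>p \<notin> rel_interior K\<close>]) auto
  then obtain a where "a \<noteq> 0" "\<forall>y \<in> K. a \<bullet> p \<le> a \<bullet> y" by blast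
  then show ?thesis using that[of "- a"] by (simp add: inner_diff_right)
qed

text \<open>
  The ellipse based at \<open>p\<close> is the section of \<open>S\<close> by its own plane. With \<open>n\<close> normal to a supporting plane at \<open>p\<close>,
  the two conditions on \<open>n\<close> say that the ellipse touches the supporting plane at \<open>p\<close> without lying in it.
\<close>
definition section_at :: "(real^3) set \<Rightarrow> real^3 \<Rightarrow> real^3 \<Rightarrow> real^3 \<Rightarrow> real^3 \<Rightarrow> bool" where
  "section_at S p n a b \<longleftrightarrow> a \<times> b \<noteq> 0 \<and> n \<bullet> b = 0 \<and> n \<bullet> a \<noteq> 0 \<and>
     ell p a b = {x \<in> S. (a \<times> b) \<bullet> (x - p) = 0}"

text \<open>
  An elliptic section cannot lie in the supporting plane: its centre would be a point of the body in that plane, hence a boundary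
  point, hence a point of the section, although it is not on the ellipse.
\<close>
lemma section_at_normal:
  assumes K: "closed K" "convex K" and n: "n \<noteq> 0" "\<And>w. w \<in> K \<Longrightarrow> n \<bullet> (w - p) \<le> 0"
    and ab: "a \<times> b \<noteq> 0" and E: "ell p a b = {x \<in> frontier K. (a \<times> b) \<bullet> (x - p) = 0}"
  shows "section_at (frontier K) p n a b"
proof -
  have sub: "ell p a b \<subseteq> K" using E K(1) frontier_subset_closed by blast
  have nb: "n \<bullet> b = 0" using support_normal_orth_tangent[of p a b n] sub n(2) by blast
  have "n \<bullet> a \<noteq> 0"
  proof
    assume na: "n \<bullet> a = 0"
    \<comment> \<open>The centre is the midpoint of \<open>p\<close> and the opposite point.\<close>
    have "p - 2 *\<^sub>R a \<in> K" using ellI[of 2 0 p a b] sub by auto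
    then have "(1/2) *\<^sub>R p + (1/2) *\<^sub>R (p - 2 *\<^sub>R a) \<in> K"
      using K(2) base_in_ell[of p a b] sub by (intro convexD) auto
    moreover have "(1/2) *\<^sub>R p + (1/2) *\<^sub>R (p - 2 *\<^sub>R a) = p - a" by (simp add: vec_eq_iff diff_divide_distrib)
    ultimately have c: "p - a \<in> K" by simp
    then have "p - a \<in> frontier K"
      using support_eq_in_frontier[of n K p "p - a"] n na by simp
    then have "p - a \<in> ell p a b" unfolding E by (simp add: dot_cross_self inner_commute)
    then have "p - 1 *\<^sub>R a + 0 *\<^sub>R b \<in> ell p a b" by simp
    then show False unfolding in_ell_iff[OF ab] by simp
  qed
  with nb ab E show ?thesis unfolding section_at_def by blast
qed

lemma sections_planes_distinct:
  assumes "section_at S p n a1 b1" "section_at S p n a2 b2" "b1 \<times> b2 \<noteq> 0"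
  shows "(a1 \<times> b1) \<times> (a2 \<times> b2) \<noteq> 0"
proof
  assume "(a1 \<times> b1) \<times> (a2 \<times> b2) = 0"
  then obtain s where "a2 \<times> b2 = s *\<^sub>R (a1 \<times> b1)"
    using cross_eq_0_imp_scale assms(1) unfolding section_at_def by blast
  moreover then have "s \<noteq> 0" using assms(2) by (auto simp: section_at_def)
  moreover have "(a2 \<times> b2) \<bullet> b2 = 0" by (simp add: dot_cross_self)
  ultimately have "(a1 \<times> b1) \<bullet> b2 = 0" by simp
  \<comment> \<open>If the planes were parallel, \<open>b2\<close> would be a tangent vector in the first plane, hence parallel to \<open>b1\<close>.\<close>
  then obtain x y where b2: "b2 = x *\<^sub>R a1 + y *\<^sub>R b1"
    using cross_span assms(1) unfolding section_at_def by blast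
  then have "x * (n \<bullet> a1) = 0" using assms(1,2) unfolding section_at_def by (simp add: inner_add_right)
  then have "x = 0" using assms(1) by (simp add: section_at_def)
  then show False using assms(3) b2 by (simp add: cross_mult_right)
qed

lemma section_orth:
  assumes "section_at S p n a b" "x \<in> ell p a b"
  shows "(a \<times> b) \<bullet> (x - p) = 0" "x \<in> S"
  using assms unfolding section_at_def by auto

text \<open>
  The planes of the two sections share a line through \<open>p\<close>. It is not tangent to either ellipse, because
  a tangent to one that lies in the plane of the other is also in the supporting plane and so
  tangent to the other, which is excluded. A secant through \<open>p\<close> meets the ellipse once more.
\<close>
lemma sections_meet:
  assumes s1: "section_at S p n a1 b1" and s2: "section_at S p n a2 b2" and b: "b1 \<times> b2 \<noteq> 0"
  obtains q where "q \<noteq> p" "ell p a1 b1 \<inter> ell p a2 b2 = {p, q}"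
proof -
  define N1 N2 where "N1 = a1 \<times> b1" and "N2 = a2 \<times> b2"
  define v where "v = N1 \<times> N2"
  have N1: "N1 \<noteq> 0" using s1 by (simp add: section_at_def N1_def)
  have v0: "v \<noteq> 0" using sections_planes_distinct[OF assms] by (simp add: v_def N1_def N2_def)
  have vN: "N1 \<bullet> v = 0" "N2 \<bullet> v = 0" by (simp_all add: v_def dot_cross_self)
  obtain x y where v: "v = x *\<^sub>R a1 + y *\<^sub>R b1" using cross_span[of a1 b1 v] N1 vN by (auto simp: N1_def)
  have x0: "x \<noteq> 0"
  proof
    assume "x = 0"
    then have vb: "v = y *\<^sub>R b1" using v by simp
    then have "y \<noteq> 0" using v0 by auto
    then have "(a2 \<times> b2) \<bullet> b1 = 0" using vN(2) vb by (simp add: N2_def)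
    then obtain s t where b1: "b1 = s *\<^sub>R a2 + t *\<^sub>R b2"
      using cross_span s2 unfolding section_at_def by blast
    then have "s * (n \<bullet> a2) = 0" using s1 s2 unfolding section_at_def by (simp add: inner_add_right)
    then have "s = 0" using s2 by (simp add: section_at_def)
    then show False using b b1 by (simp add: cross_mult_left)
  qed
  \<comment> \<open>The parameter of the second intersection of the line in direction \<open>v\<close> with the first ellipse.\<close>
  define l where "l = - 2 * x / (x\<^sup>2 + y\<^sup>2)"
  have sq: "x\<^sup>2 + y\<^sup>2 > 0" using x0 by (simp add: add_pos_nonneg)
  have l0: "l \<noteq> 0" using x0 sq by (simp add: l_def)
  have line: "p + t *\<^sub>R v \<in> ell p a1 b1 \<longleftrightarrow> t = 0 \<or> t = l" for t
  proof -
    have "p + t *\<^sub>R v = p - (- t * x) *\<^sub>R a1 + (t * y) *\<^sub>R b1" by (simp add: v algebra_simps)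
    then have "p + t *\<^sub>R v \<in> ell p a1 b1 \<longleftrightarrow> p - (- t * x) *\<^sub>R a1 + (t * y) *\<^sub>R b1 \<in> ell p a1 b1"
      by (rule arg_cong)
    also have "\<dots> \<longleftrightarrow> (- t * x)\<^sup>2 + (t * y)\<^sup>2 = 2 * (- t * x)"
      by (rule in_ell_iff) (use N1 N1_def in simp)
    also have "\<dots> \<longleftrightarrow> t * (t * (x\<^sup>2 + y\<^sup>2) + 2 * x) = 0" by (auto simp: algebra_simps power2_eq_square)
    also have "\<dots> \<longleftrightarrow> t = 0 \<or> t * (x\<^sup>2 + y\<^sup>2) + 2 * x = 0" by simp
    also have "t * (x\<^sup>2 + y\<^sup>2) + 2 * x = 0 \<longleftrightarrow> t = l"
      using sq unfolding l_def by (subst eq_divide_eq) auto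
    finally show ?thesis .
  qed
  define q where "q = p + l *\<^sub>R v"
  have q1: "q \<in> ell p a1 b1" using line q_def by blast
  have q2: "q \<in> ell p a2 b2"
    using section_orth(2)[OF s1 q1] s2 vN(2) unfolding section_at_def by (simp add: q_def N2_def)
  have "w = p \<or> w = q" if w: "w \<in> ell p a1 b1" "w \<in> ell p a2 b2" for w
  proof -
    have "v \<times> (w - p) = 0"
      using cross_both_orthogonal[of N1 N2 v "w - p"] v0 vN section_orth(1)[OF s1 w(1)] section_orth(1)[OF s2 w(2)]
      by (simp add: v_def N1_def N2_def)
    then obtain t where "w - p = t *\<^sub>R v" using cross_eq_0_imp_scale v0 by blast
    then have "w = p + t *\<^sub>R v" by (simp add: algebra_simps)
    then show ?thesis using line w(1) q_def by auto
  qed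
  then have "ell p a1 b1 \<inter> ell p a2 b2 = {p, q}" using q1 q2 by auto
  moreover have "q \<noteq> p" using l0 v0 by (simp add: q_def)
  ultimately show ?thesis using that by blast
qed

text \<open>
  If the two tangents at the second point \<open>q\<close> were parallel, they would point along the common line of
  the two planes, which is the direction \<open>q - p\<close> of a chord; but a chord is never parallel to the
  tangent at its end.
\<close>
lemma tangents_at_second_point:
  assumes s1: "section_at S p n a1 b1" and s2: "section_at S p n a2 b2" and b: "b1 \<times> b2 \<noteq> 0"
    and q1: "q = p - u1 *\<^sub>R a1 + y1 *\<^sub>R b1" "u1\<^sup>2 + y1\<^sup>2 = 2 * u1"
    and q2: "q = p - u2 *\<^sub>R a2 + y2 *\<^sub>R b2" "u2\<^sup>2 + y2\<^sup>2 = 2 * u2"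
    and qp: "q \<noteq> p"
  shows "((1-u1) *\<^sub>R b1 - y1 *\<^sub>R a1) \<times> ((1-u2) *\<^sub>R b2 - y2 *\<^sub>R a2) \<noteq> 0" (is "?t1 \<times> ?t2 \<noteq> 0")
proof
  assume c: "?t1 \<times> ?t2 = 0"
  have nz1: "a1 \<times> b1 \<noteq> 0" and nz2: "a2 \<times> b2 \<noteq> 0" using s1 s2 by (auto simp: section_at_def)
  have u1: "u1 \<noteq> 0" using q1 qp by auto
  have t1: "?t1 \<noteq> 0" and t2: "?t2 \<noteq> 0"
    using ell_rebase(2)[OF q1(2,1) refl refl] ell_rebase(2)[OF q2(2,1) refl refl] nz1 nz2
    by (metis cross_zero_right)+
  obtain s where s: "?t2 = s *\<^sub>R ?t1" using cross_eq_0_imp_scale[OF c t1] by blast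
  then have s0: "s \<noteq> 0" using t2 by auto
  have o1: "(a1 \<times> b1) \<bullet> ?t1 = 0" by (simp add: inner_diff_right dot_cross_self)
  have "(a2 \<times> b2) \<bullet> ?t2 = 0" by (simp add: inner_diff_right dot_cross_self)
  then have o2: "(a2 \<times> b2) \<bullet> ?t1 = 0" unfolding s using s0 by simp
  have o3: "(a1 \<times> b1) \<bullet> (q - p) = 0" by (simp add: q1(1) inner_diff_right inner_add_right dot_cross_self)
  have o4: "(a2 \<times> b2) \<bullet> (q - p) = 0" by (simp add: q2(1) inner_diff_right inner_add_right dot_cross_self)
  have "?t1 \<times> (q - p) = 0"
    by (rule cross_both_orthogonal[OF sections_planes_distinct[OF s1 s2 b] o1 o2 o3 o4])
  moreover have "?t1 \<times> (q - p) = ((1 - u1) * u1 - y1\<^sup>2) *\<^sub>R (a1 \<times> b1)"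
    unfolding q1(1)
    using cross_combination[of "- y1" a1 "1 - u1" b1 "- u1" y1] by (simp add: power2_eq_square algebra_simps)
  moreover have "(1 - u1) * u1 - y1\<^sup>2 = - u1" using q1(2) by (simp add: power2_eq_square algebra_simps)
  ultimately show False using u1 nz1 by simp
qed

section \<open>A quadric through three sections, and its uniqueness\<close>

lemma quad_deriv_0_on_plane:
  assumes "n \<noteq> 0" "n \<bullet> b1 = 0" "n \<bullet> b2 = 0" "b1 \<times> b2 \<noteq> 0"
    and "quad_deriv C q b1 = 0" "quad_deriv C q b2 = 0" "n \<bullet> v = 0"
  shows "quad_deriv C q v = 0"
proof -
  obtain x y where "v = x *\<^sub>R b1 + y *\<^sub>R b2" by (rule orthogonal_span[OF assms(1-4,7)])
  then show ?thesis using assms by (simp add: quad_deriv_simps)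
qed

text \<open>
  At a second common point of two sections on which the polynomial vanishes, the gradient is orthogonal to two
  independent tangent directions, hence to every ellipse in \<open>S\<close> through this point. It supplies a zero
  of order 2 when further intersection points coincide.
\<close>
lemma quad_deriv_at_common_point:
  assumes sup: "\<And>x. x \<in> S \<Longrightarrow> \<exists>n. n \<noteq> 0 \<and> (\<forall>w \<in> S. n \<bullet> (w - x) \<le> 0)"
    and s: "section_at S p n a1 b1" "section_at S p n a2 b2" "b1 \<times> b2 \<noteq> 0"
    and y: "y \<in> ell p a1 b1" "y \<in> ell p a2 b2" "y \<noteq> p"
    and Q: "\<forall>x \<in> ell p a1 b1. quad C x = 0" "\<forall>x \<in> ell p a2 b2. quad C x = 0"
    and F: "ell y a b \<subseteq> S"
  shows "quad_deriv C y b = 0"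
proof -
  obtain u1 y1 where 1: "y = p - u1 *\<^sub>R a1 + y1 *\<^sub>R b1" "u1\<^sup>2 + y1\<^sup>2 = 2 * u1"
    by (rule ell_pointE[OF y(1)])
  obtain u2 y2 where 2: "y = p - u2 *\<^sub>R a2 + y2 *\<^sub>R b2" "u2\<^sup>2 + y2\<^sup>2 = 2 * u2"
    by (rule ell_pointE[OF y(2)])
  define t1 where "t1 = (1-u1) *\<^sub>R b1 - y1 *\<^sub>R a1"
  define t2 where "t2 = (1-u2) *\<^sub>R b2 - y2 *\<^sub>R a2"
  have t: "t1 \<times> t2 \<noteq> 0"
    unfolding t1_def t2_def by (rule tangents_at_second_point[OF s 1 2 y(3)])
  obtain c1 where c1: "ell p a1 b1 = ell y c1 t1" using ell_rebase(1)[OF 1(2,1) refl t1_def] by blast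
  obtain c2 where c2: "ell p a2 b2 = ell y c2 t2" using ell_rebase(1)[OF 2(2,1) refl t2_def] by blast
  have S: "ell p a1 b1 \<subseteq> S" "ell p a2 b2 \<subseteq> S" using s by (auto simp: section_at_def)
  then have "y \<in> S" using y by blast
  then obtain m where m: "m \<noteq> 0" "\<forall>w \<in> S. m \<bullet> (w - y) \<le> 0" using sup by blast
  have "m \<bullet> t1 = 0" using support_normal_orth_tangent[of y c1 t1 m] S(1) m(2) c1 by blast
  moreover have "m \<bullet> t2 = 0" using support_normal_orth_tangent[of y c2 t2 m] S(2) m(2) c2 by blast
  moreover have "m \<bullet> b = 0" using support_normal_orth_tangent[of y a b m] F m(2) by blast
  moreover have q0: "quad C y = 0" using Q y by blast
  have "quad_deriv C y t1 = 0" using quad_deriv_tangent_0(1)[OF q0] Q(1) c1 by metis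
  moreover have "quad_deriv C y t2 = 0" using quad_deriv_tangent_0(1)[OF q0] Q(2) c2 by metis
  ultimately show ?thesis using quad_deriv_0_on_plane[OF m(1) _ _ t] by blast
qed

text \<open>
  A zero of order 3 at \<open>p\<close> together with crossings of two sections. If the crossing points are
  different, they are two more zeros; if they coincide, they form one zero of order 2.
\<close>
lemma quad_0_on_ell_contact_and_two_crossings:
  assumes sup: "\<And>x. x \<in> S \<Longrightarrow> \<exists>n. n \<noteq> 0 \<and> (\<forall>w \<in> S. n \<bullet> (w - x) \<le> 0)"
    and s: "section_at S p n a1 b1" "section_at S p n a2 b2" "b1 \<times> b2 \<noteq> 0"
    and F: "ell p a b \<subseteq> S"
    and C: "quad C p = 0" "quad_deriv C p b = 0" "polar C b b = quad_deriv C p a"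
    and Q: "\<forall>x \<in> ell p a1 b1. quad C x = 0" "\<forall>x \<in> ell p a2 b2. quad C x = 0"
    and y: "y1 \<in> ell p a1 b1 \<inter> ell p a b" "y2 \<in> ell p a2 b2 \<inter> ell p a b" "y1 \<noteq> p" "y2 \<noteq> p"
  shows "\<forall>x \<in> ell p a b. quad C x = 0"
proof (cases "y1 = y2")
  case False
  then show ?thesis using quad_0_on_ell_triple[OF C, of y1 y2] y Q by blast
next
  case True
  obtain u v where uv: "y1 = p - u *\<^sub>R a + v *\<^sub>R b" "u\<^sup>2 + v\<^sup>2 = 2 * u"
    using ell_pointE[of y1 p a b] y by blast
  then have u0: "u \<noteq> 0" using y by auto
  have "ell y1 ((1-u) *\<^sub>R a + v *\<^sub>R b) ((1-u) *\<^sub>R b - v *\<^sub>R a) \<subseteq> S"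
    using ell_rebase(1)[OF uv(2,1) refl refl] F by simp
  then have "quad_deriv C y1 ((1-u) *\<^sub>R b - v *\<^sub>R a) = 0"
    using quad_deriv_at_common_point[OF sup s _ _ _ Q, of y1] y True by blast
  moreover have "quad C y1 = 0" using y Q by blast
  ultimately show ?thesis using quad_0_on_ell_triple_double[OF C uv(2) u0 uv(1)] by blast
qed

lemma inner_contact_functional: "C \<bullet> (monomials_polar b b - ((0, a, 0, 0) + monomials_polar p a)) = polar C b b - quad_deriv C p a"
  by (simp add: polar_def quad_deriv_def inner_diff_right)

text \<open>
  The nine conditions are a zero of order 3 at \<open>p\<close> on each of the three ellipses, which takes six linear
  conditions since the gradient has to kill only a plane of tangents, and three conditions at the
  further intersection points. These points are pairwise different or all the same. In the
  latter case the conditions are a zero of order 2 at the common point, where again two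
  tangent directions span all three.
\<close>
lemma quad_through_three_sections:
  assumes sup: "\<And>x. x \<in> S \<Longrightarrow> \<exists>n. n \<noteq> 0 \<and> (\<forall>w \<in> S. n \<bullet> (w - x) \<le> 0)"
    and n: "n \<noteq> 0"
    and s: "section_at S p n a1 b1" "section_at S p n a2 b2" "section_at S p n a3 b3"
    and b: "b1 \<times> b2 \<noteq> 0" "b1 \<times> b3 \<noteq> 0" "b2 \<times> b3 \<noteq> 0"
  obtains C where "C \<noteq> 0" "\<forall>x \<in> ell p a1 b1. quad C x = 0" "\<forall>x \<in> ell p a2 b2. quad C x = 0"
    "\<forall>x \<in> ell p a3 b3. quad C x = 0"
proof -
  obtain q12 where q12: "q12 \<noteq> p" "ell p a1 b1 \<inter> ell p a2 b2 = {p, q12}"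
    by (rule sections_meet[OF s(1,2) b(1)])
  obtain q13 where q13: "q13 \<noteq> p" "ell p a1 b1 \<inter> ell p a3 b3 = {p, q13}"
    by (rule sections_meet[OF s(1,3) b(2)])
  obtain q23 where q23: "q23 \<noteq> p" "ell p a2 b2 \<inter> ell p a3 b3 = {p, q23}"
    by (rule sections_meet[OF s(2,3) b(3)])
  have sub: "ell p a1 b1 \<subseteq> S" "ell p a2 b2 \<subseteq> S" "ell p a3 b3 \<subseteq> S" using s by (auto simp: section_at_def)
  have nb: "n \<bullet> b1 = 0" "n \<bullet> b2 = 0" "n \<bullet> b3 = 0" using s by (auto simp: section_at_def)
  let ?D = "\<lambda>x v. (0, v, 0, 0) + monomials_polar x v :: qcoef"
  let ?W = "\<lambda>a b. monomials_polar b b - ?D p a"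
  define W0 where "W0 = {monomials p, ?D p b1, ?D p b2, ?W a1 b1, ?W a2 b2, ?W a3 b3}"
  have W0: "finite W0" "card W0 \<le> 6" by (auto simp: W0_def card_insert_if)
  have contact: "quad C p = 0 \<and> (\<forall>b \<in> {b1,b2,b3}. quad_deriv C p b = 0) \<and> polar C b1 b1 = quad_deriv C p a1 \<and>
      polar C b2 b2 = quad_deriv C p a2 \<and> polar C b3 b3 = quad_deriv C p a3"
    if "\<And>w. w \<in> W0 \<Longrightarrow> C \<bullet> w = 0" for C
  proof -
    have D: "quad_deriv C p b1 = 0" "quad_deriv C p b2 = 0"
      using that unfolding quad_deriv_def W0_def by blast+
    have "quad_deriv C p b3 = 0"
      by (rule quad_deriv_0_on_plane[OF n nb(1,2) b(1) D nb(3)])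
    moreover have "quad C p = 0" using that unfolding quad_def W0_def by blast
    moreover have "C \<bullet> ?W a1 b1 = 0" "C \<bullet> ?W a2 b2 = 0" "C \<bullet> ?W a3 b3 = 0"
      using that unfolding W0_def by blast+
    ultimately show ?thesis using D unfolding inner_contact_functional by auto
  qed
  show ?thesis
  proof (cases "q12 = q13")
    case False
    have W: "finite (W0 \<union> {monomials q12, monomials q13, monomials q23})"
      "card (W0 \<union> {monomials q12, monomials q13, monomials q23}) \<le> 9"
    proof -
      have "card {monomials q12, monomials q13, monomials q23} \<le> 3" by (simp add: card_insert_if)
      then show "card (W0 \<union> {monomials q12, monomials q13, monomials q23}) \<le> 9"
        using card_Un_le[of W0 "{monomials q12, monomials q13, monomials q23}"] W0 by linarith
    qed (use W0 in auto)
    obtain C where C: "C \<noteq> 0" "\<And>w. w \<in> W0 \<union> {monomials q12, monomials q13, monomials q23} \<Longrightarrow> C \<bullet> w = 0"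
      using exists_quad_with_nine_conditions[OF W] by blast
    have q: "quad C q12 = 0" "quad C q13 = 0" "quad C q23 = 0" using C(2) by (simp_all add: quad_def)
    note c = contact[OF C(2)[OF UnI1], simplified]
    have d: "q12 \<noteq> q23" "q13 \<noteq> q23" using False q12 q13 q23 by blast+
    have "\<forall>x \<in> ell p a1 b1. quad C x = 0"
      by (rule quad_0_on_ell_triple[of C p b1 a1 q12 q13]) (use c q q12 q13 False in auto)
    moreover have "\<forall>x \<in> ell p a2 b2. quad C x = 0"
      by (rule quad_0_on_ell_triple[of C p b2 a2 q12 q23]) (use c q q12 q23 d in auto)
    moreover have "\<forall>x \<in> ell p a3 b3. quad C x = 0"
      by (rule quad_0_on_ell_triple[of C p b3 a3 q13 q23]) (use c q q13 q23 d in auto)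
    ultimately show ?thesis using that C(1) by blast
  next
    case True
    define q where "q = q12"
    have q: "q \<in> ell p a1 b1" "q \<in> ell p a2 b2" "q \<in> ell p a3 b3" "q \<noteq> p"
      using True q12 q13 by (auto simp: q_def)
    obtain u1 y1 where 1: "q = p - u1 *\<^sub>R a1 + y1 *\<^sub>R b1" "u1\<^sup>2 + y1\<^sup>2 = 2 * u1"
      by (rule ell_pointE[OF q(1)])
    obtain u2 y2 where 2: "q = p - u2 *\<^sub>R a2 + y2 *\<^sub>R b2" "u2\<^sup>2 + y2\<^sup>2 = 2 * u2"
      by (rule ell_pointE[OF q(2)])
    obtain u3 y3 where 3: "q = p - u3 *\<^sub>R a3 + y3 *\<^sub>R b3" "u3\<^sup>2 + y3\<^sup>2 = 2 * u3"
      by (rule ell_pointE[OF q(3)])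
    have u: "u1 \<noteq> 0" "u2 \<noteq> 0" "u3 \<noteq> 0" using 1 2 3 q(4) by auto
    define t1 where "t1 = (1-u1) *\<^sub>R b1 - y1 *\<^sub>R a1"
    define t2 where "t2 = (1-u2) *\<^sub>R b2 - y2 *\<^sub>R a2"
    define t3 where "t3 = (1-u3) *\<^sub>R b3 - y3 *\<^sub>R a3"
    have t: "t1 \<times> t2 \<noteq> 0"
      unfolding t1_def t2_def by (rule tangents_at_second_point[OF s(1,2) b(1) 1 2 q(4)])
    obtain c1 where c1: "ell p a1 b1 = ell q c1 t1" using ell_rebase(1)[OF 1(2,1) refl t1_def] by blast
    obtain c2 where c2: "ell p a2 b2 = ell q c2 t2" using ell_rebase(1)[OF 2(2,1) refl t2_def] by blast
    obtain c3 where c3: "ell p a3 b3 = ell q c3 t3" using ell_rebase(1)[OF 3(2,1) refl t3_def] by blast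
    obtain m where m: "m \<noteq> 0" "\<forall>w \<in> S. m \<bullet> (w - q) \<le> 0" using sup q(1) sub(1) by blast
    have mt: "m \<bullet> t1 = 0" "m \<bullet> t2 = 0" "m \<bullet> t3 = 0"
      using support_normal_orth_tangent[of q c1 t1 m] support_normal_orth_tangent[of q c2 t2 m] support_normal_orth_tangent[of q c3 t3 m] sub m(2) c1 c2 c3
      by blast+
    let ?V = "{monomials q, ?D q t1, ?D q t2}"
    have W: "finite (W0 \<union> ?V)" "card (W0 \<union> ?V) \<le> 9"
    proof -
      have "card ?V \<le> 3" by (simp add: card_insert_if)
      then show "card (W0 \<union> ?V) \<le> 9" using card_Un_le[of W0 ?V] W0 by linarith
    qed (use W0 in auto)
    obtain C where C: "C \<noteq> 0" "\<And>w. w \<in> W0 \<union> ?V \<Longrightarrow> C \<bullet> w = 0"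
      using exists_quad_with_nine_conditions[OF W] by blast
    have Q: "quad C q = 0" and D: "quad_deriv C q t1 = 0" "quad_deriv C q t2 = 0"
      using C(2) unfolding quad_def quad_deriv_def by blast+
    have D3: "quad_deriv C q t3 = 0"
      by (rule quad_deriv_0_on_plane[OF m(1) mt(1,2) t D mt(3)])
    note c = contact[OF C(2)[OF UnI1], simplified]
    have "\<forall>x \<in> ell p a1 b1. quad C x = 0"
      by (rule quad_0_on_ell_triple_double[OF _ _ _ 1(2) u(1) 1(1)]) (use c Q D in \<open>auto simp: t1_def\<close>)
    moreover have "\<forall>x \<in> ell p a2 b2. quad C x = 0"
      by (rule quad_0_on_ell_triple_double[OF _ _ _ 2(2) u(2) 2(1)]) (use c Q D in \<open>auto simp: t2_def\<close>)
    moreover have "\<forall>x \<in> ell p a3 b3. quad C x = 0"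
      by (rule quad_0_on_ell_triple_double[OF _ _ _ 3(2) u(3) 3(1)]) (use c Q D3 in \<open>auto simp: t3_def\<close>)
    ultimately show ?thesis using that C(1) by blast
  qed
qed

text \<open>
  A quadric that is singular at \<open>p\<close> is a cone with apex \<open>p\<close>. If it contains the three ellipses, its quadratic part vanishes on
  their planes and, having three zeros among the tangent directions, on the supporting plane. Two of these
  planes and the supporting plane are enough to kill a quadratic form.
\<close>
lemma quad_eq_0_if_singular:
  assumes n: "n \<noteq> 0"
    and s: "section_at S p n a1 b1" "section_at S p n a2 b2" "section_at S p n a3 b3"
    and b: "b1 \<times> b2 \<noteq> 0" "b1 \<times> b3 \<noteq> 0" "b2 \<times> b3 \<noteq> 0"
    and Q: "\<forall>x \<in> ell p a1 b1. quad C x = 0" "\<forall>x \<in> ell p a2 b2. quad C x = 0" "\<forall>x \<in> ell p a3 b3. quad C x = 0"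
    and sing: "quad_deriv C p n = 0"
  shows "C = 0"
proof -
  have nb: "n \<bullet> b1 = 0" "n \<bullet> b2 = 0" "n \<bullet> b3 = 0" and na: "n \<bullet> a1 \<noteq> 0" "n \<bullet> a2 \<noteq> 0"
    using s by (auto simp: section_at_def)
  have q0: "quad C p = 0" using Q(1) by simp
  note t1 = quad_0_on_ell_iff[OF q0, of a1 b1, THEN iffD1, OF Q(1)]
  note t2 = quad_0_on_ell_iff[OF q0, of a2 b2, THEN iffD1, OF Q(2)]
  note t3 = quad_0_on_ell_iff[OF q0, of a3 b3, THEN iffD1, OF Q(3)]
  have D: "quad_deriv C p b1 = 0" "quad_deriv C p b2 = 0" using t1 t2 by (auto simp: trace_poly_def)
  have l0: "quad_deriv C p v = 0" for v
  proof -
    define v' where "v' = v - ((n \<bullet> v) / (n \<bullet> n)) *\<^sub>R n"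
    have "n \<bullet> v' = 0" using n by (simp add: v'_def inner_diff_right)
    then have "quad_deriv C p v' = 0" by (rule quad_deriv_0_on_plane[OF n nb(1,2) b(1) D])
    then show ?thesis by (simp add: v'_def quad_deriv_simps sing)
  qed
  have p1: "polar C b1 b1 = 0" "polar C a1 a1 = 0" "polar C a1 b1 = 0" using t1 l0 by (auto simp: trace_poly_def)
  have p2: "polar C b2 b2 = 0" "polar C a2 b2 = 0" using t2 l0 by (auto simp: trace_poly_def)
  have p3: "polar C b3 b3 = 0" using t3 l0 by (auto simp: trace_poly_def)
  obtain x y where b3: "b3 = x *\<^sub>R b1 + y *\<^sub>R b2" by (rule orthogonal_span[OF n nb(1,2) b(1) nb(3)])
  have "x \<noteq> 0" "y \<noteq> 0" using b(2,3) b3 by (auto simp: cross_add_right cross_mult_right cross_add_left cross_mult_left)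
  moreover have "2 * x * y * polar C b1 b2 = 0"
    using p3 p1 p2 unfolding b3 by (simp add: polar_simps polar_commute[of C b2 b1])
  ultimately have p12: "polar C b1 b2 = 0" by simp
  \<comment> \<open>The vectors \<open>a1\<close>, \<open>b1\<close>, \<open>b2\<close> form a basis; the one product not known yet, of \<open>a1\<close> and \<open>b2\<close>, comes from the second plane, which contains \<open>b2\<close> and a vector \<open>a2\<close> off the tangent plane.\<close>
  have dec: "\<exists>s y z. v = s *\<^sub>R a1 + y *\<^sub>R b1 + z *\<^sub>R b2 \<and> s = (n \<bullet> v) / (n \<bullet> a1)" for v
  proof -
    define s where "s = (n \<bullet> v) / (n \<bullet> a1)"
    have o: "n \<bullet> (v - s *\<^sub>R a1) = 0" using na by (simp add: s_def inner_diff_right)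
    obtain y z where "v - s *\<^sub>R a1 = y *\<^sub>R b1 + z *\<^sub>R b2" by (rule orthogonal_span[OF n nb(1,2) b(1) o])
    then have "v = s *\<^sub>R a1 + y *\<^sub>R b1 + z *\<^sub>R b2" by (simp add: algebra_simps)
    then show ?thesis using s_def by blast
  qed
  obtain s y z where a2: "a2 = s *\<^sub>R a1 + y *\<^sub>R b1 + z *\<^sub>R b2" "s = (n \<bullet> a2) / (n \<bullet> a1)" using dec by blast
  have "s \<noteq> 0" using a2(2) na by simp
  moreover have "s * polar C a1 b2 = 0" using p2 p12 unfolding a2(1) by (simp add: polar_simps)
  ultimately have pa: "polar C a1 b2 = 0" by simp
  have "polar C v v = 0" for v
  proof -
    obtain s y z where v: "v = s *\<^sub>R a1 + y *\<^sub>R b1 + z *\<^sub>R b2" using dec by blast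
    show ?thesis unfolding v
      by (simp add: polar_simps p1 p2 p12 pa polar_commute[of C b1 a1] polar_commute[of C b2 a1] polar_commute[of C b2 b1])
  qed
  then have "quad C (p + v) = 0" for v by (simp add: quad_taylor q0 l0)
  then have "quad C x = 0" for x by (metis add_diff_cancel_left' diff_add_cancel add.commute)
  then show ?thesis by (rule quad_eq_0_imp)
qed

text \<open>
  Some nontrivial combination of the two polynomials has gradient zero at \<open>p\<close>, so it vanishes identically.
\<close>
lemma quadric_through_three_sections_unique:
  assumes n: "n \<noteq> 0"
    and s: "section_at S p n a1 b1" "section_at S p n a2 b2" "section_at S p n a3 b3"
    and b: "b1 \<times> b2 \<noteq> 0" "b1 \<times> b3 \<noteq> 0" "b2 \<times> b3 \<noteq> 0"
    and Q: "\<forall>x \<in> ell p a1 b1. quad C x = 0" "\<forall>x \<in> ell p a2 b2. quad C x = 0" "\<forall>x \<in> ell p a3 b3. quad C x = 0"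
    and Q': "\<forall>x \<in> ell p a1 b1. quad C' x = 0" "\<forall>x \<in> ell p a2 b2. quad C' x = 0" "\<forall>x \<in> ell p a3 b3. quad C' x = 0"
    and nz: "C \<noteq> 0" "C' \<noteq> 0"
  shows "quad C x = 0 \<longleftrightarrow> quad C' x = 0"
proof -
  define k k' where "k = quad_deriv C p n" and "k' = quad_deriv C' p n"
  have k: "k \<noteq> 0" "k' \<noteq> 0"
    using quad_eq_0_if_singular[OF n s b Q] quad_eq_0_if_singular[OF n s b Q'] nz by (auto simp: k_def k'_def)
  have "k' *\<^sub>R C + (- k) *\<^sub>R C' = 0"
  proof (rule quad_eq_0_if_singular[OF n s b])
    show "quad_deriv (k' *\<^sub>R C + (- k) *\<^sub>R C') p n = 0"
      unfolding quad_deriv_scale_add by (simp add: k_def k'_def)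
  qed (unfold quad_scale_add, use Q Q' in auto)
  then have "k' * quad C x + (- k) * quad C' x = 0"
    unfolding quad_scale_add[symmetric] by (simp add: quad_def)
  then show ?thesis using k by auto
qed

section \<open>Second order contact\<close>

text \<open>
  Near \<open>p\<close> the surface is \<open>n \<bullet> (x - p) = T (x - p) (x - p)\<close> up to an error \<open>o(norm (x - p)\<^sup>2)\<close>: on
  tangent vectors, and for a unit normal \<open>n\<close>, \<open>T\<close> is half the second fundamental form, expressed
  without a parametrization.
\<close>
definition osculates :: "(real^3) set \<Rightarrow> real^3 \<Rightarrow> real^3 \<Rightarrow> (real^3 \<Rightarrow> real^3 \<Rightarrow> real) \<Rightarrow> bool" where
  "osculates S p n T \<longleftrightarrow> bilinear T \<and> (\<forall>e>0. \<exists>d>0. \<forall>x\<in>S. dist x p < d \<longrightarrow>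
     \<bar>n \<bullet> (x - p) - T (x - p) (x - p)\<bar> \<le> e * (norm (x - p))\<^sup>2)"

text \<open>
  Since \<open>n\<close> supports the surface at \<open>p\<close>, it is orthogonal to the image of the derivative \<open>L\<close> of the
  parametrization, so the height \<open>n \<bullet> (\<phi> (u0 + w) - p)\<close> is half the second derivative up to \<open>o(norm w\<^sup>2)\<close>. A left inverse \<open>A\<close> of \<open>L\<close> recovers
  the parameter \<open>w\<close> from \<open>x - p\<close> to first order, which turns this into a form in \<open>x - p\<close>.
\<close>
lemma C2_surface_second_order:
  fixes S :: "(real^3) set"
  assumes S: "C2_embedded_surface S" and p: "p \<in> S" and sup: "\<And>x. x \<in> S \<Longrightarrow> n \<bullet> (x - p) \<le> 0"
  shows "\<exists>T. osculates S p n T"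
proof -
  obtain V U \<phi> \<psi> where V: "open V" "p \<in> V" and C2: "C2_on (\<phi> :: real^2 \<Rightarrow> real^3) U"
    and hom: "homeomorphism U (S \<inter> V) \<phi> \<psi>" and inj: "\<forall>u\<in>U. inj (frechet_derivative \<phi> (at u))"
    using S[unfolded C2_embedded_surface_def, rule_format, OF p] by (elim exE conjE) (rule that)
  have "\<exists>(f' :: real^2 \<Rightarrow> ((real^2) \<Rightarrow>\<^sub>L (real^3))) (f'' :: real^2 \<Rightarrow> ((real^2) \<Rightarrow>\<^sub>L ((real^2) \<Rightarrow>\<^sub>L (real^3)))).
        (\<forall>x\<in>U. (\<phi> has_derivative blinfun_apply (f' x)) (at x)) \<and>
        (\<forall>x\<in>U. (f' has_derivative blinfun_apply (f'' x)) (at x)) \<and> continuous_on U f''"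
    and U: "open U" using C2 unfolding C2_on_def by simp_all
  then obtain f' :: "real^2 \<Rightarrow> ((real^2) \<Rightarrow>\<^sub>L (real^3))" and f'' :: "real^2 \<Rightarrow> ((real^2) \<Rightarrow>\<^sub>L ((real^2) \<Rightarrow>\<^sub>L (real^3)))"
    where dd: "\<forall>x\<in>U. (\<phi> has_derivative blinfun_apply (f' x)) (at x)"
      "\<forall>x\<in>U. (f' has_derivative blinfun_apply (f'' x)) (at x)"
    by (elim exE conjE) (rule that)
  note d1 = bspec[OF dd(1)] and d2 = bspec[OF dd(2)]
  define u0 where "u0 = \<psi> p"
  have u0: "u0 \<in> U" "\<phi> u0 = p"
    using hom p V by (auto simp: homeomorphism_def u0_def)
  have \<phi>S: "\<phi> u \<in> S" if "u \<in> U" for u using hom that by (auto simp: homeomorphism_def)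
  define L where "L = blinfun_apply (f' u0)"
  have linL: "linear L" unfolding L_def by (rule bounded_linear.linear[OF blinfun.bounded_linear_right])
  have "frechet_derivative \<phi> (at u0) = L"
    using frechet_derivative_at[OF d1[OF u0(1)]] by (simp add: L_def)
  then have injL: "inj L" using inj u0(1) by metis
  obtain A where A: "linear A" "A \<circ> L = id"
    using linear_injective_left_inverse[OF linL injL] by blast
  have AL: "A (L w) = w" for w using A(2) by (metis comp_apply id_apply)
  have blA: "bounded_linear A" using A(1) by (rule linear_conv_bounded_linear[THEN iffD1])
  obtain k where k: "k > 0" "\<And>x. norm (A x) \<le> norm x * k"
    using bounded_linear.pos_bounded[OF blA] by blast
  have nL: "n \<bullet> L w = 0" for w
  proof -
    have "((\<lambda>u. n \<bullet> \<phi> u) has_derivative (\<lambda>w. n \<bullet> L w)) (at u0)"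
      unfolding L_def by (intro derivative_intros d1 u0)
    moreover have "\<forall>u\<in>U. n \<bullet> \<phi> u \<le> n \<bullet> \<phi> u0"
      using sup \<phi>S u0(2) by (simp add: inner_diff_right)
    ultimately have "(\<lambda>w. n \<bullet> L w) = (\<lambda>w. 0)"
      using differential_zero_maxmin[OF u0(1) U] by blast
    then show ?thesis by metis
  qed
  define H where "H v w = n \<bullet> blinfun_apply (blinfun_apply (f'' u0) v) w / 2" for v w
  have bH: "bilinear H"
    unfolding bilinear_def H_def
    by (intro conjI allI linearI) (simp_all add: blinfun.bilinear_simps inner_add_right add_divide_distrib)
  define M where "M = norm n * norm (f'' u0)"
  have M0: "0 \<le> M" by (simp add: M_def)
  have HM: "\<bar>H v w\<bar> \<le> M * norm v * norm w" for v w
  proof -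
    have "\<bar>n \<bullet> blinfun_apply (blinfun_apply (f'' u0) v) w\<bar> \<le> norm n * norm (blinfun_apply (blinfun_apply (f'' u0) v) w)"
      by (rule Cauchy_Schwarz_ineq2)
    also have "\<dots> \<le> norm n * (norm (blinfun_apply (f'' u0) v) * norm w)"
      by (intro mult_left_mono norm_blinfun) auto
    also have "\<dots> \<le> norm n * ((norm (f'' u0) * norm v) * norm w)"
      by (intro mult_left_mono mult_right_mono norm_blinfun) auto
    finally show ?thesis unfolding H_def M_def by (simp add: mult.assoc)
  qed
  \<comment> \<open>Second order Taylor expansion from differentiability of \<open>f'\<close> at \<open>u0\<close> alone, by the mean value theorem on the segment from \<open>u0\<close> to \<open>u0 + w\<close>.\<close>
  have taylor: "\<exists>d>0. \<forall>w. norm w < d \<longrightarrow> u0 + w \<in> U \<and> \<bar>n \<bullet> (\<phi> (u0 + w) - p) - H w w\<bar> \<le> e * (norm w)\<^sup>2"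
    if e: "e > 0" for e
  proof -
    define e1 where "e1 = e / (norm n + 1)"
    have e1: "e1 > 0" "norm n * e1 \<le> e" using e by (simp_all add: e1_def field_simps add_nonneg_pos add_pos_nonneg)
    obtain r where r: "r > 0" "ball u0 r \<subseteq> U" using U u0(1) open_contains_ball by blast
    obtain d where d: "d > 0" "\<And>y. norm (y - u0) < d \<Longrightarrow>
        norm (f' y - f' u0 - blinfun_apply (f'' u0) (y - u0)) \<le> e1 * norm (y - u0)"
      using d2[OF u0(1)] e1(1) unfolding has_derivative_at_alt by blast
    have "u0 + w \<in> U \<and> \<bar>n \<bullet> (\<phi> (u0 + w) - p) - H w w\<bar> \<le> e * (norm w)\<^sup>2" if w: "norm w < min r d" for w
    proof -
      have small: "norm (t *\<^sub>R w) < min r d" "norm (t *\<^sub>R w) \<le> norm w" if "0 \<le> t" "t \<le> 1" for t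
      proof -
        have "norm (t *\<^sub>R w) \<le> 1 * norm w" using that by (simp only: norm_scaleR) (intro mult_right_mono, auto)
        then show "norm (t *\<^sub>R w) < min r d" "norm (t *\<^sub>R w) \<le> norm w" using w by auto
      qed
      have inU: "u0 + t *\<^sub>R w \<in> U" if "0 \<le> t" "t \<le> 1" for t
        using small(1)[OF that] r(2) by (auto simp: dist_norm subset_iff)
      define g where "g t = n \<bullet> \<phi> (u0 + t *\<^sub>R w) - t\<^sup>2 * H w w" for t
      define g' where "g' t = n \<bullet> blinfun_apply (f' (u0 + t *\<^sub>R w)) w - 2 * t * H w w" for t
      have "DERIV g t :> g' t" if "0 \<le> t" "t \<le> 1" for t
      proof -
        have c: "((\<lambda>t. u0 + t *\<^sub>R w) has_derivative (\<lambda>s. s *\<^sub>R w)) (at t)"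
          by (auto intro!: derivative_eq_intros)
        have "((\<lambda>t. \<phi> (u0 + t *\<^sub>R w)) has_derivative (\<lambda>s. blinfun_apply (f' (u0 + t *\<^sub>R w)) (s *\<^sub>R w))) (at t)"
          using has_derivative_compose[OF c d1[OF inU[OF that]]] .
        then have "((\<lambda>t. n \<bullet> \<phi> (u0 + t *\<^sub>R w)) has_derivative (\<lambda>s. n \<bullet> blinfun_apply (f' (u0 + t *\<^sub>R w)) (s *\<^sub>R w))) (at t)"
          by (intro derivative_intros)
        then have "((\<lambda>t. n \<bullet> \<phi> (u0 + t *\<^sub>R w)) has_field_derivative (n \<bullet> blinfun_apply (f' (u0 + t *\<^sub>R w)) w)) (at t)"
          by (simp add: has_field_derivative_def blinfun.scaleR_right mult.commute[of _ "n \<bullet> _"] mult_commute_abs)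
        then show ?thesis unfolding g_def g'_def by (auto intro!: derivative_eq_intros)
      qed
      then obtain t where t: "0 < t" "t < 1" "g 1 - g 0 = (1 - 0) * g' t"
        using MVT2[of 0 1 g g'] by auto
      have "g' t = n \<bullet> blinfun_apply (f' (u0 + t *\<^sub>R w) - f' u0 - blinfun_apply (f'' u0) (t *\<^sub>R w)) w"
        using nL[of w] by (simp add: g'_def H_def L_def blinfun.bilinear_simps inner_diff_right)
      also have "\<bar>\<dots>\<bar> \<le> norm n * norm (blinfun_apply (f' (u0 + t *\<^sub>R w) - f' u0 - blinfun_apply (f'' u0) (t *\<^sub>R w)) w)"
        by (rule Cauchy_Schwarz_ineq2)
      also have "\<dots> \<le> norm n * (norm (f' (u0 + t *\<^sub>R w) - f' u0 - blinfun_apply (f'' u0) (t *\<^sub>R w)) * norm w)"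
        by (intro mult_left_mono norm_blinfun) auto
      also have "\<dots> \<le> norm n * ((e1 * norm w) * norm w)"
      proof (intro mult_left_mono mult_right_mono)
        have "norm (f' (u0 + t *\<^sub>R w) - f' u0 - blinfun_apply (f'' u0) (t *\<^sub>R w)) \<le> e1 * norm (t *\<^sub>R w)"
          using d(2)[of "u0 + t *\<^sub>R w"] small(1)[of t] t by simp
        also have "\<dots> \<le> e1 * norm w" using small(2)[of t] t e1 by (intro mult_left_mono) auto
        finally show "norm (f' (u0 + t *\<^sub>R w) - f' u0 - blinfun_apply (f'' u0) (t *\<^sub>R w)) \<le> e1 * norm w" .
      qed auto
      also have "\<dots> = (norm n * e1) * (norm w)\<^sup>2" by (simp add: power2_eq_square)
      also have "\<dots> \<le> e * (norm w)\<^sup>2" using e1(2) by (intro mult_right_mono) auto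
      finally have "\<bar>g 1 - g 0\<bar> \<le> e * (norm w)\<^sup>2" using t(3) by simp
      moreover have "g 1 - g 0 = n \<bullet> (\<phi> (u0 + w) - p) - H w w"
        by (simp add: g_def u0(2) inner_diff_right)
      ultimately show ?thesis using inU[of 1] by simp
    qed
    then show ?thesis using r(1) d(1) by (intro exI[of _ "min r d"]) auto
  qed
  define T where "T v w = H (A v) (A w)" for v w
  have bT: "bilinear T"
    unfolding bilinear_def T_def
    by (intro conjI allI linearI)
      (simp_all add: linear_add[OF A(1)] linear_scale[OF A(1)] bilinear_ladd[OF bH] bilinear_radd[OF bH]
        bilinear_lmul[OF bH] bilinear_rmul[OF bH])
  have "\<exists>d>0. \<forall>x\<in>S. dist x p < d \<longrightarrow> \<bar>n \<bullet> (x - p) - T (x - p) (x - p)\<bar> \<le> e * (norm (x - p))\<^sup>2"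
    if e: "e > 0" for e
  proof -
    \<comment> \<open>With error \<open>e1\<close> in both first and second order expansions the total error is at most \<open>e1 * c\<close>, and \<open>e1 * k \<le> 1/2\<close> bounds \<open>w\<close> by \<open>2 k\<close> times the distance.\<close>
    define c where "c = 4 * k\<^sup>2 + 6 * M * k^3"
    have c: "c > 0" using k(1) M0 unfolding c_def by (simp add: add_pos_nonneg)
    define e1 where "e1 = min (1 / (2 * k)) (e / c)"
    have "e1 * k \<le> (1 / (2 * k)) * k" using k(1) by (intro mult_right_mono) (auto simp: e1_def)
    moreover have "e1 * c \<le> (e / c) * c" using c by (intro mult_right_mono) (auto simp: e1_def)
    ultimately have e1: "e1 > 0" "e1 * k \<le> 1/2" "e1 * c \<le> e" using e c k(1) by (auto simp: e1_def)
    obtain r1 where r1: "r1 > 0" "\<And>w. norm w < r1 \<Longrightarrow> u0 + w \<in> U \<and> \<bar>n \<bullet> (\<phi> (u0 + w) - p) - H w w\<bar> \<le> e1 * (norm w)\<^sup>2"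
      using taylor[OF e1(1)] by blast
    obtain r2 where r2: "r2 > 0" "\<And>y. norm (y - u0) < r2 \<Longrightarrow> norm (\<phi> y - \<phi> u0 - L (y - u0)) \<le> e1 * norm (y - u0)"
      using d1[OF u0(1)] e1(1) unfolding has_derivative_at_alt L_def by blast
    have "continuous_on (S \<inter> V) \<psi>" using hom by (simp add: homeomorphism_def)
    then obtain r3 where r3: "r3 > 0" "\<And>x. x \<in> S \<inter> V \<Longrightarrow> dist x p < r3 \<Longrightarrow> dist (\<psi> x) (\<psi> p) < min r1 r2"
      using p V(2) r1(1) r2(1) unfolding continuous_on_iff by (metis IntI min_less_iff_conj)
    obtain r4 where r4: "r4 > 0" "ball p r4 \<subseteq> V" using V open_contains_ball by blast
    have "\<bar>n \<bullet> (x - p) - T (x - p) (x - p)\<bar> \<le> e * (norm (x - p))\<^sup>2" if x: "x \<in> S" "dist x p < min r3 r4" for x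
    proof -
      have xV: "x \<in> S \<inter> V" using x r4(2) by (auto simp: subset_iff dist_commute)
      define w where "w = \<psi> x - u0"
      have xw: "\<phi> (u0 + w) = x" using hom xV by (simp add: w_def homeomorphism_def)
      have w: "norm w < r1" "norm w < r2" using r3(2)[OF xV] x by (auto simp: w_def u0_def dist_norm)
      define v where "v = A (x - p)"
      have "v - w = A (x - p - L w)" using A(1) AL[of w] by (simp add: v_def linear_diff)
      then have "norm (v - w) \<le> norm (x - p - L w) * k" using k(2) by simp
      also have "\<dots> \<le> (e1 * norm w) * k"
        using r2(2)[of "u0 + w"] w(2) xw u0(2) k(1) by (intro mult_right_mono) auto
      finally have vw: "norm (v - w) \<le> e1 * k * norm w" by (simp add: mult_ac)
      also have "\<dots> \<le> 1/2 * norm w" using e1(2) by (intro mult_right_mono) auto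
      finally have "norm w \<le> 2 * norm v" using norm_triangle_ineq2[of w v] by (simp add: norm_minus_commute)
      moreover have nv: "norm v \<le> k * norm (x - p)" using k(2)[of "x - p"] by (simp add: v_def mult.commute)
      ultimately have nw: "norm w \<le> 2 * k * norm (x - p)" by linarith
      have "H v v - H w w = H (v - w) v + H w (v - w)"
        using bH by (simp add: bilinear_lsub bilinear_rsub)
      also have "\<bar>\<dots>\<bar> \<le> M * norm (v - w) * norm v + M * norm w * norm (v - w)"
        using HM[of "v - w" v] HM[of w "v - w"] by linarith
      also have "\<dots> = M * (norm (v - w) * (norm v + norm w))" by (simp add: algebra_simps)
      also have "\<dots> \<le> M * ((e1 * k * (2 * k * norm (x - p))) * (k * norm (x - p) + 2 * k * norm (x - p)))"
      proof (intro mult_left_mono[OF _ M0] mult_mono)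
        show "norm (v - w) \<le> e1 * k * (2 * k * norm (x - p))"
        proof -
          have "e1 * k * norm w \<le> e1 * k * (2 * k * norm (x - p))"
            by (rule mult_left_mono[OF nw]) (use e1 k in auto)
          then show ?thesis using vw by linarith
        qed
      qed (use nv nw e1 k in auto)
      also have "\<dots> = e1 * (6 * M * k^3) * (norm (x - p))\<^sup>2"
        by (simp add: power2_eq_square power3_eq_cube algebra_simps)
      finally have 1: "\<bar>H v v - H w w\<bar> \<le> e1 * (6 * M * k^3) * (norm (x - p))\<^sup>2" .
      have "\<bar>n \<bullet> (x - p) - H w w\<bar> \<le> e1 * (norm w)\<^sup>2" using r1(2)[OF w(1)] xw by simp
      also have "\<dots> \<le> e1 * (2 * k * norm (x - p))\<^sup>2" using nw e1(1) by (intro mult_left_mono power_mono) auto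
      also have "\<dots> = e1 * (4 * k\<^sup>2) * (norm (x - p))\<^sup>2" by (simp add: power2_eq_square algebra_simps)
      finally have "\<bar>n \<bullet> (x - p) - H v v\<bar> \<le> e1 * (4 * k\<^sup>2) * (norm (x - p))\<^sup>2 + e1 * (6 * M * k^3) * (norm (x - p))\<^sup>2"
        using 1 by linarith
      also have "\<dots> = (e1 * c) * (norm (x - p))\<^sup>2" by (simp add: c_def algebra_simps)
      also have "\<dots> \<le> e * (norm (x - p))\<^sup>2" using e1(3) by (intro mult_right_mono) auto
      finally show ?thesis by (simp add: T_def v_def)
    qed
    then show ?thesis using r3(1) r4(1) by (intro exI[of _ "min r3 r4"]) auto
  qed
  with bT show ?thesis unfolding osculates_def by blast
qed

text \<open>
  For points of the surface approaching \<open>p\<close> in direction \<open>b\<close>, the height divided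
  by the square of the scaling factor \<open>r\<close> tends to \<open>T b b\<close>.
\<close>
lemma osculates_curve:
  assumes T: "osculates S p n T"
    and lim: "(r \<longlongrightarrow> 0) F" "(w \<longlongrightarrow> b) F" "((\<lambda>t. n \<bullet> w t / r t) \<longlongrightarrow> c) F"
    and ev: "eventually (\<lambda>t. r t \<noteq> (0::real) \<and> p + r t *\<^sub>R w t \<in> S) F" and F: "F \<noteq> bot"
  shows "c = T b b"
proof -
  have bb: "bounded_bilinear T" using T by (simp add: osculates_def bilinear_conv_bounded_bilinear)
  have bound: "\<bar>c - T b b\<bar> \<le> e * (norm b)\<^sup>2" if e: "e > 0" for e
  proof -
    obtain d where d: "d > 0" "\<And>x. x\<in>S \<Longrightarrow> dist x p < d \<Longrightarrow> \<bar>n \<bullet> (x - p) - T (x - p) (x - p)\<bar> \<le> e * (norm (x - p))\<^sup>2"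
      using T e unfolding osculates_def by meson
    have "((\<lambda>t. r t *\<^sub>R w t) \<longlongrightarrow> 0 *\<^sub>R b) F" by (intro tendsto_intros lim)
    then have "eventually (\<lambda>t. dist (r t *\<^sub>R w t) 0 < d) F" using d(1) unfolding tendsto_iff by simp
    with ev have "eventually (\<lambda>t. \<bar>n \<bullet> w t / r t - T (w t) (w t)\<bar> \<le> e * (norm (w t))\<^sup>2) F"
    proof eventually_elim
      case (elim t)
      define x where "x = p + r t *\<^sub>R w t"
      have r: "r t \<noteq> 0" using elim by simp
      have "\<bar>n \<bullet> (r t *\<^sub>R w t) - T (r t *\<^sub>R w t) (r t *\<^sub>R w t)\<bar> \<le> e * (norm (r t *\<^sub>R w t))\<^sup>2"
        using d(2)[of x] elim by (simp add: x_def dist_norm)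
      also have "T (r t *\<^sub>R w t) (r t *\<^sub>R w t) = (r t)\<^sup>2 * T (w t) (w t)"
        using T by (simp add: osculates_def bilinear_lmul bilinear_rmul power2_eq_square)
      also have "n \<bullet> (r t *\<^sub>R w t) - (r t)\<^sup>2 * T (w t) (w t) = (r t)\<^sup>2 * (n \<bullet> w t / r t - T (w t) (w t))"
        using r by (simp add: power2_eq_square algebra_simps)
      also have "e * (norm (r t *\<^sub>R w t))\<^sup>2 = (r t)\<^sup>2 * (e * (norm (w t))\<^sup>2)" by (simp add: power_mult_distrib)
      finally have "(r t)\<^sup>2 * \<bar>n \<bullet> w t / r t - T (w t) (w t)\<bar> \<le> (r t)\<^sup>2 * (e * (norm (w t))\<^sup>2)"
        by (simp add: abs_mult)
      then show ?case using r by (simp add: mult_le_cancel_left)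
    qed
    then show ?thesis
      by (rule tendsto_le[OF F _ _, rotated 2])
         (intro tendsto_intros lim bounded_bilinear.tendsto[OF bb])+
  qed
  have "\<bar>c - T b b\<bar> \<le> 0 + e" if "e > 0" for e
  proof -
    have "\<bar>c - T b b\<bar> \<le> e / ((norm b)\<^sup>2 + 1) * (norm b)\<^sup>2"
      using that by (intro bound divide_pos_pos add_nonneg_pos) auto
    also have "\<dots> \<le> e / ((norm b)\<^sup>2 + 1) * ((norm b)\<^sup>2 + 1)" using that by (intro mult_left_mono) auto
    also have "\<dots> = e" by (simp add: add_nonneg_eq_0_iff)
    finally show ?thesis by simp
  qed
  then have "\<bar>c - T b b\<bar> \<le> 0" by (rule field_le_epsilon)
  then show ?thesis by simp
qed

text \<open>
  Meusnier's theorem: the normal component of the acceleration of an ellipse in the surface depends only on its velocity.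
\<close>
lemma osculates_ell:
  assumes T: "osculates S p n T" and sub: "ell p a b \<subseteq> S" and nb: "n \<bullet> b = 0"
  shows "n \<bullet> a = - 2 * T b b"
proof -
  \<comment> \<open>The stereographic parameter \<open>1/t\<close> describes the points near \<open>p\<close>.\<close>
  let ?r = "\<lambda>t::real. 2 * t / (1 + t\<^sup>2)" and ?w = "\<lambda>t. b - t *\<^sub>R a"
  have "- (n \<bullet> a) / 2 = T b b"
  proof (rule osculates_curve[OF T])
    show "(?r \<longlongrightarrow> 0) (at_right 0)" by (auto intro!: tendsto_eq_intros)
    show "(?w \<longlongrightarrow> b) (at_right 0)" by (auto intro!: tendsto_eq_intros)
    have "((\<lambda>t. - (n \<bullet> a) * (1 + t\<^sup>2) / 2) \<longlongrightarrow> - (n \<bullet> a) / 2) (at_right 0)"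
      by (auto intro!: tendsto_eq_intros)
    moreover have "eventually (\<lambda>t. - (n \<bullet> a) * (1 + t\<^sup>2) / 2 = n \<bullet> ?w t / ?r t) (at_right 0)"
      using eventually_at_right_less[of "0::real"]
      by eventually_elim (simp add: nb inner_diff_right field_simps)
    ultimately show "((\<lambda>t. n \<bullet> ?w t / ?r t) \<longlongrightarrow> - (n \<bullet> a) / 2) (at_right 0)"
      by (rule Lim_transform_eventually)
    show "eventually (\<lambda>t. ?r t \<noteq> 0 \<and> p + ?r t *\<^sub>R ?w t \<in> S) (at_right 0)"
      using eventually_at_right_less[of "0::real"]
    proof eventually_elim
      case (elim t)
      have pos: "1 + t\<^sup>2 > 0" by (simp add: add_pos_nonneg)
      have "p + ?r t *\<^sub>R ?w t = stereo p a b (1/t)" using elim by (subst stereo_inverse) auto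
      then show ?case using elim pos stereo_in_ell[of p a b "1/t"] sub by auto
    qed
  qed simp
  then show ?thesis by simp
qed

lemma osculates_segment:
  assumes T: "osculates S p n T" and seg: "\<And>t. 0 < t \<Longrightarrow> t < 1 \<Longrightarrow> p + t *\<^sub>R v \<in> S" and nv: "n \<bullet> v = 0"
  shows "T v v = 0"
proof -
  have "0 = T v v"
  proof (rule osculates_curve[OF T, where r = "\<lambda>t. t" and w = "\<lambda>t. v" and F = "at_right 0"])
    show "eventually (\<lambda>t. t \<noteq> 0 \<and> p + t *\<^sub>R v \<in> S) (at_right (0::real))"
      using eventually_at_right_real[of 0 "1::real"] by (auto elim!: eventually_mono intro: seg)
  qed (auto simp: nv tendsto_ident_at)
  then show ?thesis by simp
qed

text \<open>
  If the ellipse lay in the supporting plane, so would its chords from \<open>p\<close>; they consist of boundary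
  points, so \<open>T\<close> vanishes in their directions, which are enough to make \<open>T\<close> vanish on the whole plane. But
  along the section \<open>a1, b1\<close> it does not vanish.
\<close>
lemma no_ellipse_in_support_plane:
  assumes K: "convex K" and n: "n \<noteq> 0" "\<And>w. w \<in> K \<Longrightarrow> n \<bullet> (w - p) \<le> 0"
    and T: "osculates (frontier K) p n T" and s: "section_at (frontier K) p n a1 b1"
    and ab: "a \<times> b \<noteq> 0" "ell p a b \<subseteq> K" "n \<bullet> b = 0"
  shows "n \<bullet> a \<noteq> 0"
proof
  assume na: "n \<bullet> a = 0"
  have bil: "bilinear T" using T by (simp add: osculates_def)
  have Tv: "T v v = 0" if v: "p + v \<in> ell p a b" "n \<bullet> v = 0" for v
  proof (rule osculates_segment[OF T _ v(2)])
    fix t :: real assume t: "0 < t" "t < 1"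
    have "(1 - t) *\<^sub>R p + t *\<^sub>R (p + v) \<in> K"
      using K base_in_ell[of p a b] ab(2) v(1) t by (intro convexD) auto
    moreover have "(1 - t) *\<^sub>R p + t *\<^sub>R (p + v) = p + t *\<^sub>R v" by (simp add: algebra_simps)
    ultimately show "p + t *\<^sub>R v \<in> frontier K"
      using support_eq_in_frontier[of n K p "p + t *\<^sub>R v"] n v(2) by simp
  qed
  \<comment> \<open>The three chords with \<open>(u, y) = (2, 0), (1, 1), (1, -1)\<close>.\<close>
  have "T (- (2 *\<^sub>R a)) (- (2 *\<^sub>R a)) = 0" "T (b - a) (b - a) = 0" "T (- b - a) (- b - a) = 0"
    using ellI[of 2 0 p a b] ellI[of 1 1 p a b] ellI[of 1 "-1" p a b]
    by (intro Tv; simp add: na ab(3) inner_diff_right algebra_simps)+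
  then have 1: "T a a = 0" "T b b = 0" "T a b + T b a = 0"
    using bil by (simp_all add: bilinear_lsub bilinear_rsub bilinear_lneg bilinear_rneg bilinear_lmul bilinear_rmul)
  have nb1: "n \<bullet> b1 = 0" "n \<bullet> a1 \<noteq> 0" "ell p a1 b1 \<subseteq> frontier K" using s by (auto simp: section_at_def)
  obtain x y where "b1 = x *\<^sub>R a + y *\<^sub>R b" by (rule orthogonal_span[OF n(1) na ab(3,1) nb1(1)])
  then have "T b1 b1 = x * y * (T a b + T b a)"
    using bil 1(1,2) by (simp add: bilinear_ladd bilinear_radd bilinear_lmul bilinear_rmul algebra_simps)
  then have "T b1 b1 = 0" using 1(3) by simp
  then show False using osculates_ell[OF T nb1(3,1)] nb1(2) by simp
qed

text \<open>
  On tangent vectors the quadratic form \<open>G\<close> below measures how far the second order behaviour of the quadric is from that of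
  the surface. It vanishes in the directions of the three sections, so it vanishes
  on the tangent plane, and the quadric has contact of order 3 with every ellipse in the surface through \<open>p\<close>.
\<close>
lemma contact_of_quad:
  assumes n: "n \<noteq> 0" and T: "osculates S p n T"
    and s: "section_at S p n a1 b1" "section_at S p n a2 b2" "section_at S p n a3 b3"
    and b: "b1 \<times> b2 \<noteq> 0" "b1 \<times> b3 \<noteq> 0" "b2 \<times> b3 \<noteq> 0"
    and Q: "\<forall>x \<in> ell p a1 b1. quad C x = 0" "\<forall>x \<in> ell p a2 b2. quad C x = 0" "\<forall>x \<in> ell p a3 b3. quad C x = 0"
    and F: "ell p a b \<subseteq> S" "n \<bullet> b = 0"
  shows "quad_deriv C p b = 0" "polar C b b = quad_deriv C p a"
proof -
  have nb: "n \<bullet> b1 = 0" "n \<bullet> b2 = 0" "n \<bullet> b3 = 0" using s by (auto simp: section_at_def)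
  have sub: "ell p a1 b1 \<subseteq> S" "ell p a2 b2 \<subseteq> S" "ell p a3 b3 \<subseteq> S" using s by (auto simp: section_at_def)
  have q0: "quad C p = 0" using Q(1) by simp
  note t = quad_deriv_tangent_0[OF q0 Q(1)] quad_deriv_tangent_0[OF q0 Q(2)] quad_deriv_tangent_0[OF q0 Q(3)]
  have D0: "quad_deriv C p v = 0" if "n \<bullet> v = 0" for v
    by (rule quad_deriv_0_on_plane[OF n nb(1,2) b(1) t(1,3) that])
  show "quad_deriv C p b = 0" by (rule D0[OF F(2)])
  \<comment> \<open>The gradient is a multiple \<open>k n\<close> of the normal.\<close>
  define k where "k = quad_deriv C p n / (n \<bullet> n)"
  have D: "quad_deriv C p v = k * (n \<bullet> v)" for v
  proof -
    have "n \<bullet> (v - ((n \<bullet> v) / (n \<bullet> n)) *\<^sub>R n) = 0" using n by (simp add: inner_diff_right)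
    from D0[OF this] show ?thesis by (simp add: quad_deriv_simps k_def)
  qed
  have bil: "bilinear T" using T by (simp add: osculates_def)
  define G where "G v w = polar C v w + 2 * k * T v w" for v w
  have bG: "bilinear G" unfolding bilinear_def G_def
    by (intro conjI allI linearI)
      (simp_all add: polar_simps bilinear_ladd[OF bil] bilinear_radd[OF bil] bilinear_lmul[OF bil] bilinear_rmul[OF bil] algebra_simps)
  have G0: "G b' b' = 0" if "ell p a' b' \<subseteq> S" "n \<bullet> b' = 0" "polar C b' b' = quad_deriv C p a'" for a' b'
    using osculates_ell[OF T that(1,2)] that(3) D[of a'] by (simp add: G_def)
  have G: "G b1 b1 = 0" "G b2 b2 = 0" "G b3 b3 = 0"
    using G0[OF sub(1) nb(1) t(2)] G0[OF sub(2) nb(2) t(4)] G0[OF sub(3) nb(3) t(6)] by auto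
  note bs = bilinear_ladd[OF bG] bilinear_radd[OF bG] bilinear_lmul[OF bG] bilinear_rmul[OF bG]
  obtain x y where b3: "b3 = x *\<^sub>R b1 + y *\<^sub>R b2" by (rule orthogonal_span[OF n nb(1,2) b(1) nb(3)])
  have "x \<noteq> 0" "y \<noteq> 0" using b(2,3) b3 by (auto simp: cross_add_right cross_mult_right cross_add_left cross_mult_left)
  moreover have "x * y * (G b1 b2 + G b2 b1) = 0" using G unfolding b3 bs by (simp add: algebra_simps)
  ultimately have G12: "G b1 b2 + G b2 b1 = 0" by simp
  obtain x' y' where b': "b = x' *\<^sub>R b1 + y' *\<^sub>R b2" by (rule orthogonal_span[OF n nb(1,2) b(1) F(2)])
  have "G b b = x' * y' * (G b1 b2 + G b2 b1)" unfolding b' bs using G by (simp add: algebra_simps)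
  then have "G b b = 0" using G12 by simp
  then show "polar C b b = quad_deriv C p a" using osculates_ell[OF T F] D[of a] by (simp add: G_def)
qed

section \<open>The quadric of four sections near their common point\<close>

text \<open>
  The vectors \<open>B j\<close> are the tangent directions at \<open>p\<close>, so the last condition says that no two of the
  four sections are tangent.
\<close>
definition four_sections :: "(real^3) set \<Rightarrow> real^3 \<Rightarrow> real^3 \<Rightarrow> (nat \<Rightarrow> real^3) \<Rightarrow> (nat \<Rightarrow> real^3) \<Rightarrow> bool" where
  "four_sections S p n A B \<longleftrightarrow> (\<forall>j\<in>{1..4}. section_at S p n (A j) (B j)) \<and>
     (\<forall>i\<in>{1..4}. \<forall>j\<in>{1..4}. i \<noteq> j \<longrightarrow> B i \<times> B j \<noteq> 0)"

lemma quad_through_four_sections: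
  assumes sup: "\<And>x. x \<in> S \<Longrightarrow> \<exists>n. n \<noteq> 0 \<and> (\<forall>w \<in> S. n \<bullet> (w - x) \<le> 0)"
    and n: "n \<noteq> 0" "\<forall>w \<in> S. n \<bullet> (w - p) \<le> 0" and T: "osculates S p n T" and AB: "four_sections S p n A B"
  obtains C where "C \<noteq> 0" "\<And>j. j \<in> {1..4} \<Longrightarrow> \<forall>x \<in> ell p (A j) (B j). quad C x = 0"
    "\<And>a b. ell p a b \<subseteq> S \<Longrightarrow> quad_deriv C p b = 0 \<and> polar C b b = quad_deriv C p a"
proof -
  have s: "section_at S p n (A 1) (B 1)" "section_at S p n (A 2) (B 2)" "section_at S p n (A 3) (B 3)"
    "section_at S p n (A 4) (B 4)" using AB by (auto simp: four_sections_def)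
  have b: "B 1 \<times> B 2 \<noteq> 0" "B 1 \<times> B 3 \<noteq> 0" "B 2 \<times> B 3 \<noteq> 0" "B 1 \<times> B 4 \<noteq> 0" "B 2 \<times> B 4 \<noteq> 0"
    using AB by (auto simp: four_sections_def)
  obtain C where C: "C \<noteq> 0" "\<forall>x \<in> ell p (A 1) (B 1). quad C x = 0" "\<forall>x \<in> ell p (A 2) (B 2). quad C x = 0"
    "\<forall>x \<in> ell p (A 3) (B 3). quad C x = 0"
    by (rule quad_through_three_sections[OF sup n(1) s(1-3) b(1-3)])
  have contact: "quad_deriv C p b = 0 \<and> polar C b b = quad_deriv C p a" if F: "ell p a b \<subseteq> S" for a b
  proof -
    have "n \<bullet> b = 0" using support_normal_orth_tangent[of p a b n] n(2) F by blast
    then show ?thesis using contact_of_quad[OF n(1) T s(1-3) b(1-3) C(2-4) F] by blast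
  qed
  have sub: "ell p (A 4) (B 4) \<subseteq> S" using s(4) by (auto simp: section_at_def)
  obtain y1 where y1: "y1 \<noteq> p" "ell p (A 1) (B 1) \<inter> ell p (A 4) (B 4) = {p, y1}"
    by (rule sections_meet[OF s(1,4) b(4)])
  obtain y2 where y2: "y2 \<noteq> p" "ell p (A 2) (B 2) \<inter> ell p (A 4) (B 4) = {p, y2}"
    by (rule sections_meet[OF s(2,4) b(5)])
  have q0: "quad C p = 0" using C(2) by simp
  have "\<forall>x \<in> ell p (A 4) (B 4). quad C x = 0"
    by (rule quad_0_on_ell_contact_and_two_crossings[OF sup s(1,2) b(1) sub q0 _ _ C(2,3), of y1 y2])
       (use contact[OF sub] y1 y2 in auto)
  then have "\<forall>x \<in> ell p (A j) (B j). quad C x = 0" if "j \<in> {1..4}" for j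
  proof -
    have "j = 1 \<or> j = 2 \<or> j = 3 \<or> j = 4" using that by auto
    then show ?thesis using C \<open>\<forall>x \<in> ell p (A 4) (B 4). quad C x = 0\<close> by auto
  qed
  with C(1) contact show ?thesis using that by blast
qed

text \<open>
  A plane that crosses the tangent of an ellipse at \<open>p\<close> separates the points with parameters \<open>e\<close> and \<open>-e\<close>, for
  small \<open>e\<close>. Planes close to it still do, and thus meet both arcs between these two points.
\<close>
lemma ell_crossing:
  assumes ab: "a \<times> b \<noteq> 0" and lim: "(N' \<longlongrightarrow> N) F" "(q \<longlongrightarrow> p) F" and Nb: "N \<bullet> b \<noteq> 0" and r: "r > 0"
  shows "eventually (\<lambda>k. \<exists>x y. x \<in> ell p a b \<and> y \<in> ell p a b \<and> N' k \<bullet> (x - q k) = 0 \<and> N' k \<bullet> (y - q k) = 0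
           \<and> dist x p < r \<and> x \<noteq> y \<and> y \<noteq> p) F"
proof -
  define g where "g t = p - (1 - cos t) *\<^sub>R a + sin t *\<^sub>R b" for t
  have gE: "g t \<in> ell p a b" for t
    unfolding g_def
  proof (rule ellI)
    show "(1 - cos t)\<^sup>2 + (sin t)\<^sup>2 = 2 * (1 - cos t)"
      using sin_cos_squared_add[of t] by (simp add: power2_eq_square algebra_simps)
  qed
  have contg: "continuous_on A g" for A unfolding g_def by (intro continuous_intros)
  have g0: "g 0 = p" by (simp add: g_def)
  have gcos: "cos s = cos t" if "g s = g t" for s t
  proof -
    have "(cos s - cos t) *\<^sub>R a + (sin s - sin t) *\<^sub>R b = 0" using that by (simp add: g_def algebra_simps)
    from cross_indep(1)[OF ab this] show ?thesis by simp
  qed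
  define s where "s = N \<bullet> b"
  define h where "h t = s * (N \<bullet> (g t - p))" for t
  have "((\<lambda>t. N \<bullet> (g t - p)) has_field_derivative s) (at 0)"
    unfolding g_def s_def inner_diff_right inner_add_right inner_scaleR_right
    by (auto intro!: derivative_eq_intros)
  then have "(h has_field_derivative (s * s)) (at 0)" unfolding h_def by (rule DERIV_cmult)
  moreover have "s * s > 0" using Nb unfolding s_def by (simp add: zero_less_mult_iff) linarith
  ultimately obtain d1 d2 where d1: "d1 > 0" "\<And>t. 0 < t \<Longrightarrow> t < d1 \<Longrightarrow> h 0 < h (0 + t)"
    and d2: "d2 > 0" "\<And>t. 0 < t \<Longrightarrow> t < d2 \<Longrightarrow> h (0 - t) < h 0"
    using DERIV_pos_inc_right[of h "s * s" 0] DERIV_pos_inc_left[of h "s * s" 0] by blast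
  have h0: "h 0 = 0" by (simp add: h_def g0)
  have "continuous (at 0) g" using contg[of UNIV] by (simp add: continuous_on_eq_continuous_at)
  then obtain d3 where d3: "d3 > 0" "\<And>t. dist t 0 < d3 \<Longrightarrow> dist (g t) (g 0) < r"
    using r unfolding continuous_at_eps_delta by blast
  define e where "e = min (min d1 d2) (min d3 pi) / 2"
  have e: "0 < e" "e < d1" "e < d2" "e < d3" "e < pi" using d1(1) d2(1) d3(1) by (auto simp: e_def min_def)
  have he: "h e > 0" "h (- e) < 0" using d1(2)[of e] d2(2)[of e] e h0 by auto
  \<comment> \<open>The factor \<open>s\<close> normalizes signs, so that \<open>f k\<close> is eventually positive at \<open>e\<close> and negative at \<open>-e\<close>.\<close>
  define f where "f k t = s * (N' k \<bullet> (g t - q k))" for k t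
  have flim: "((\<lambda>k. f k t) \<longlongrightarrow> h t) F" for t
    unfolding f_def h_def by (intro tendsto_intros lim)
  have "eventually (\<lambda>k. f k e > 0) F" "eventually (\<lambda>k. f k (- e) < 0) F"
    using order_tendstoD(1)[OF flim he(1)] order_tendstoD(2)[OF flim he(2)] by auto
  then show ?thesis
  proof eventually_elim
    case (elim k)
    have cont: "continuous_on A (f k)" for A unfolding f_def by (intro continuous_intros contg)
    obtain t1 where t1: "- e \<le> t1" "t1 \<le> e" "f k t1 = 0"
      using IVT'[of "f k" "- e" 0 e] elim e(1) cont by force
    have per: "f k (2 * pi - e) = f k (- e)" by (simp add: f_def g_def sin_diff cos_diff)
    obtain t2 where t2: "e \<le> t2" "t2 \<le> 2 * pi - e" "f k t2 = 0"
      using IVT2'[of "f k" "2 * pi - e" 0 e] elim e per cont by force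
    \<comment> \<open>Comparing cosines tells the points on the short arc from those on the long one.\<close>
    have c2: "cos t2 \<le> cos e"
    proof (cases "t2 \<le> pi")
      case True
      then show ?thesis using t2 e by (intro cos_monotone_0_pi_le) auto
    next
      case False
      have "cos t2 = cos (2 * pi - t2)" by (simp add: cos_diff)
      also have "\<dots> \<le> cos e" using t2 e False by (intro cos_monotone_0_pi_le) auto
      finally show ?thesis .
    qed
    have c0: "cos e < cos 0" using e by (intro cos_monotone_0_pi) auto
    have c1: "cos e < cos t1"
    proof -
      have "t1 \<noteq> e" "t1 \<noteq> - e" using t1(3) elim by auto
      then have "\<bar>t1\<bar> < e" using t1 by auto
      then have "cos e < cos \<bar>t1\<bar>" using e by (intro cos_monotone_0_pi) auto
      then show ?thesis by simp
    qed
    have "g t1 \<noteq> g t2" using gcos[of t1 t2] c1 c2 by auto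
    moreover have "g t2 \<noteq> p" using gcos[of t2 0] g0 c2 c0 by auto
    moreover have "dist (g t1) p < r" using d3(2)[of t1] t1 e g0 by (auto simp: dist_real_def)
    moreover have "N' k \<bullet> (g t1 - q k) = 0" "N' k \<bullet> (g t2 - q k) = 0"
      using t1(3) t2(3) Nb by (auto simp: f_def s_def)
    ultimately show ?case using gE by blast
  qed
qed

text \<open>
  Here \<open>x1\<close>, \<open>x2\<close>, \<open>x3\<close> are the crossings near \<open>p\<close>, and \<open>y1\<close>, \<open>y2\<close> are crossings away from \<open>p\<close>. If the
  ellipse passes through \<open>p\<close>, the near crossings may all be \<open>p\<close>, but then \<open>p\<close> is a zero of order 3;
  otherwise the three near crossings are different. If \<open>y1\<close> and \<open>y2\<close> coincide, they count twice.
\<close>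
lemma quad_0_on_crossing_ell:
  assumes sup: "\<And>x. x \<in> S \<Longrightarrow> \<exists>n. n \<noteq> 0 \<and> (\<forall>w \<in> S. n \<bullet> (w - x) \<le> 0)"
    and s: "section_at S p n a1 b1" "section_at S p n a2 b2" "b1 \<times> b2 \<noteq> 0"
    and Q: "\<forall>x \<in> ell p a1 b1. quad C x = 0" "\<forall>x \<in> ell p a2 b2. quad C x = 0" "\<forall>x \<in> ell p a3 b3. quad C x = 0"
    and contact: "\<And>a b. ell p a b \<subseteq> S \<Longrightarrow> quad_deriv C p b = 0 \<and> polar C b b = quad_deriv C p a"
    and F: "ell q a b \<subseteq> S"
    and x: "x1 \<in> ell p a1 b1 \<inter> ell q a b" "x2 \<in> ell p a2 b2 \<inter> ell q a b" "x3 \<in> ell p a3 b3 \<inter> ell q a b"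
    and y: "y1 \<in> ell p a1 b1 \<inter> ell q a b" "y2 \<in> ell p a2 b2 \<inter> ell q a b" "y1 \<noteq> p" "y2 \<noteq> p"
    and xy: "x1 \<noteq> y1" "x2 \<noteq> y2"
    and near: "x1 \<in> ell p a2 b2 \<Longrightarrow> x1 = p" "x2 \<in> ell p a1 b1 \<Longrightarrow> x2 = p"
      "x3 \<in> ell p a1 b1 \<Longrightarrow> x3 = p" "x3 \<in> ell p a2 b2 \<Longrightarrow> x3 = p"
  shows "\<forall>x \<in> ell q a b. quad C x = 0"
proof (cases "p \<in> ell q a b")
  case True
  obtain u v where p: "p = q - u *\<^sub>R a + v *\<^sub>R b" "u\<^sup>2 + v\<^sup>2 = 2 * u" by (rule ell_pointE[OF True])
  obtain a' b' where F': "ell q a b = ell p a' b'" using ell_rebase(1)[OF p(2,1) refl refl] by blast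
  have c: "quad_deriv C p b' = 0" "polar C b' b' = quad_deriv C p a'" using contact[of a' b'] F F' by auto
  have "quad C p = 0" using Q(1) by simp
  from quad_0_on_ell_contact_and_two_crossings[OF sup s F[unfolded F'] this c Q(1,2) y[unfolded F']]
  show ?thesis unfolding F' .
next
  case False
  \<comment> \<open>Off \<open>p\<close>, a near crossing lies on one of the sections only.\<close>
  have xp: "x1 \<noteq> p" "x2 \<noteq> p" "x3 \<noteq> p" using False x by auto
  have d: "x1 \<noteq> x2" "x1 \<noteq> x3" "x2 \<noteq> x3" using near xp x by auto
  have d': "x1 \<noteq> y2" "x2 \<noteq> y1" "x3 \<noteq> y1" "x3 \<noteq> y2" using near xp y by auto
  have y1F: "y1 \<in> ell q a b" using y by blast
  obtain u v where p: "y1 = q - u *\<^sub>R a + v *\<^sub>R b" "u\<^sup>2 + v\<^sup>2 = 2 * u" by (rule ell_pointE[OF y1F])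
  obtain a' b' where F': "ell q a b = ell y1 a' b'" using ell_rebase(1)[OF p(2,1) refl refl] by blast
  have q0: "quad C y1 = 0" using Q(1) y by blast
  show ?thesis
  proof (cases "y1 = y2")
    case True
    have D: "quad_deriv C y1 b' = 0"
      using quad_deriv_at_common_point[OF sup s _ _ y(3) Q(1,2) F[unfolded F']] y True by blast
    show ?thesis unfolding F'
      by (rule quad_0_on_ell_double[OF q0 D, of "{x1,x2,x3}"]) (use x d d' xy F' Q in auto)
  next
    case False
    show ?thesis unfolding F'
      by (rule quad_0_on_ell_five_zeros[OF q0, of "{y2,x1,x2,x3}"]) (use x y d d' xy F' Q False in auto)
  qed
qed

text \<open>
  The norm of \<open>a \<times> b\<close> is the area of the ellipse divided by \<open>\<pi>\<close>. The bound excludes degenerate limits.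
\<close>
definition large_section :: "(real^3) set \<Rightarrow> real \<Rightarrow> real^3 \<Rightarrow> real^3 \<Rightarrow> real^3 \<Rightarrow> bool" where
  "large_section S \<delta> q a b \<longleftrightarrow> \<delta> \<le> norm (a \<times> b) \<and> ell q a b = {x \<in> S. (a \<times> b) \<bullet> (x - q) = 0}"

lemma ell_axes_bounded:
  assumes "\<And>x. x \<in> S \<Longrightarrow> norm x \<le> R" "ell q a b \<subseteq> S"
  shows "norm a \<le> R" "norm b \<le> 3 * R"
proof -
  have q: "norm q \<le> R" using assms base_in_ell by blast
  \<comment> \<open>The point opposite to \<open>q\<close>, and below an end of the diameter parallel to the tangent.\<close>
  have "norm (q - 2 *\<^sub>R a) \<le> R" using ellI[of 2 0 q a b] assms by auto
  moreover have "norm (2 *\<^sub>R a) \<le> norm q + norm (q - 2 *\<^sub>R a)"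
    using norm_triangle_ineq4[of q "q - 2 *\<^sub>R a"] by simp
  ultimately show a: "norm a \<le> R" using q by simp
  have "norm (q - a + b) \<le> R" using ellI[of 1 1 q a b] assms by auto
  moreover have "norm b \<le> norm (q - a + b) + norm (q - a)"
    using norm_triangle_ineq4[of "q - a + b" "q - a"] by simp
  moreover have "norm (q - a) \<le> norm q + norm a" by (rule norm_triangle_ineq4)
  ultimately show "norm b \<le> 3 * R" using q a by linarith
qed

lemma large_sections_subconverge:
  assumes S: "closed S" "bounded S" and q: "q \<longlonglongrightarrow> p" and ab: "\<And>k. large_section S \<delta> (q k) (a k) (b k)"
  obtains \<sigma> a' b' where "strict_mono (\<sigma> :: nat \<Rightarrow> nat)"
    "(\<lambda>k. a (\<sigma> k) \<times> b (\<sigma> k)) \<longlonglongrightarrow> a' \<times> b'" "\<delta> \<le> norm (a' \<times> b')" "ell p a' b' \<subseteq> S"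
proof -
  obtain R where R: "\<And>x. x \<in> S \<Longrightarrow> norm x \<le> R" using S(2) bounded_iff by blast
  have sub: "ell (q k) (a k) (b k) \<subseteq> S" for k using ab[of k] by (auto simp: large_section_def)
  have "(a k, b k) \<in> Sigma (cball 0 R) (\<lambda>_. cball 0 (3 * R))" for k
    using ell_axes_bounded[OF R sub] by auto
  then have "range (\<lambda>k. (a k, b k)) \<subseteq> Sigma (cball 0 R) (\<lambda>_. cball 0 (3 * R))" by blast
  moreover have "bounded (Sigma (cball 0 R) (\<lambda>_. cball 0 (3 * R)) :: ((real^3) \<times> (real^3)) set)"
    by (intro bounded_Times bounded_cball)
  ultimately have "bounded (range (\<lambda>k. (a k, b k)))" by (rule bounded_subset[rotated])
  then obtain l \<sigma> where \<sigma>: "strict_mono (\<sigma> :: nat \<Rightarrow> nat)" "((\<lambda>k. (a k, b k)) \<circ> \<sigma>) \<longlonglongrightarrow> l"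
    using bounded_imp_convergent_subsequence by blast
  obtain a' b' where l: "l = (a', b')" by (cases l)
  have A: "(\<lambda>k. a (\<sigma> k)) \<longlonglongrightarrow> a'" using tendsto_fst[OF \<sigma>(2)] by (simp add: l o_def)
  have B: "(\<lambda>k. b (\<sigma> k)) \<longlonglongrightarrow> b'" using tendsto_snd[OF \<sigma>(2)] by (simp add: l o_def)
  have bb: "bounded_bilinear (\<times>)" using bilinear_cross by (simp add: bilinear_conv_bounded_bilinear)
  have N: "(\<lambda>k. a (\<sigma> k) \<times> b (\<sigma> k)) \<longlonglongrightarrow> a' \<times> b'"
    by (rule bounded_bilinear.tendsto[OF bb A B])
  have d: "\<delta> \<le> norm (a' \<times> b')"
    by (rule tendsto_lowerbound[OF tendsto_norm[OF N]]) (use ab in \<open>auto simp: large_section_def\<close>)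
  have Q: "(\<lambda>k. q (\<sigma> k)) \<longlonglongrightarrow> p" using LIMSEQ_subseq_LIMSEQ[OF q \<sigma>(1)] by (simp add: o_def)
  have "ell p a' b' \<subseteq> S"
  proof
    fix x assume "x \<in> ell p a' b'"
    then obtain u y where x: "x = p - u *\<^sub>R a' + y *\<^sub>R b'" "u\<^sup>2 + y\<^sup>2 = 2 * u" unfolding ell_def by blast
    have lim: "(\<lambda>k. q (\<sigma> k) - u *\<^sub>R a (\<sigma> k) + y *\<^sub>R b (\<sigma> k)) \<longlonglongrightarrow> x"
      unfolding x(1) by (intro tendsto_intros A B Q)
    have "\<forall>k. q (\<sigma> k) - u *\<^sub>R a (\<sigma> k) + y *\<^sub>R b (\<sigma> k) \<in> S" using ellI[OF x(2)] sub by blast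
    then show "x \<in> S" by (intro Lim_in_closed_set[OF S(1) _ sequentially_bot lim] always_eventually)
  qed
  with \<sigma>(1) N d show ?thesis using that by blast
qed

text \<open>
  Directions of sections that lie in the plane of the ellipse are parallel to its tangent \<open>b\<close>; as no two sections are tangent, there is
  at most one.
\<close>
lemma large_section_crosses_three:
  assumes n: "n \<noteq> 0" and AB: "four_sections S p n A B"
    and ab: "a \<times> b \<noteq> 0" "n \<bullet> b = 0" "n \<bullet> a \<noteq> 0"
  obtains i j k where "i \<in> {1..4}" "j \<in> {1..4}" "k \<in> {1..4}" "i \<noteq> j" "i \<noteq> k" "j \<noteq> k"
    "(a \<times> b) \<bullet> B i \<noteq> 0" "(a \<times> b) \<bullet> B j \<noteq> 0" "(a \<times> b) \<bullet> B k \<noteq> 0"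
proof -
  have par: "\<exists>s. B i = s *\<^sub>R b" if i: "i \<in> {1..4}" "(a \<times> b) \<bullet> B i = 0" for i
  proof -
    obtain x y where xy: "B i = x *\<^sub>R a + y *\<^sub>R b" by (rule cross_span[OF ab(1) i(2)])
    have "n \<bullet> B i = 0" using AB i(1) by (auto simp: four_sections_def section_at_def)
    then have "x * (n \<bullet> a) = 0" using ab(2) by (simp add: xy inner_add_right)
    then show ?thesis using ab(3) xy by auto
  qed
  have one: "(a \<times> b) \<bullet> B i \<noteq> 0 \<or> (a \<times> b) \<bullet> B j \<noteq> 0" if ij: "i \<in> {1..4}" "j \<in> {1..4}" "i \<noteq> j" for i j
  proof (rule ccontr)
    assume c: "\<not> ?thesis"
    obtain s where "B i = s *\<^sub>R b" using par ij c by blast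
    moreover obtain t where "B j = t *\<^sub>R b" using par ij c by blast
    ultimately have "B i \<times> B j = 0" by (simp add: cross_mult_left cross_mult_right)
    then show False using AB ij by (auto simp: four_sections_def)
  qed
  consider "(a \<times> b) \<bullet> B 1 = 0" | "(a \<times> b) \<bullet> B 2 = 0" | "(a \<times> b) \<bullet> B 3 = 0"
    | "(a \<times> b) \<bullet> B 1 \<noteq> 0" "(a \<times> b) \<bullet> B 2 \<noteq> 0" "(a \<times> b) \<bullet> B 3 \<noteq> 0" by blast
  then show ?thesis
  proof cases
    case 1 then show ?thesis using that[of 2 3 4] one[of 1 2] one[of 1 3] one[of 1 4] by simp
  next
    case 2 then show ?thesis using that[of 1 3 4] one[of 2 1] one[of 2 3] one[of 2 4] by simp
  next
    case 3 then show ?thesis using that[of 1 2 4] one[of 3 1] one[of 3 2] one[of 3 4] by simp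
  next
    case 4 then show ?thesis using that[of 1 2 3] by simp
  qed
qed

text \<open>
  Argue by contradiction with a sequence of boundary points off the quadric that tends to \<open>p\<close>, and pass to a limit of large
  sections through its members.
\<close>
lemma quad_0_near:
  assumes K: "convex_body K" and p: "p \<in> frontier K" and \<delta>: "\<delta> > 0"
    and n: "n \<noteq> 0" "\<And>w. w \<in> K \<Longrightarrow> n \<bullet> (w - p) \<le> 0"
    and T: "osculates (frontier K) p n T" and AB: "four_sections (frontier K) p n A B"
    and Q: "\<And>j. j \<in> {1..4} \<Longrightarrow> \<forall>x \<in> ell p (A j) (B j). quad C x = 0"
    and contact: "\<And>a b. ell p a b \<subseteq> frontier K \<Longrightarrow> quad_deriv C p b = 0 \<and> polar C b b = quad_deriv C p a"
    and large: "\<And>q. q \<in> frontier K \<Longrightarrow> \<exists>a b. large_section (frontier K) \<delta> q a b"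
  shows "\<exists>r>0. \<forall>x \<in> frontier K. dist x p < r \<longrightarrow> quad C x = 0"
proof (rule ccontr)
  assume contra: "\<not> ?thesis"
  define S where "S = frontier K"
  have cK: "closed K" "convex K" "bounded K"
    using K by (auto simp: convex_body_def compact_imp_closed compact_imp_bounded)
  have SK: "S \<subseteq> K" using frontier_subset_closed[OF cK(1)] by (simp add: S_def)
  have S: "closed S" "bounded S" "S \<subseteq> K"
    using SK bounded_subset[OF cK(3) SK] by (auto simp: S_def)
  have sup: "\<exists>n. n \<noteq> 0 \<and> (\<forall>w \<in> S. n \<bullet> (w - x) \<le> 0)" if x: "x \<in> S" for x
  proof -
    obtain m where "m \<noteq> 0" "\<And>w. w \<in> K \<Longrightarrow> m \<bullet> (w - x) \<le> 0"
      using support_exists[OF K x[unfolded S_def]] by blast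
    then show ?thesis using S(3) by blast
  qed
  have "\<exists>x. x \<in> S \<and> dist x p < 1 / real (Suc k) \<and> quad C x \<noteq> 0" for k
    using contra unfolding S_def by (metis of_nat_0_less_iff zero_less_Suc zero_less_divide_1_iff)
  then obtain q where q: "\<And>k. q k \<in> S" "\<And>k. dist (q k) p < 1 / real (Suc k)" "\<And>k. quad C (q k) \<noteq> 0" by metis
  have "(\<lambda>k. dist (q k) p) \<longlonglongrightarrow> 0"
  proof (rule tendsto_sandwich[OF _ _ tendsto_const LIMSEQ_inverse_real_of_nat])
    have "dist (q k) p \<le> inverse (real (Suc k))" for k
      using q(2)[of k] by (simp only: inverse_eq_divide)
    then show "eventually (\<lambda>k. dist (q k) p \<le> inverse (real (Suc k))) sequentially" by simp
  qed simp
  then have qp: "q \<longlonglongrightarrow> p" by (rule tendsto_dist_iff[THEN iffD2])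
  have "\<exists>a b. large_section S \<delta> (q k) a b" for k using large q(1) S_def by blast
  then obtain a b where ab: "\<And>k. large_section S \<delta> (q k) (a k) (b k)" by metis
  obtain \<sigma> a' b' where \<sigma>: "strict_mono \<sigma>" and lim: "(\<lambda>k. a (\<sigma> k) \<times> b (\<sigma> k)) \<longlonglongrightarrow> a' \<times> b'"
    and d: "\<delta> \<le> norm (a' \<times> b')" and sub: "ell p a' b' \<subseteq> S"
    by (rule large_sections_subconverge[OF S(1,2) qp ab])
  have ab0: "a' \<times> b' \<noteq> 0" using d \<delta> by auto
  have nb: "n \<bullet> b' = 0" using support_normal_orth_tangent[of p a' b' n] n(2) sub S(3) by blast
  have sec: "section_at S p n (A j) (B j)" if "j \<in> {1..4}" for j using AB that by (auto simp: four_sections_def S_def)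
  have s1: "section_at (frontier K) p n (A 1) (B 1)" using sec[of 1] by (simp add: S_def)
  have subK: "ell p a' b' \<subseteq> K" using sub S(3) by blast
  have na: "n \<bullet> a' \<noteq> 0" by (rule no_ellipse_in_support_plane[OF cK(2) n T s1 ab0 subK nb])
  obtain i j k where ijk: "i \<in> {1..4}" "j \<in> {1..4}" "k \<in> {1..4}" "i \<noteq> j" "i \<noteq> k" "j \<noteq> k"
    and N: "(a' \<times> b') \<bullet> B i \<noteq> 0" "(a' \<times> b') \<bullet> B j \<noteq> 0" "(a' \<times> b') \<bullet> B k \<noteq> 0"
    by (rule large_section_crosses_three[OF n(1) AB ab0 nb na])
  have BB: "B i \<times> B j \<noteq> 0" "B i \<times> B k \<noteq> 0" "B j \<times> B k \<noteq> 0" using AB ijk by (auto simp: four_sections_def)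
  obtain qij where qij: "qij \<noteq> p" "ell p (A i) (B i) \<inter> ell p (A j) (B j) = {p, qij}"
    by (rule sections_meet[OF sec[OF ijk(1)] sec[OF ijk(2)] BB(1)])
  obtain qik where qik: "qik \<noteq> p" "ell p (A i) (B i) \<inter> ell p (A k) (B k) = {p, qik}"
    by (rule sections_meet[OF sec[OF ijk(1)] sec[OF ijk(3)] BB(2)])
  obtain qjk where qjk: "qjk \<noteq> p" "ell p (A j) (B j) \<inter> ell p (A k) (B k) = {p, qjk}"
    by (rule sections_meet[OF sec[OF ijk(2)] sec[OF ijk(3)] BB(3)])
  \<comment> \<open>Points closer to \<open>p\<close> than \<open>r\<close> and different from \<open>p\<close> lie on at most one of the three sections.\<close>
  define r where "r = Min {dist qij p, dist qik p, dist qjk p}"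
  have r: "r > 0" "r \<le> dist qij p" "r \<le> dist qik p" "r \<le> dist qjk p"
    using qij(1) qik(1) qjk(1) by (auto simp: r_def)
  have qlim: "(\<lambda>k. q (\<sigma> k)) \<longlonglongrightarrow> p" using LIMSEQ_subseq_LIMSEQ[OF qp \<sigma>] by (simp add: o_def)
  have AB0: "A i \<times> B i \<noteq> 0" "A j \<times> B j \<noteq> 0" "A k \<times> B k \<noteq> 0"
    using sec ijk by (auto simp: section_at_def)
  have "eventually (\<lambda>m. False) sequentially"
    using ell_crossing[OF AB0(1) lim qlim N(1) r(1)] ell_crossing[OF AB0(2) lim qlim N(2) r(1)]
      ell_crossing[OF AB0(3) lim qlim N(3) r(1)]
  proof eventually_elim
    case (elim m)
    let ?F = "ell (q (\<sigma> m)) (a (\<sigma> m)) (b (\<sigma> m))"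
    have F: "?F = {x \<in> S. (a (\<sigma> m) \<times> b (\<sigma> m)) \<bullet> (x - q (\<sigma> m)) = 0}"
      using ab[of "\<sigma> m"] by (simp add: large_section_def)
    then have FS: "?F \<subseteq> S" by blast
    have inF: "x \<in> ell p (A l) (B l) \<inter> ?F"
      if "l \<in> {1..4}" "x \<in> ell p (A l) (B l)" "(a (\<sigma> m) \<times> b (\<sigma> m)) \<bullet> (x - q (\<sigma> m)) = 0" for x l
      using sec[OF that(1)] that F by (auto simp: section_at_def)
    obtain x1 y1 where 1: "x1 \<in> ell p (A i) (B i) \<inter> ?F" "y1 \<in> ell p (A i) (B i) \<inter> ?F"
      "dist x1 p < r" "x1 \<noteq> y1" "y1 \<noteq> p" using elim(1) inF[OF ijk(1)] by blast
    obtain x2 y2 where 2: "x2 \<in> ell p (A j) (B j) \<inter> ?F" "y2 \<in> ell p (A j) (B j) \<inter> ?F"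
      "dist x2 p < r" "x2 \<noteq> y2" "y2 \<noteq> p" using elim(2) inF[OF ijk(2)] by blast
    obtain x3 where 3: "x3 \<in> ell p (A k) (B k) \<inter> ?F" "dist x3 p < r" using elim(3) inF[OF ijk(3)] by blast
    have near: "x1 \<in> ell p (A j) (B j) \<Longrightarrow> x1 = p" "x2 \<in> ell p (A i) (B i) \<Longrightarrow> x2 = p"
      "x3 \<in> ell p (A i) (B i) \<Longrightarrow> x3 = p" "x3 \<in> ell p (A j) (B j) \<Longrightarrow> x3 = p"
      using 1 2 3 qij(2) qik(2) qjk(2) r by force+
    have "\<forall>x \<in> ?F. quad C x = 0"
      by (rule quad_0_on_crossing_ell[OF sup sec[OF ijk(1)] sec[OF ijk(2)] BB(1)
            Q[OF ijk(1)] Q[OF ijk(2)] Q[OF ijk(3)] contact[folded S_def] FS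
            1(1) 2(1) 3(1) 1(2) 2(2) 1(5) 2(5) 1(4) 2(4) near])
    then show False using q(3)[of "\<sigma> m"] by simp
  qed
  then show False by simp
qed

section \<open>Ellipses, their tangent lines and their areas\<close>

lemma ellipse_eq_ell:
  assumes "ellipse E" "z \<in> E"
  obtains a b where "a \<times> b \<noteq> 0" "E = ell z a b"
proof -
  obtain c and L :: "real^2 \<Rightarrow> real^3" where L: "linear L" "inj L" and E: "E = (\<lambda>x. c + L x) ` sphere 0 1"
    using assms(1) unfolding ellipse_def by blast
  obtain v where v: "norm v = 1" "z = c + L v" using assms(2) E by auto
  define v' :: "real^2" where "v' = vector [- v$2, v$1]"
  have vv: "(v$1)\<^sup>2 + (v$2)\<^sup>2 = 1"
    using v(1) by (simp add: norm_eq_1 inner_vec_def sum_2 power2_eq_square)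
  define a b where "a = L v" and "b = L v'"
  have comb: "L (s *\<^sub>R v + t *\<^sub>R v') = s *\<^sub>R a + t *\<^sub>R b" for s t
    by (simp add: a_def b_def linear_add[OF L(1)] linear_scale[OF L(1)])
  have nv: "(norm (s *\<^sub>R v + t *\<^sub>R v'))\<^sup>2 = s\<^sup>2 + t\<^sup>2" for s t
  proof -
    have "(norm (s *\<^sub>R v + t *\<^sub>R v'))\<^sup>2 = (s\<^sup>2 + t\<^sup>2) * ((v$1)\<^sup>2 + (v$2)\<^sup>2)"
      unfolding power2_norm_eq_inner by (simp add: v'_def inner_vec_def sum_2 power2_eq_square algebra_simps)
    then show ?thesis by (simp add: vv)
  qed
  have "a \<times> b \<noteq> 0"
  proof
    assume c: "a \<times> b = 0"
    have "a \<noteq> 0"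
      using v(1) L linear_injective_0[OF L(1)] by (metis a_def norm_zero zero_neq_one)
    then obtain s where s: "b = s *\<^sub>R a" using cross_eq_0_imp_scale[OF c] by blast
    have "L (s *\<^sub>R v + (- 1) *\<^sub>R v') = 0" unfolding comb by (simp add: s)
    then have "s *\<^sub>R v + (- 1) *\<^sub>R v' = 0" using linear_injective_0[OF L(1)] L(2) by blast
    then have "s\<^sup>2 + (-1)\<^sup>2 = (0::real)" using nv[of s "-1"] by simp
    then show False by (simp add: add_nonneg_eq_0_iff)
  qed
  moreover have "E = ell z a b"
  proof
    show "E \<subseteq> ell z a b"
    proof
      fix x assume "x \<in> E"
      then obtain w where w: "norm w = 1" "x = c + L w" using E by auto
      define s t where "s = w \<bullet> v" and "t = w \<bullet> v'"
      have "s *\<^sub>R v + t *\<^sub>R v' = ((v$1)\<^sup>2 + (v$2)\<^sup>2) *\<^sub>R w"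
        by (simp add: s_def t_def v'_def vec_eq_iff forall_2 inner_vec_def sum_2 power2_eq_square algebra_simps)
      then have ws: "w = s *\<^sub>R v + t *\<^sub>R v'" by (simp add: vv)
      then have "s\<^sup>2 + t\<^sup>2 = 1" using nv[of s t] w(1) by simp
      then have 1: "(1-s)\<^sup>2 + t\<^sup>2 = 2 * (1-s)" by (simp add: power2_eq_square algebra_simps)
      have "x = z - (1-s) *\<^sub>R a + t *\<^sub>R b" unfolding w(2) ws comb v(2) by (simp add: a_def algebra_simps)
      then show "x \<in> ell z a b" using ellI[OF 1] by simp
    qed
    show "ell z a b \<subseteq> E"
    proof
      fix x assume "x \<in> ell z a b"
      then obtain u y where x: "x = z - u *\<^sub>R a + y *\<^sub>R b" and uy: "u\<^sup>2 + y\<^sup>2 = 2 * u"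
        unfolding ell_def by blast
      have "(norm ((1-u) *\<^sub>R v + y *\<^sub>R v'))\<^sup>2 = 1"
        unfolding nv using uy by (simp add: power2_eq_square algebra_simps)
      then have "norm ((1-u) *\<^sub>R v + y *\<^sub>R v') = 1"
        by (smt (verit) norm_ge_zero power2_eq_1_iff)
      moreover have "x = c + L ((1-u) *\<^sub>R v + y *\<^sub>R v')"
        unfolding comb x v(2) by (simp add: a_def algebra_simps)
      ultimately show "x \<in> E" using E by auto
    qed
  qed
  ultimately show ?thesis using that by blast
qed

text \<open>
  A motion within the ellipse that is at \<open>z\<close> at time 0 has \<open>u \<ge> 0\<close> with equality at \<open>z\<close>, so the
  derivative of \<open>u\<close> vanishes there and the velocity has no component along \<open>a\<close>.
\<close>
lemma tangent_line_ell:
  assumes ab: "a \<times> b \<noteq> 0"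
  shows "tangent_line (ell z a b) z = {z + s *\<^sub>R b | s. True}"
proof
  define N where "N = a \<times> b"
  show "tangent_line (ell z a b) z \<subseteq> {z + s *\<^sub>R b | s. True}"
  proof
    fix x assume "x \<in> tangent_line (ell z a b) z"
    then obtain v and \<gamma> :: "real \<Rightarrow> real^3" where x: "x = z + v" and g: "\<And>t. \<gamma> t \<in> ell z a b" "\<gamma> 0 = z"
      and d: "(\<gamma> has_vector_derivative v) (at 0)" unfolding tangent_line_def by blast
    have dl: "((\<lambda>t. M \<bullet> (\<gamma> t - z)) has_field_derivative (M \<bullet> v)) (at 0)" for M
    proof -
      have "((\<lambda>t. M \<bullet> (\<gamma> t - z)) has_derivative (\<lambda>h. M \<bullet> (h *\<^sub>R v - 0))) (at 0)"
        using d unfolding has_vector_derivative_def by (intro derivative_intros)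
      then show ?thesis by (simp add: has_field_derivative_def mult_commute_abs)
    qed
    have "N \<bullet> (\<gamma> t - z) = 0" for t
      using g(1)[of t] by (auto simp: ell_def N_def inner_diff_right inner_add_right dot_cross_self)
    then have "((\<lambda>t. 0) has_field_derivative (N \<bullet> v)) (at 0)" using dl[of N] by simp
    then have Nv: "N \<bullet> v = 0" using DERIV_unique[OF _ DERIV_const] by blast
    obtain s t where v: "v = s *\<^sub>R a + t *\<^sub>R b" by (rule cross_span[OF ab Nv[unfolded N_def]])
    \<comment> \<open>The functional \<open>M\<close> vanishes on \<open>b\<close> and is positive on \<open>a\<close>, so it reads off \<open>u\<close>.\<close>
    define M where "M = b \<times> N"
    have Ma: "M \<bullet> a = N \<bullet> N" and Mb: "M \<bullet> b = 0"
      unfolding M_def N_def dot_cross Lagrange by (simp_all add: inner_diff_left inner_diff_right inner_commute mult.commute)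
    have "0 \<le> M \<bullet> (- (\<gamma> t - z))" for t
    proof -
      obtain u y where uy: "\<gamma> t = z - u *\<^sub>R a + y *\<^sub>R b" "u\<^sup>2 + y\<^sup>2 = 2 * u" using g(1)[of t] unfolding ell_def by blast
      have "0 \<le> 2 * u" using uy(2) by (metis sum_power2_ge_zero)
      moreover have "M \<bullet> (- (\<gamma> t - z)) = u * (N \<bullet> N)" using uy(1) Ma Mb by (simp add: inner_diff_right inner_add_right)
      ultimately show ?thesis by simp
    qed
    then have "\<forall>y. \<bar>0 - y\<bar> < 1 \<longrightarrow> (- M) \<bullet> (\<gamma> 0 - z) \<le> (- M) \<bullet> (\<gamma> y - z)"
      using g(2) by (simp add: inner_diff_right)
    then have "(- M) \<bullet> v = 0" using DERIV_local_min[OF dl[of "- M"]] zero_less_one by blast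
    then have "s * (N \<bullet> N) = 0" using Ma Mb by (simp add: v inner_add_right)
    then have "s = 0" using ab by (simp add: N_def)
    then show "x \<in> {z + s *\<^sub>R b | s. True}" using x v by auto
  qed
  show "{z + s *\<^sub>R b | s. True} \<subseteq> tangent_line (ell z a b) z"
  proof
    fix x assume "x \<in> {z + s *\<^sub>R b | s. True}"
    then obtain s where x: "x = z + s *\<^sub>R b" by blast
    define \<gamma> where "\<gamma> t = z - (1 - cos (s * t)) *\<^sub>R a + sin (s * t) *\<^sub>R b" for t
    have "\<gamma> t \<in> ell z a b" for t
      unfolding \<gamma>_def
    proof (rule ellI)
      show "(1 - cos (s * t))\<^sup>2 + (sin (s * t))\<^sup>2 = 2 * (1 - cos (s * t))"
        using sin_cos_squared_add[of "s * t"] by (simp add: power2_eq_square algebra_simps)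
    qed
    moreover have "\<gamma> 0 = z" by (simp add: \<gamma>_def)
    moreover have "(\<gamma> has_vector_derivative s *\<^sub>R b) (at 0)"
      unfolding \<gamma>_def by (auto intro!: derivative_eq_intros)
    ultimately show "x \<in> tangent_line (ell z a b) z" unfolding tangent_line_def x by blast
  qed
qed

lemma not_tangent_imp_cross:
  assumes "a1 \<times> b1 \<noteq> 0" "a2 \<times> b2 \<noteq> 0" "\<not> tangent_at z (ell z a1 b1) (ell z a2 b2)"
  shows "b1 \<times> b2 \<noteq> 0"
proof
  assume c: "b1 \<times> b2 = 0"
  have b: "b1 \<noteq> 0" "b2 \<noteq> 0" using assms by auto
  obtain s where s: "b2 = s *\<^sub>R b1" by (rule cross_eq_0_imp_scale[OF c b(1)])
  then have s0: "s \<noteq> 0" using b by auto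
  have "{z + t *\<^sub>R b1 | t. True} = {z + t *\<^sub>R b2 | t. True}"
  proof (intro set_eqI iffI)
    fix x assume "x \<in> {z + t *\<^sub>R b1 | t. True}"
    then obtain t where "x = z + t *\<^sub>R b1" by blast
    then have "x = z + (t / s) *\<^sub>R b2" using s s0 by simp
    then show "x \<in> {z + t *\<^sub>R b2 | t. True}" by blast
  next
    fix x assume "x \<in> {z + t *\<^sub>R b2 | t. True}"
    then obtain t where "x = z + t *\<^sub>R b2" by blast
    then have "x = z + (t * s) *\<^sub>R b1" using s by simp
    then show "x \<in> {z + t *\<^sub>R b1 | t. True}" by blast
  qed
  then show False using assms unfolding tangent_at_def by (simp add: tangent_line_ell)
qed

text \<open>
  The plane of a section is determined by the ellipse in it, so it can be written through \<open>a \<times> b\<close>.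
\<close>
lemma plane_of_ellipse:
  assumes H: "plane H" and ab: "a \<times> b \<noteq> 0" and sub: "ell z a b \<subseteq> H"
  shows "H = {x. (a \<times> b) \<bullet> (x - z) = 0}"
proof -
  have "affine H" "aff_dim H = DIM(real^3) - 1" using H by (auto simp: plane_def)
  then obtain m c where m: "m \<noteq> 0" "H = {x. m \<bullet> x = c}"
    using aff_dim_eq_hyperplane[of H] by (auto simp: affine_hull_eq[THEN iffD2])
  have "z \<in> H" using sub base_in_ell by blast
  then have z: "m \<bullet> (x - z) = 0" if "x \<in> H" for x
    using that m(2) by (simp add: inner_diff_right)
  have mb: "m \<bullet> b = 0" using support_normal_orth_tangent[of z a b m] z sub by (metis order_refl subsetD)
  have "z - 2 *\<^sub>R a + 0 *\<^sub>R b \<in> H" using ellI[of 2 0 z a b] sub by auto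
  from z[OF this] have ma: "m \<bullet> a = 0" by simp
  have "m \<times> (a \<times> b) = 0" by (simp add: Lagrange ma mb)
  then obtain s where s: "a \<times> b = s *\<^sub>R m" using cross_eq_0_imp_scale m(1) by blast
  then have "s \<noteq> 0" using ab by auto
  moreover have "c = m \<bullet> z" using \<open>z \<in> H\<close> m(2) by simp
  ultimately show ?thesis using m(2) s by (auto simp: inner_diff_right)
qed

lemma linear_of_inner_preserving:
  fixes G :: "'a::real_inner \<Rightarrow> 'b::real_inner"
  assumes "\<And>x y. G x \<bullet> G y = x \<bullet> y"
  shows "linear G"
proof (rule linearI)
  fix x y
  have "(G (x + y) - G x - G y) \<bullet> (G (x + y) - G x - G y) = 0"
    by (simp add: inner_diff_left inner_diff_right assms inner_add_left inner_add_right inner_commute)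
  then have "G (x + y) - G x - G y = 0" by (simp only: inner_eq_zero_iff)
  then show "G (x + y) = G x + G y" by (simp add: algebra_simps)
next
  fix r :: real and x
  have "(G (r *\<^sub>R x) - r *\<^sub>R G x) \<bullet> (G (r *\<^sub>R x) - r *\<^sub>R G x) = 0"
    by (simp add: inner_diff_left inner_diff_right assms)
  then have "G (r *\<^sub>R x) - r *\<^sub>R G x = 0" by (simp only: inner_eq_zero_iff)
  then show "G (r *\<^sub>R x) = r *\<^sub>R G x" by simp
qed

lemma isometry_onto_plane_exists:
  fixes N z :: "real^3"
  assumes "N \<noteq> 0"
  shows "\<exists>f :: real^2 \<Rightarrow> real^3. (\<forall>x y. dist (f x) (f y) = dist x y) \<and> {x. N \<bullet> (x - z) = 0} \<subseteq> range f"
proof -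
  have d: "dim (UNIV :: (real^2) set) = dim {x. N \<bullet> x = 0}" using dim_hyperplane[OF assms] by simp
  have "\<exists>g :: real^2 \<Rightarrow> real^3. linear g \<and> g ` UNIV = {x. N \<bullet> x = 0} \<and> (\<forall>x \<in> UNIV. norm (g x) = norm x)"
    by (rule isometry_subspaces[OF subspace_UNIV subspace_hyperplane d]) blast
  then obtain g :: "real^2 \<Rightarrow> real^3" where g: "linear g" "g ` UNIV = {x. N \<bullet> x = 0}"
    "\<And>x. norm (g x) = norm x" by blast
  have "dist (z + g x) (z + g y) = dist x y" for x y
    using g(3)[of "x - y"] by (simp add: dist_norm linear_diff[OF g(1)])
  moreover have "{x. N \<bullet> (x - z) = 0} \<subseteq> range (\<lambda>x. z + g x)"
  proof
    fix x assume "x \<in> {x. N \<bullet> (x - z) = 0}"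
    then have "x - z \<in> range g" using g(2) by simp
    then obtain y where "x - z = g y" by blast
    then have "x = z + g y" by (simp add: algebra_simps)
    then show "x \<in> range (\<lambda>x. z + g x)" by blast
  qed
  ultimately show ?thesis by (intro exI[of _ "\<lambda>x. z + g x"]) simp
qed

text \<open>
  In Cartesian coordinates \<open>f\<close> of its plane, the ellipse bounds an affine image of the unit disc by a linear map
  \<open>L\<close>. Isometries preserve inner products, so \<open>det L\<close> has absolute value \<open>norm (a \<times> b)\<close>. Only an
  upper bound on the area is needed, so it is enough that the convex image of the disc contains the inside.
\<close>
lemma enclosed_area_ell_le:
  assumes ab: "a \<times> b \<noteq> 0"
  shows "enclosed_area (ell z a b) \<le> measure lebesgue (cball (0::real^2) 1) * norm (a \<times> b)"
proof -
  define E where "E = ell z a b"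
  define f where "f = (SOME f :: real^2 \<Rightarrow> real^3. (\<forall>x y. dist (f x) (f y) = dist x y) \<and> E \<subseteq> range f)"
  have Esub: "E \<subseteq> {x. (a \<times> b) \<bullet> (x - z) = 0}"
    by (auto simp: E_def ell_def inner_diff_right inner_add_right dot_cross_self)
  have "\<exists>f :: real^2 \<Rightarrow> real^3. (\<forall>x y. dist (f x) (f y) = dist x y) \<and> E \<subseteq> range f"
    using isometry_onto_plane_exists[OF ab, of z] Esub by (meson order_trans)
  then have "(\<forall>x y. dist (f x) (f y) = dist x y) \<and> E \<subseteq> range f"
    unfolding f_def by (rule someI_ex)
  then have f: "\<forall>x y. dist (f x) (f y) = dist x y" "E \<subseteq> range f" by blast+
  have area: "enclosed_area E = measure lebesgue (inside (f -` E))"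
    unfolding enclosed_area_def f_def[symmetric] Let_def ..
  obtain z' where z': "f z' = z" using f(2) base_in_ell[of z a b] E_def by blast
  define G where "G v = f (z' + v) - z" for v
  have Gd: "norm (G v - G w) = norm (v - w)" for v w
    using f(1)[rule_format, of "z' + v" "z' + w"] by (simp add: G_def dist_norm)
  have G0: "G 0 = 0" by (simp add: G_def z')
  have Gn: "norm (G v) = norm v" for v using Gd[of v 0] G0 by simp
  have Gi: "G v \<bullet> G w = v \<bullet> w" for v w
    using Gd[of v w] Gn[of v] Gn[of w] dot_norm_neg[of "G v" "G w"] dot_norm_neg[of v w] by simp
  have lin: "linear G" using Gi by (rule linear_of_inner_preserving)
  have rG: "v \<in> range G" if "z + v \<in> E" for v
  proof -
    obtain x where "z + v = f x" using f(2) \<open>z + v \<in> E\<close> by blast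
    then have "v = G (x - z')" by (simp add: G_def flip: \<open>z + v = f x\<close>)
    then show ?thesis by blast
  qed
  \<comment> \<open>Both semi-diameters are linear combinations of differences of points of the ellipse, so they have preimages under \<open>G\<close>.\<close>
  have "z + - (2 *\<^sub>R a) \<in> E" using ellI[of 2 0 z a b] by (simp add: E_def)
  then obtain a2 where "- (2 *\<^sub>R a) = G a2" using rG by blast
  then have "a = G ((- 1/2) *\<^sub>R a2)" unfolding linear_scale[OF lin] by (simp flip: \<open>- (2 *\<^sub>R a) = G a2\<close>)
  then obtain a' where a': "a = G a'" by blast
  have "z + (b - a) \<in> E" using ellI[of 1 1 z a b] by (simp add: E_def algebra_simps)
  then obtain b2 where "b - a = G b2" using rG by blast
  then have "b = G (a' + b2)" unfolding linear_add[OF lin] a'[symmetric] by (simp add: algebra_simps)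
  then obtain b' where b': "b = G b'" by blast
  define L :: "real^2 \<Rightarrow> real^2" where "L w = w$1 *\<^sub>R a' + w$2 *\<^sub>R b'" for w
  have linL: "linear L" by (rule linearI) (simp_all add: L_def algebra_simps)
  define D where "D = (\<lambda>x. (z' - a') + x) ` (L ` cball 0 1)"
  have conv: "convex D" unfolding D_def using linL by (intro convex_translation convex_linear_image) auto
  have "f -` E \<subseteq> D"
  proof
    fix x assume "x \<in> f -` E"
    then obtain u y where fx: "f x = z - u *\<^sub>R a + y *\<^sub>R b" "u\<^sup>2 + y\<^sup>2 = 2 * u"
      unfolding E_def ell_def by blast
    have "G (x - z') = G (- u *\<^sub>R a' + y *\<^sub>R b')"
      unfolding linear_add[OF lin] linear_scale[OF lin] a'[symmetric] b'[symmetric] by (simp add: G_def fx(1))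
    then have "x - z' = - u *\<^sub>R a' + y *\<^sub>R b'" using Gd[of "x - z'" "- u *\<^sub>R a' + y *\<^sub>R b'"] by simp
    then have "x = (z' - a') + L (vector [1 - u, y])" by (simp add: L_def algebra_simps)
    moreover have "(norm (vector [1 - u, y] :: real^2))\<^sup>2 = 1"
      unfolding power2_norm_eq_inner using fx(2) by (simp add: inner_vec_def sum_2 power2_eq_square algebra_simps)
    then have "norm (vector [1 - u, y] :: real^2) \<le> 1" unfolding power2_eq_1_iff by (smt (verit) norm_ge_zero)
    ultimately show "x \<in> D" unfolding D_def by auto
  qed
  then have sub: "inside (f -` E) \<subseteq> D" using inside_mono[of "f -` E" D] inside_convex[OF conv] by blast
  have meas: "L ` cball 0 1 \<in> lmeasurable" using linL by (intro measurable_linear_image) auto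
  have mD: "measure lebesgue D = \<bar>det (matrix L)\<bar> * measure lebesgue (cball (0::real^2) 1)"
    unfolding D_def measure_translation using measure_linear_image[OF linL] by simp
  have "measure lebesgue (inside (f -` E)) \<le> measure lebesgue D"
  proof (cases "inside (f -` E) \<in> sets lebesgue")
    case True
    have "D \<in> lmeasurable" unfolding D_def using meas by (rule measurable_translation)
    then show ?thesis using measure_mono_fmeasurable[OF sub True] by blast
  qed (simp add: measure_notin_sets)
  moreover have "\<bar>det (matrix L)\<bar> = norm (a \<times> b)"
  proof -
    have "(det (matrix L))\<^sup>2 = (a' \<bullet> a') * (b' \<bullet> b') - (a' \<bullet> b')\<^sup>2"
      by (simp add: det_2 matrix_def L_def axis_def inner_vec_def sum_2 power2_eq_square algebra_simps)
    also have "\<dots> = (norm (a \<times> b))\<^sup>2" unfolding norm_cross by (simp add: a' b' Gi power2_norm_eq_inner)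
    finally have "sqrt ((det (matrix L))\<^sup>2) = sqrt ((norm (a \<times> b))\<^sup>2)" by (rule arg_cong)
    then show ?thesis by simp
  qed
  ultimately show ?thesis using area mD by (simp add: E_def mult.commute)
qed

text \<open>
  The hypothesis of the theorem at one point, with the planes, areas and tangent lines translated into vectors.
\<close>
lemma transversal_large_sections_exist:
  fixes S :: "(real^3) set"
  assumes p: "p \<in> S"
    and "\<exists>H :: nat \<Rightarrow> (real^3) set.
           (\<forall>j\<in>{1..4}. plane (H j) \<and> p \<in> H j) \<and>
           (\<forall>j\<in>{1..4}. ellipse (H j \<inter> S) \<and> enclosed_area (H j \<inter> S) > \<alpha>) \<and>
           (\<forall>i\<in>{1..4}. \<forall>j\<in>{1..4}. i < j \<longrightarrow> \<not> tangent_at p (H i \<inter> S) (H j \<inter> S))"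
    and V: "V = measure lebesgue (cball (0::real^2) 1)" and \<delta>: "\<delta> = \<alpha> / V"
  shows "\<exists>A B. (\<forall>j\<in>{1..4::nat}. A j \<times> B j \<noteq> 0 \<and> large_section S \<delta> p (A j) (B j)) \<and>
     (\<forall>i\<in>{1..4}. \<forall>j\<in>{1..4}. i \<noteq> j \<longrightarrow> B i \<times> B j \<noteq> 0)"
proof -
  have V0: "V > 0" unfolding V by (simp add: content_cball_pos)
  obtain H :: "nat \<Rightarrow> (real^3) set" where H: "\<forall>j\<in>{1..4}. plane (H j) \<and> p \<in> H j"
    "\<forall>j\<in>{1..4}. ellipse (H j \<inter> S) \<and> enclosed_area (H j \<inter> S) > \<alpha>"
    "\<forall>i\<in>{1..4}. \<forall>j\<in>{1..4}. i < j \<longrightarrow> \<not> tangent_at p (H i \<inter> S) (H j \<inter> S)"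
    using assms(2) by blast
  have "\<exists>a b. a \<times> b \<noteq> 0 \<and> H j \<inter> S = ell p a b" if "j \<in> {1..4}" for j
  proof -
    have "ellipse (H j \<inter> S)" "p \<in> H j \<inter> S" using H that p by auto
    from ellipse_eq_ell[OF this] show ?thesis by metis
  qed
  then obtain A B where AB: "\<And>j. j \<in> {1..4} \<Longrightarrow> A j \<times> B j \<noteq> 0"
    "\<And>j. j \<in> {1..4} \<Longrightarrow> H j \<inter> S = ell p (A j) (B j)" by metis
  have "large_section S \<delta> p (A j) (B j)" if j: "j \<in> {1..4}" for j
  proof -
    have "H j = {x. (A j \<times> B j) \<bullet> (x - p) = 0}"
      using plane_of_ellipse[of "H j" "A j" "B j" p] H(1) AB j by blast
    then have "ell p (A j) (B j) = {x \<in> S. (A j \<times> B j) \<bullet> (x - p) = 0}" using AB(2)[OF j] by blast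
    moreover have "\<alpha> < enclosed_area (ell p (A j) (B j))" using H(2) j AB(2)[OF j] by metis
    then have "\<alpha> < V * norm (A j \<times> B j)" using enclosed_area_ell_le[OF AB(1)[OF j], of p] unfolding V by linarith
    then have "\<delta> \<le> norm (A j \<times> B j)" using V0 by (simp add: \<delta> field_simps)
    ultimately show ?thesis by (simp add: large_section_def)
  qed
  moreover have lt: "B i \<times> B j \<noteq> 0" if "i \<in> {1..4}" "j \<in> {1..4}" "i < j" for i j
    using not_tangent_imp_cross[OF AB(1)[OF that(1)] AB(1)[OF that(2)]] H(3) AB(2) that by metis
  have "B i \<times> B j \<noteq> 0" if "i \<in> {1..4}" "j \<in> {1..4}" "i \<noteq> j" for i j
  proof (cases "i < j")
    case False
    then have "B j \<times> B i \<noteq> 0" using lt that by auto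
    then show ?thesis by (subst cross_skew) simp
  qed (use lt that in auto)
  ultimately show ?thesis using AB(1) by blast
qed

section \<open>Convex bodies bounded by a quadric\<close>

text \<open>
  Gram--Schmidt for the inner product \<open>B\<close>, applied to the standard basis.
\<close>
lemma orthonormal_frame_of_bilinear:
  fixes B :: "real^3 \<Rightarrow> real^3 \<Rightarrow> real"
  assumes B: "bilinear B" and sym: "\<And>v w. B v w = B w v" and pos: "\<And>v. v \<noteq> 0 \<Longrightarrow> B v v > 0"
  obtains L :: "real^3 \<Rightarrow> real^3" where "linear L" "\<And>x. B (L x) (L x) = (norm x)\<^sup>2"
proof -
  define g1 :: "real^3" where "g1 = axis 1 1"
  define g2 :: "real^3" where "g2 = axis 2 1 - (B g1 (axis 2 1) / B g1 g1) *\<^sub>R g1"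
  define g3 :: "real^3" where "g3 = axis 3 1 - (B g1 (axis 3 1) / B g1 g1) *\<^sub>R g1 - (B g2 (axis 3 1) / B g2 g2) *\<^sub>R g2"
  note bs = bilinear_lsub[OF B] bilinear_rsub[OF B] bilinear_lmul[OF B] bilinear_rmul[OF B]
    bilinear_ladd[OF B] bilinear_radd[OF B]
  \<comment> \<open>The diagonal components stay 1, so none of these vectors is zero.\<close>
  have "g1 $ 1 = 1" "g2 $ 2 = 1" "g3 $ 3 = 1" by (simp_all add: g1_def g2_def g3_def axis_def)
  then have "g1 \<noteq> 0" "g2 \<noteq> 0" "g3 \<noteq> 0" by auto
  then have p: "B g1 g1 > 0" "B g2 g2 > 0" "B g3 g3 > 0" using pos by auto
  have o12: "B g1 g2 = 0" using p by (simp add: g2_def bs)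
  have o13: "B g1 g3 = 0" using p o12 by (simp add: g3_def bs)
  have o23: "B g2 g3 = 0" using p o12 sym[of g2 g1] by (simp add: g3_def bs)
  define s1 s2 s3 where "s1 = sqrt (B g1 g1)" and "s2 = sqrt (B g2 g2)" and "s3 = sqrt (B g3 g3)"
  have s: "s1 > 0" "s2 > 0" "s3 > 0" "B g1 g1 = s1\<^sup>2" "B g2 g2 = s2\<^sup>2" "B g3 g3 = s3\<^sup>2"
    using p by (auto simp: s1_def s2_def s3_def)
  define L :: "real^3 \<Rightarrow> real^3" where "L x = (x$1 / s1) *\<^sub>R g1 + (x$2 / s2) *\<^sub>R g2 + (x$3 / s3) *\<^sub>R g3" for x
  have "linear L" by (rule linearI) (simp_all add: L_def algebra_simps add_divide_distrib)
  moreover have "B (L x) (L x) = (norm x)\<^sup>2" for x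
  proof -
    have "B (L x) (L x) = (x$1 / s1)\<^sup>2 * B g1 g1 + (x$2 / s2)\<^sup>2 * B g2 g2 + (x$3 / s3)\<^sup>2 * B g3 g3"
      unfolding L_def bs using o12 o13 o23 sym[of g2 g1] sym[of g3 g1] sym[of g3 g2]
      by (simp add: power2_eq_square)
    also have "\<dots> = (x$1)\<^sup>2 + (x$2)\<^sup>2 + (x$3)\<^sup>2" using s by (simp add: power_divide)
    also have "\<dots> = (norm x)\<^sup>2" unfolding power2_norm_eq_inner by (simp add: inner_vec_def sum_3 power2_eq_square)
    finally show ?thesis .
  qed
  ultimately show ?thesis using that by blast
qed

lemma frontier_affine_image_cball:
  fixes L :: "real^3 \<Rightarrow> real^3"
  assumes "linear L" "inj L"
  shows "frontier ((\<lambda>x. c + L x) ` cball 0 1) = (\<lambda>x. c + L x) ` sphere 0 1"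
proof -
  have "compact (L ` cball 0 1)"
    using assms(1) by (intro compact_continuous_image linear_continuous_on) (auto simp: linear_conv_bounded_linear)
  then have "frontier (L ` cball 0 1) = L ` cball 0 1 - L ` ball 0 1"
    unfolding frontier_def
    using interior_injective_linear_image[OF assms, of "cball 0 1"]
    by (simp add: compact_imp_closed closure_closed interior_cball)
  also have "\<dots> = L ` (cball 0 1 - ball 0 1)" by (rule image_set_diff[OF assms(2), symmetric])
  also have "cball 0 1 - ball 0 1 = (sphere 0 1 :: (real^3) set)" by auto
  finally have "(+) c ` frontier (L ` cball 0 1) = (+) c ` L ` sphere 0 1" by simp
  then show ?thesis unfolding frontier_translation[symmetric] by (simp add: image_image)
qed

text \<open>
  Every line through the interior point \<open>o'\<close> meets the boundary on both sides of \<open>o'\<close>, so the quadratic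
  polynomial has a positive and a negative root on it; as its value at \<open>o'\<close> is negative, its leading
  coefficient is positive. The quadratic part is therefore positive definite and the quadric is an
  ellipsoid. Each ray from \<open>o'\<close> hits the quadric only once, so the boundary is all of it.
\<close>
lemma ellipsoid_if_frontier_in_quadric_neg:
  assumes K: "convex_body K" and C: "\<And>x. x \<in> frontier K \<Longrightarrow> quad C x = 0"
    and o': "o' \<in> interior K" "quad C o' < 0"
  shows "ellipsoid (frontier K)"
proof -
  have bd: "bounded K" using K by (simp add: convex_body_def compact_imp_bounded)
  define f0 where "f0 = quad C o'"
  define l where "l v = quad_deriv C o' v" for v
  define B where "B v w = polar C v w / 2" for v w
  have f0: "f0 < 0" using o' by (simp add: f0_def)
  have ray: "quad C (o' + t *\<^sub>R v) = f0 + t * l v + t\<^sup>2 * B v v" for t v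
    by (simp add: quad_ray f0_def l_def B_def)
  have hit: "\<exists>d>0. o' + d *\<^sub>R v \<in> frontier K \<and> f0 + d * l v + d\<^sup>2 * B v v = 0" if "v \<noteq> 0" for v
    using ray_to_frontier[OF bd o'(1) that] C ray by metis
  have lin: "linear l" unfolding l_def by (rule linear_quad_deriv)
  have bil: "bilinear B" unfolding bilinear_def B_def
    by (intro conjI allI linearI) (simp_all add: polar_simps add_divide_distrib)
  have pos: "B v v > 0" if v: "v \<noteq> 0" for v
  proof -
    obtain d1 where d1: "d1 > 0" "f0 + d1 * l v + d1\<^sup>2 * B v v = 0" using hit[OF v] by blast
    obtain d2 where d2: "d2 > 0" "f0 + d2 * l (- v) + d2\<^sup>2 * B (- v) (- v) = 0" using hit[of "- v"] v by auto
    have e2: "f0 - d2 * l v + d2\<^sup>2 * B v v = 0"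
      using d2(2) by (simp add: linear_neg[OF lin] bilinear_lneg[OF bil] bilinear_rneg[OF bil])
    \<comment> \<open>A combination of the two equations in which the linear term cancels.\<close>
    have "(d1 + d2) * (f0 + d1 * d2 * B v v)
        = d2 * (f0 + d1 * l v + d1\<^sup>2 * B v v) + d1 * (f0 - d2 * l v + d2\<^sup>2 * B v v)"
      by (simp add: power2_eq_square algebra_simps)
    also have "\<dots> = 0" unfolding d1(2) e2 by simp
    finally have "d1 * d2 * B v v = - f0" using d1(1) d2(1) by simp
    then have "0 < (d1 * d2) * B v v" using f0 by simp
    moreover have "0 < d1 * d2" using d1(1) d2(1) by simp
    ultimately show ?thesis using zero_less_mult_pos by blast
  qed
  have sym: "B v w = B w v" for v w by (simp add: B_def polar_commute)
  obtain L :: "real^3 \<Rightarrow> real^3" where L: "linear L" "\<And>x. B (L x) (L x) = (norm x)\<^sup>2"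
    using orthonormal_frame_of_bilinear[OF bil sym pos] by blast
  have injL: "inj L"
  proof -
    have "x = 0" if "L x = 0" for x using L(2)[of x] that bilinear_lzero[OF bil] by simp
    then show ?thesis using linear_injective_0[OF L(1)] by blast
  qed
  have surjL: "surj L" by (rule linear_injective_imp_surjective[OF L(1) injL refl])
  define w where "w = adjoint (l \<circ> L) 1"
  have w: "l (L y) = w \<bullet> y" for y
    using adjoint_works[OF linear_compose[OF L(1) lin], of y 1] by (simp add: w_def inner_commute)
  define R where "R = sqrt ((norm w)\<^sup>2 / 4 - f0)"
  have "(norm w)\<^sup>2 / 4 - f0 > 0" using f0 zero_le_power2[of "norm w"] by linarith
  then have R: "R > 0" "R\<^sup>2 = (norm w)\<^sup>2 / 4 - f0" by (simp_all add: R_def)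
  define w2 where "w2 = (1/2) *\<^sub>R w"
  \<comment> \<open>Completing the square, in coordinates where the quadratic part is \<open>norm y ^ 2\<close>.\<close>
  have q: "quad C (o' + L y) = (norm (y + w2))\<^sup>2 - R\<^sup>2" for y
  proof -
    have "quad C (o' + L y) = f0 + w \<bullet> y + (norm y)\<^sup>2" using ray[of 1 "L y"] w L(2) by simp
    also have "\<dots> = (norm (y + w2))\<^sup>2 - R\<^sup>2"
      unfolding R(2) w2_def by (simp add: power2_norm_eq_inner inner_add_left inner_add_right inner_commute)
    finally show ?thesis .
  qed
  define c where "c = o' - L w2"
  define L' where "L' x = L (R *\<^sub>R x)" for x
  have L': "linear L'" "inj L'"
  proof -
    show "linear L'" unfolding L'_def
      by (intro linearI) (simp_all add: linear_add[OF L(1)] linear_scale[OF L(1)] algebra_simps)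
    show "inj L'" using injL R(1) unfolding inj_def L'_def by (metis scaleR_left_imp_eq less_irrefl)
  qed
  have param: "c + L' x = o' + L (R *\<^sub>R x - w2)" for x
    by (simp add: c_def L'_def linear_diff[OF L(1)])
  have "frontier K = (\<lambda>x. c + L' x) ` sphere 0 1"
  proof
    show "frontier K \<subseteq> (\<lambda>x. c + L' x) ` sphere 0 1"
    proof
      fix x assume x: "x \<in> frontier K"
      obtain y where y: "x - o' = L y" using surjL by (meson surjE)
      then have xy: "x = o' + L y" by (simp add: algebra_simps)
      have "(norm (y + w2))\<^sup>2 = R\<^sup>2" using q[of y] C[OF x] xy by simp
      then have "norm (y + w2) = R" using R(1) by (simp add: power2_eq_iff_nonneg)
      then have m: "(1/R) *\<^sub>R (y + w2) \<in> sphere 0 1" using R(1) by simp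
      have "x = c + L' ((1/R) *\<^sub>R (y + w2))" unfolding param using R(1) xy by simp
      then show "x \<in> (\<lambda>x. c + L' x) ` sphere 0 1" by (rule image_eqI[OF _ m])
    qed
    show "(\<lambda>x. c + L' x) ` sphere 0 1 \<subseteq> frontier K"
    proof
      fix x assume "x \<in> (\<lambda>x. c + L' x) ` sphere 0 1"
      then obtain y where y: "norm y = 1" "x = c + L' y" by auto
      have "quad C x = 0" unfolding y(2) param q using y(1) by simp
      moreover then have "x \<noteq> o'" using o'(2) by auto
      ultimately have v: "x - o' \<noteq> 0" and e: "f0 + l (x - o') + B (x - o') (x - o') = 0" using ray[of 1 "x - o'"] by auto
      obtain d where d: "d > 0" "o' + d *\<^sub>R (x - o') \<in> frontier K"
        "f0 + d * l (x - o') + d\<^sup>2 * B (x - o') (x - o') = 0" using hit[OF v] by blast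
      \<comment> \<open>Both \<open>1\<close> and \<open>d\<close> are positive roots of one polynomial whose roots have a negative product.\<close>
      have "(1 - d) * (f0 - d * B (x - o') (x - o')) = (f0 + d * l (x - o') + d\<^sup>2 * B (x - o') (x - o'))
          - d * (f0 + l (x - o') + B (x - o') (x - o'))"
        by (simp add: power2_eq_square algebra_simps)
      also have "\<dots> = 0" unfolding d(3) e by simp
      finally have "d = 1 \<or> f0 = d * B (x - o') (x - o')" by simp
      moreover have "0 < d * B (x - o') (x - o')" using d(1) pos[OF v] by simp
      ultimately have "d = 1" using f0 by linarith
      then show "x \<in> frontier K" using d(2) by simp
    qed
  qed
  also have "\<dots> = frontier ((\<lambda>x. c + L' x) ` cball 0 1)" using frontier_affine_image_cball[OF L'] by simp
  finally show ?thesis unfolding ellipsoid_def solid_ellipsoid_def using L' by blast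
qed

lemma ellipsoid_if_frontier_in_quadric:
  assumes K: "convex_body K" and C: "C \<noteq> 0" "\<And>x. x \<in> frontier K \<Longrightarrow> quad C x = 0"
  shows "ellipsoid (frontier K)"
proof -
  have "interior K \<noteq> {}" using K by (simp add: convex_body_def)
  then obtain o' where o': "o' \<in> interior K" "quad C o' \<noteq> 0"
    using quad_0_on_open_imp[of "interior K" _ C] C(1) by blast
  then have neg: "quad C o' < 0 \<or> quad (- C) o' < 0" unfolding quad_minus by linarith
  have "\<And>x. x \<in> frontier K \<Longrightarrow> quad (- C) x = 0" using C(2) by (simp add: quad_minus)
  with neg show ?thesis
    using ellipsoid_if_frontier_in_quadric_neg[OF K _ o'(1)] C(2) by blast
qed

lemma connected_frontier_convex_body:
  fixes K :: "(real^3) set"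
  assumes "convex_body K"
  shows "connected (frontier K)"
proof -
  have K: "convex K" "bounded K" "interior K \<noteq> {}"
    using assms by (auto simp: convex_body_def compact_imp_bounded)
  then have "rel_frontier K = frontier K" "aff_dim K = 3"
    by (simp_all add: rel_frontier_nonempty_interior aff_dim_nonempty_interior)
  then show ?thesis using connected_sphere_gen[OF K(1,2)] by simp
qed

section \<open>The characterization of ellipsoids\<close>

theorem theorem1:
  fixes K :: "(real^3) set" and \<alpha> :: real
  assumes "convex_body K"
    and "C2_embedded_surface (frontier K)"
    and "\<alpha> > 0"
    and "\<forall>p\<in>frontier K. \<exists>H :: nat \<Rightarrow> (real^3) set.
           (\<forall>j\<in>{1..4}. plane (H j) \<and> p \<in> H j) \<and>
           (\<forall>j\<in>{1..4}. ellipse (H j \<inter> frontier K) \<and> enclosed_area (H j \<inter> frontier K) > \<alpha>) \<and>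
           (\<forall>i\<in>{1..4}. \<forall>j\<in>{1..4}. i < j \<longrightarrow>
              \<not> tangent_at p (H i \<inter> frontier K) (H j \<inter> frontier K))"
  shows "ellipsoid (frontier K)"
proof -
  define S where "S = frontier K"
  have cK: "closed K" "convex K" "bounded K"
    using assms(1) by (auto simp: convex_body_def compact_imp_closed compact_imp_bounded)
  have SK: "S \<subseteq> K" using cK frontier_subset_closed by (auto simp: S_def)
  define V where "V = measure lebesgue (cball (0::real^2) 1)"
  have V: "V > 0" unfolding V_def by (simp add: content_cball_pos)
  \<comment> \<open>Here \<open>V\<close> is the area of the unit disc.\<close>
  define \<delta> where "\<delta> = \<alpha> / V"
  have \<delta>: "\<delta> > 0" using assms(3) V by (simp add: \<delta>_def)
  have planes: "\<exists>A B. (\<forall>j\<in>{1..4::nat}. A j \<times> B j \<noteq> 0 \<and> large_section S \<delta> p (A j) (B j)) \<and>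
     (\<forall>i\<in>{1..4}. \<forall>j\<in>{1..4}. i \<noteq> j \<longrightarrow> B i \<times> B j \<noteq> 0)" if p: "p \<in> S" for p
    by (rule transversal_large_sections_exist[OF p _ V_def \<delta>_def]) (use assms(4) p in \<open>auto simp: S_def\<close>)
  have large: "\<exists>a b. large_section S \<delta> q a b" if "q \<in> S" for q
    using planes[OF that] by (metis atLeastAtMost_iff le_numeral_extra(4) one_le_numeral)
  have sup: "\<exists>n. n \<noteq> 0 \<and> (\<forall>w \<in> S. n \<bullet> (w - x) \<le> 0)" if x: "x \<in> S" for x
    using support_exists[OF assms(1) x[unfolded S_def]] SK by (metis subsetD)
  have loc: "\<exists>C n A B. C \<noteq> 0 \<and> n \<noteq> 0 \<and> four_sections S p n A B \<and>
      (\<forall>j\<in>{1..4}. \<forall>x \<in> ell p (A j) (B j). quad C x = 0) \<and> (\<exists>r>0. \<forall>x \<in> S. dist x p < r \<longrightarrow> quad C x = 0)"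
    if p: "p \<in> S" for p
  proof -
    have pK: "p \<in> frontier K" using p S_def by simp
    have "\<exists>n. n \<noteq> 0 \<and> (\<forall>w \<in> K. n \<bullet> (w - p) \<le> 0)" using support_exists[OF assms(1) pK] by metis
    then obtain n where n: "n \<noteq> 0" "\<And>w. w \<in> K \<Longrightarrow> n \<bullet> (w - p) \<le> 0" by blast
    have nS: "\<forall>w \<in> S. n \<bullet> (w - p) \<le> 0" using n(2) SK by blast
    obtain T where T: "osculates S p n T"
      using C2_surface_second_order[OF assms(2) pK, of n] nS unfolding S_def by blast
    obtain A B where AB: "\<forall>j\<in>{1..4::nat}. A j \<times> B j \<noteq> 0 \<and> large_section S \<delta> p (A j) (B j)"
      "\<forall>i\<in>{1..4}. \<forall>j\<in>{1..4}. i \<noteq> j \<longrightarrow> B i \<times> B j \<noteq> 0" using planes[OF p] by blast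
    have "section_at S p n (A j) (B j)" if "j \<in> {1..4}" for j
      using section_at_normal[OF cK(1,2) n, of "A j" "B j"] AB(1) that by (simp add: S_def large_section_def)
    then have four: "four_sections S p n A B" using AB(2) by (simp add: four_sections_def)
    have "\<exists>C. C \<noteq> 0 \<and> (\<forall>j\<in>{1..4}. \<forall>x \<in> ell p (A j) (B j). quad C x = 0) \<and>
        (\<forall>a b. ell p a b \<subseteq> S \<longrightarrow> quad_deriv C p b = 0 \<and> polar C b b = quad_deriv C p a)"
    proof (rule quad_through_four_sections[OF sup n(1) nS T four])
      fix C assume "C \<noteq> 0" "\<And>j. j \<in> {1..4} \<Longrightarrow> \<forall>x \<in> ell p (A j) (B j). quad C x = 0"
        "\<And>a b. ell p a b \<subseteq> S \<Longrightarrow> quad_deriv C p b = 0 \<and> polar C b b = quad_deriv C p a"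
      then show "\<exists>C. C \<noteq> 0 \<and> (\<forall>j\<in>{1..4}. \<forall>x \<in> ell p (A j) (B j). quad C x = 0) \<and>
        (\<forall>a b. ell p a b \<subseteq> S \<longrightarrow> quad_deriv C p b = 0 \<and> polar C b b = quad_deriv C p a)"
        by (intro exI[of _ C] conjI ballI allI impI) auto
    qed
    then obtain C where C: "C \<noteq> 0" "\<And>j. j \<in> {1..4} \<Longrightarrow> \<forall>x \<in> ell p (A j) (B j). quad C x = 0"
      "\<And>a b. ell p a b \<subseteq> S \<Longrightarrow> quad_deriv C p b = 0 \<and> polar C b b = quad_deriv C p a" by blast
    have "\<exists>r>0. \<forall>x \<in> S. dist x p < r \<longrightarrow> quad C x = 0"
      unfolding S_def
      by (rule quad_0_near[OF assms(1) pK \<delta> n T[unfolded S_def] four[unfolded S_def] C(2) C(3)[unfolded S_def] large[unfolded S_def]])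
    then show ?thesis using C(1,2) n(1) four by blast
  qed
  then have "\<forall>p\<in>S. \<exists>C n A B. C \<noteq> 0 \<and> n \<noteq> 0 \<and> four_sections S p n A B \<and>
      (\<forall>j\<in>{1..4}. \<forall>x \<in> ell p (A j) (B j). quad C x = 0) \<and> (\<exists>r>0. \<forall>x \<in> S. dist x p < r \<longrightarrow> quad C x = 0)"
    by blast
  then obtain C n A B where *: "\<forall>p\<in>S. C p \<noteq> 0 \<and> n p \<noteq> 0 \<and> four_sections S p (n p) (A p) (B p) \<and>
      (\<forall>j\<in>{1..4}. \<forall>x \<in> ell p (A p j) (B p j). quad (C p) x = 0) \<and>
      (\<exists>r>0. \<forall>x \<in> S. dist x p < r \<longrightarrow> quad (C p) x = 0)"
    unfolding bchoice_iff by (elim exE) (rule that)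
  have C: "\<And>p. p \<in> S \<Longrightarrow> C p \<noteq> 0" "\<And>p. p \<in> S \<Longrightarrow> n p \<noteq> 0"
    and four: "\<And>p. p \<in> S \<Longrightarrow> four_sections S p (n p) (A p) (B p)"
    and CE: "\<And>p j. p \<in> S \<Longrightarrow> j \<in> {1..4} \<Longrightarrow> \<forall>x \<in> ell p (A p j) (B p j). quad (C p) x = 0"
    and Cnear: "\<And>p. p \<in> S \<Longrightarrow> \<exists>r>0. \<forall>x \<in> S. dist x p < r \<longrightarrow> quad (C p) x = 0"
    using bspec[OF *] by simp_all
  \<comment> \<open>The quadrics chosen at nearby points agree: the one at \<open>p\<close> contains arcs of the sections through \<open>y\<close>, hence these sections, and they determine the quadric.\<close>
  define Z where "Z p = {x. quad (C p) x = 0}" for p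
  have const: "\<forall>p\<in>S. eventually (\<lambda>y. Z p = Z y) (at p within S)"
  proof
    fix p assume p: "p \<in> S"
    obtain r where r: "r > 0" "\<forall>x \<in> S. dist x p < r \<longrightarrow> quad (C p) x = 0" using Cnear[OF p] by blast
    have "Z p = Z y" if y: "y \<in> S" "dist y p < r" for y
    proof -
      have sec: "section_at S y (n y) (A y j) (B y j)" if "j \<in> {1..4}" for j
        using four[OF y(1)] that by (simp add: four_sections_def)
      have BB: "B y 1 \<times> B y 2 \<noteq> 0" "B y 1 \<times> B y 3 \<noteq> 0" "B y 2 \<times> B y 3 \<noteq> 0"
        using four[OF y(1)] by (auto simp: four_sections_def)
      have on: "\<forall>x \<in> ell y (A y j) (B y j). quad (C p) x = 0" if j: "j \<in> {1..4}" for j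
      proof (rule quad_0_on_ell_if_near)
        show "r - dist y p > 0" using y by simp
        fix x assume x: "x \<in> ell y (A y j) (B y j)" "dist x y < r - dist y p"
        have "x \<in> S" using sec[OF j] x(1) by (auto simp: section_at_def)
        moreover have "dist x p < r" using x(2) dist_triangle[of x p y] by linarith
        ultimately show "quad (C p) x = 0" using r(2) by blast
      qed
      show ?thesis unfolding Z_def
        using quadric_through_three_sections_unique[OF C(2)[OF y(1)] sec[of 1] sec[of 2] sec[of 3] BB on[of 1] on[of 2] on[of 3]
            CE[OF y(1), of 1] CE[OF y(1), of 2] CE[OF y(1), of 3] C(1)[OF p] C(1)[OF y(1)]] by auto
    qed
    then show "eventually (\<lambda>y. Z p = Z y) (at p within S)"
      unfolding eventually_at using r(1) by blast
  qed
  have conn: "connected S" unfolding S_def by (rule connected_frontier_convex_body[OF assms(1)])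
  have "S \<noteq> {}"
    using assms(1) unfolding S_def convex_body_def
    by (metis compact_imp_bounded frontier_not_empty interior_empty not_bounded_UNIV)
  then obtain p0 where p0: "p0 \<in> S" by blast
  have "quad (C p0) x = 0" if x: "x \<in> S" for x
  proof -
    have "Z p0 = Z x" by (rule connected_local_const[OF conn p0 x const])
    moreover have "x \<in> Z x" using Cnear[OF x] x by (auto simp: Z_def)
    ultimately show ?thesis by (auto simp: Z_def)
  qed
  then show ?thesis using ellipsoid_if_frontier_in_quadric[OF assms(1) C(1)[OF p0]] S_def by blast
qed

end
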